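(* There is a universal constant $c>0$ such that the following holds. Let $(d_n)_{n\ge1}$ be a sequence of positive integers, let $A_n$ be a real $d_n\times d_n$ matrix for each $n$, and let $(\epsilon_n)_{n\ge 1}$ be independent random matrices, with $\epsilon_n$ uniformly distributed on the orthogonal group $O_{d_n}$ with respect to Haar measure. Let $s$ be the sequence obtained by listing the singular values of each $A_n$, repeating each singular value $d_n$ times, combining these into one list and rearranging it into decreasing order. Put $S_\epsilon=\sum_{n=1}^\infty d_n\,\mathrm{tr}(\epsilon_nA_n)$. Then for all $t>0$: (i) $\Pr\big(S_\epsilon> c\,K_{1,2}(t,s)\big)\le c\,e^{-c^{-1}t^2}$; (ii) $\Pr\big(S_\epsilon> c^{-1}K_{1,2}(t,s)\big)\ge c^{-1}e^{-ct^2}$.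
   Context: For a sequence $a=(a_n)$ and $t>0$, the $K$-functional of $a$ with respect to $\ell_1$ and $\ell_2$ is $K_{1,2}(t,a)=\inf\{\|a'\|_1+t\|a''\|_2 : a'+a''=a\}$. The singular values of a matrix $A$ are the eigenvalues of $\sqrt{A^*A}$ (with multiplicity), where $A^*$ is the transpose of $A$. The sequence $s=(s_m)_{m\ge1}$ is padded with zeros if it has only finitely many terms; $\|s\|_2^2=\sum_n d_n\|A_n\|_2^2$, where $\|A_n\|_2$ is the Hilbert–Schmidt norm. Infinite random sums are treated without full rigor: the convention is that the random series is taken to converge when the relevant norm (here $\|s\|_2$) is finite.
   Formalization: Part (ii) is stated only when s is not identically zero, since it fails when all A_n = 0 (then S = K = 0). The constant c is stated for probability spaces on one arbitrary fixed underlying type; taking the space of matrix sequences gives a universal c, as only the joint law matters. *)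

theory Defs
  imports
    "HOL-Probability.Probability"
    "Jordan_Normal_Form.Char_Poly"
begin

definition mat_trace :: "real mat \<Rightarrow> real" where
  "mat_trace B = (\<Sum>i<dim_row B. B $$ (i, i))"

definition symmetric_psd_mat :: "real mat \<Rightarrow> bool" where
  "symmetric_psd_mat B \<longleftrightarrow>
     square_mat B \<and> transpose_mat B = B \<and>
     (\<forall>v \<in> carrier_vec (dim_row B). v \<bullet> (B *\<^sub>v v) \<ge> 0)"

(* The square root of a symmetric positive semidefinite matrix is the unique
   matrix of the same kind whose square is the given one. *)
definition psd_sqrt :: "real mat \<Rightarrow> real mat" where
  "psd_sqrt P = (THE B. symmetric_psd_mat B \<and> B * B = P)"

(* Eigenvalues as roots of the characteristic polynomial; the multiplicity is the
   order of the root. *)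
definition singular_values :: "real mat \<Rightarrow> real multiset" where
  "singular_values A = proots (char_poly (psd_sqrt (transpose_mat A * A)))"

(* s is nonincreasing, and every x > 0 occurs in s exactly as often as in the list that
   contains, for every n, each singular value of A n (with its multiplicity) d n times.
   The sum below is a convergent series of natural numbers, so only finitely many of its
   terms are nonzero.  The value 0 is not counted: it is only used for padding, when the
   combined list has finitely many positive entries. *)
definition decreasing_singular_values ::
    "(nat \<Rightarrow> nat) \<Rightarrow> (nat \<Rightarrow> real mat) \<Rightarrow> (nat \<Rightarrow> real) \<Rightarrow> bool" where
  "decreasing_singular_values d A s \<longleftrightarrow>
     decseq s \<and> (\<forall>m. s m \<ge> 0) \<and>
     (\<forall>x>0. finite {m. s m = x} \<and>
        (\<lambda>n. d n * count (singular_values (A n)) x) sums card {m. s m = x})"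

(* Decompositions in which one of the two norms is infinite do not affect the infimum and
   are left out.  The remaining set is nonempty exactly when a is square summable, so the
   value is meaningful only for such a. *)
definition K12 :: "real \<Rightarrow> (nat \<Rightarrow> real) \<Rightarrow> real" where
  "K12 t a = Inf {(\<Sum>m. \<bar>b m\<bar>) + t * sqrt (\<Sum>m. (c m)\<^sup>2) | b c.
     summable (\<lambda>m. \<bar>b m\<bar>) \<and> summable (\<lambda>m. (c m)\<^sup>2) \<and> (\<forall>m. b m + c m = a m)}"

(* Not to be confused with the library predicate orthogonal_mat, which only asks for
   nonzero, pairwise orthogonal columns. *)
definition orthogonal_group :: "nat \<Rightarrow> real mat set" where
  "orthogonal_group d = {U \<in> carrier_mat d d. transpose_mat U * U = 1\<^sub>m d}"

(* The Borel sigma-algebra of the orthogonal group as a subspace of the real d x d matrices: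
   it is generated by the matrix entries. *)
definition orthogonal_borel :: "nat \<Rightarrow> real mat measure" where
  "orthogonal_borel d =
     vimage_algebra (orthogonal_group d)
       (\<lambda>U. \<lambda>ij \<in> {..<d} \<times> {..<d}. U $$ ij)
       (\<Pi>\<^sub>M ij \<in> {..<d} \<times> {..<d}. borel)"

(* Normalised Haar measure: the (unique) translation invariant Borel probability measure. *)
definition haar_orthogonal :: "nat \<Rightarrow> real mat measure \<Rightarrow> bool" where
  "haar_orthogonal d \<mu> \<longleftrightarrow>
     prob_space \<mu> \<and> sets \<mu> = sets (orthogonal_borel d) \<and>
     (\<forall>U \<in> orthogonal_group d. distr \<mu> \<mu> (\<lambda>V. U * V) = \<mu>)"

(* If the eps n are independent and Haar distributed and the sequence of singular values of
   the A n is square summable, this series converges almost surely; the unspecified value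
   of suminf on the remaining null set is irrelevant. *)
definition orthogonal_series ::
    "(nat \<Rightarrow> nat) \<Rightarrow> (nat \<Rightarrow> real mat) \<Rightarrow> (nat \<Rightarrow> 'w \<Rightarrow> real mat) \<Rightarrow> 'w \<Rightarrow> real" where
  "orthogonal_series d A eps \<omega> = (\<Sum>n. real (d n) * mat_trace (eps n \<omega> * A n))"

end

theory Submission
  imports Defs "Jordan_Normal_Form.Spectral_Radius"
begin

text \<open>
  After a singular value decomposition of each \<open>A n\<close> and by invariance of Haar measure, the series
  becomes \<open>\<Sum> d n * \<sigma> n i * E i i\<close>, where \<open>E\<close> are the entries of independent Haar matrices. Everything
  rests on three bounds for \<open>F(x) = ln (\<integral> exp (d * \<Sum> x i * E i i))\<close> on a single orthogonal group:
  \<open>F(x) \<le> 2 d \<bar>x\<bar>\<^sup>2\<close> always, \<open>F(x) \<ge> d \<bar>x\<bar>\<^sup>2 / 4\<close> when all \<open>\<bar>x i\<bar> \<le> 1/16\<close>, and linear growth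
  \<open>F(x) \<ge> d (\<Sum>\<^sub>S x / 64 - card S / 1024)\<close> for nonnegative \<open>x\<close> supported on \<open>S\<close>. The first two come from
  integrating derivatives along plane rotations, which is a Stein identity for the tilted measure
  \<open>exp (\<theta> * d * \<Sum> x i * E i i)\<close> and yields a differential inequality in \<open>\<theta>\<close>. The third follows from the
  second, because \<open>F\<close> is convex and invariant under permutations of \<open>x\<close>.

  For (i), split the singular values as in the \<open>K\<close>-functional: the \<open>\<ell>\<^sub>1\<close>-part is bounded surely, the
  \<open>\<ell>\<^sub>2\<close>-part is subgaussian. For (ii), cut at \<open>\<tau> = s (\<lfloor>t\<^sup>2\<rfloor> - 1)\<close>. If the values above \<open>\<tau>\<close> dominate, linear growth
  gives the lower tail, since there are at most \<open>t\<^sup>2\<close> of them; otherwise \<open>t * \<tau>\<close> is at most a multiple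
  of the \<open>\<ell>\<^sub>2\<close>-norm of the rest, so the quadratic lower bound applies up to the required \<open>\<theta>\<close> and a
  Paley-Zygmund argument gives the tail. The other part of the series is removed by flipping its
  sign, which preserves the law.
\<close>

unbundle no vec_syntax

section \<open>Singular value decomposition\<close>

text \<open>Independence is available only between different matrices; the entries of one Haar
  matrix are dependent, so each block needs exponential moment bounds with constants free of the
  dimension. The factor \<open>d\<close> makes this fit the statement: \<open>d * E i i\<close> has
  variance \<open>d\<close>, and an exponent of order d |x|^2 is the contribution of a list that
  repeats every \<open>x i\<close> exactly \<open>d\<close> times, which is how \<open>s\<close> is
  formed. No quadratic lower bound can hold for all \<open>x\<close>, since |E i i| <= 1 lets F grow
  at most linearly. Hence the restriction to |x i| <= 1/16 and the need for linear growth beyond it;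
  the two regimes mirror the two norms in the K-functional. The Stein identity contains the trace of
  (XU)^2 with X = diag(x). Its trivial bound |x|^2 suffices from above but cancels everything from
  below, so a second identity has to halve it in tilted mean; 1/16 and \<open>d \<ge> 4\<close> come
  from there. Paley-Zygmund loses an additive ln 2 in the exponent, which is harmless only for large
  \<open>t\<close>; the threshold \<open>t = 256\<close>, and with it the enormous final constant,
  have this origin.\<close>

lemma square_mat_simps [simp]:
  fixes A B :: "real mat"
  assumes "A \<in> carrier_mat n n"
  shows "A * 1\<^sub>m n = A" "1\<^sub>m n * A = A" "B \<in> carrier_mat n n \<Longrightarrow> A * B \<in> carrier_mat n n"
  using assms by auto

lemma orthogonal_groupD:
  assumes "U \<in> orthogonal_group n"
  shows "U \<in> carrier_mat n n" "transpose_mat U * U = 1\<^sub>m n" "U * transpose_mat U = 1\<^sub>m n"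
proof -
  show 1: "U \<in> carrier_mat n n" "transpose_mat U * U = 1\<^sub>m n"
    using assms by (auto simp: orthogonal_group_def)
  show "U * transpose_mat U = 1\<^sub>m n"
    using mat_mult_left_right_inverse[of "transpose_mat U" n U] 1 by auto
qed

lemma orthogonal_group_transpose: "U \<in> orthogonal_group n \<Longrightarrow> transpose_mat U \<in> orthogonal_group n"
  using orthogonal_groupD(1,3)[of U n] unfolding orthogonal_group_def by simp

lemma orthogonal_group_one: "1\<^sub>m n \<in> orthogonal_group n"
  by (auto simp: orthogonal_group_def)

lemma orthogonal_group_mult:
  assumes "U \<in> orthogonal_group n" "V \<in> orthogonal_group n"
  shows "U * V \<in> orthogonal_group n"
proof -
  note U = orthogonal_groupD[OF assms(1)] and V = orthogonal_groupD[OF assms(2)]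
  have "transpose_mat (U * V) * (U * V) = transpose_mat V * ((transpose_mat U * U) * V)"
    using U(1) V(1) by (simp add: transpose_mult[of _ n n _ n] assoc_mult_mat[of _ n n _ n _ n])
  then show ?thesis using U V by (auto simp: orthogonal_group_def)
qed

lemma mat_mult_entry:
  assumes "A \<in> carrier_mat n n" "B \<in> carrier_mat n n" "i < n" "j < n"
  shows "(A * B) $$ (i, j) = (\<Sum>k<n. A $$ (i, k) * B $$ (k, j))"
  using assms by (auto simp: scalar_prod_def lessThan_atLeast0 intro!: sum.cong)

lemma orthogonal_group_cols:
  assumes "U \<in> orthogonal_group n" "i < n" "j < n"
  shows "(\<Sum>k<n. U $$ (k, i) * U $$ (k, j)) = (if i = j then 1 else 0)"
proof -
  note U = orthogonal_groupD[OF assms(1)]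
  have "(transpose_mat U * U) $$ (i, j) = (\<Sum>k<n. U $$ (k, i) * U $$ (k, j))"
    using U(1) assms(2,3) by (subst mat_mult_entry[of _ n]) auto
  then show ?thesis using U(2) assms by auto
qed

lemma orthogonal_groupI:
  assumes "U \<in> carrier_mat n n"
    and "\<And>i j. i < n \<Longrightarrow> j < n \<Longrightarrow> (\<Sum>k<n. U $$ (k, i) * U $$ (k, j)) = (if i = j then 1 else 0)"
  shows "U \<in> orthogonal_group n"
  unfolding orthogonal_group_def
proof (safe intro!: assms(1) eq_matI)
  fix i j assume "i < dim_row (1\<^sub>m n :: real mat)" "j < dim_col (1\<^sub>m n :: real mat)"
  then have ij: "i < n" "j < n" by auto
  have "(transpose_mat U * U) $$ (i, j) = (\<Sum>k<n. U $$ (k, i) * U $$ (k, j))"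
    using ij assms(1) by (subst mat_mult_entry[of _ n]) auto
  then show "(transpose_mat U * U) $$ (i, j) = 1\<^sub>m n $$ (i, j)"
    using assms(2)[OF ij] ij by auto
qed (use assms(1) in auto)

lemma orthogonal_group_entry_le:
  assumes "U \<in> orthogonal_group n" "i < n" "j < n"
  shows "\<bar>U $$ (i, j)\<bar> \<le> 1"
proof -
  have "(U $$ (i, j))\<^sup>2 \<le> (\<Sum>k<n. (U $$ (k, j))\<^sup>2)"
    by (rule member_le_sum[of i]) (use assms in auto)
  also have "\<dots> = 1"
    using orthogonal_group_cols[OF assms(1,3,3)] by (simp add: power2_eq_square)
  finally show ?thesis by (simp add: abs_square_le_1)
qed

text \<open>Householder reflection mapping the first unit vector to \<open>v\<close>.\<close>

lemma orthogonal_group_with_column: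
  assumes v: "v \<in> carrier_vec n" and "(\<Sum>i<n. (v $ i)\<^sup>2) = (1::real)" and "n > 0"
  shows "\<exists>H \<in> orthogonal_group n. col H 0 = v"
proof (cases "v = unit_vec n 0")
  case True
  then show ?thesis using orthogonal_group_one[of n] \<open>n > 0\<close> by (intro bexI[of _ "1\<^sub>m n"]) auto
next
  case False
  define w where "w i = v $ i - (if i = 0 then 1 else 0)" for i
  define W where "W = (\<Sum>i<n. (w i)\<^sup>2)"
  define H where "H = Matrix.mat n n (\<lambda>(i,j). (if i = j then 1 else 0) - 2 * w i * w j / W)"
  have "W = (\<Sum>i<n. (v $ i)\<^sup>2 + (if i = 0 then 1 - 2 * v $ i else 0))"
    unfolding W_def w_def by (rule sum.cong) (auto simp: power2_eq_square algebra_simps)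
  also have "\<dots> = 2 - 2 * v $ 0"
    using assms(2,3) by (simp add: sum.distrib sum.delta)
  finally have W: "W = 2 - 2 * v $ 0" .
  have "W \<noteq> 0"
  proof
    assume "W = 0"
    then have "\<forall>i<n. w i = 0" unfolding W_def by (subst (asm) sum_nonneg_eq_0_iff) auto
    then have "v = unit_vec n 0" using v by (intro eq_vecI) (auto simp: w_def unit_vec_def)
    with False show False by simp
  qed
  have "H \<in> orthogonal_group n"
  proof (rule orthogonal_groupI)
    show "H \<in> carrier_mat n n" by (simp add: H_def)
    fix i j assume ij: "i < n" "j < n"
    have "(\<Sum>k<n. H $$ (k, i) * H $$ (k, j)) = (\<Sum>k<n. (if k = i then (if i = j then 1 else 0) else 0)
        - (if k = i then 2 * w i * w j / W else 0) - (if k = j then 2 * w i * w j / W else 0)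
        + 4 * w i * w j / W\<^sup>2 * (w k)\<^sup>2)"
      using ij by (intro sum.cong) (auto simp: H_def algebra_simps power2_eq_square)
    also have "\<dots> = (if i = j then 1 else 0) - 4 * w i * w j / W + 4 * w i * w j / W\<^sup>2 * W"
      using ij by (simp add: sum.distrib sum_subtractf W_def sum_distrib_left sum_divide_distrib mult.assoc)
    also have "\<dots> = (if i = j then 1 else 0)"
      using \<open>W \<noteq> 0\<close> by (simp add: power2_eq_square)
    finally show "(\<Sum>k<n. H $$ (k, i) * H $$ (k, j)) = (if i = j then 1 else 0)" .
  qed
  moreover have "col H 0 = v"
  proof (rule eq_vecI)
    fix i assume "i < dim_vec v"
    then have i: "i < n" using v by auto
    \<comment> \<open>\<open>w\<close> is \<open>v\<close> minus the first unit vector. Since -2 (w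
      0) / W = 1, the first column of the reflection is that unit vector plus \<open>w\<close>,
      which is \<open>v\<close>.\<close>
    have "w 0 = - W / 2" using W \<open>n > 0\<close> by (simp add: w_def)
    then have "H $$ (i, 0) = (if i = 0 then 1 else 0) + w i"
      using i \<open>n > 0\<close> \<open>W \<noteq> 0\<close> by (auto simp: H_def)
    then show "col H 0 $ i = v $ i" using i \<open>n > 0\<close> by (auto simp: w_def H_def)
  qed (use v in \<open>auto simp: H_def\<close>)
  ultimately show ?thesis by blast
qed

section \<open>Deflation, the spectral theorem and the singular value decomposition\<close>

abbreviation bordered :: "nat \<Rightarrow> real \<Rightarrow> real mat \<Rightarrow> real mat" where
  "bordered n c B \<equiv> four_block_mat (c \<cdot>\<^sub>m 1\<^sub>m 1) (0\<^sub>m 1 n) (0\<^sub>m n 1) B"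

lemma bordered_mult:
  assumes "B \<in> carrier_mat n n" "C \<in> carrier_mat n n"
  shows "bordered n a B * bordered n b C = bordered n (a * b) (B * C)"
  by (subst mult_four_block_mat[of _ 1 1 _ n _ n _ _ 1 _ n]) (use assms in auto)

lemma bordered_transpose:
  assumes "B \<in> carrier_mat n n"
  shows "transpose_mat (bordered n a B) = bordered n a (transpose_mat B)"
  by (subst transpose_four_block_mat[of _ 1 1 _ n _ n]) (use assms in auto)

lemma bordered_carrier: "B \<in> carrier_mat n n \<Longrightarrow> bordered n a B \<in> carrier_mat (Suc n) (Suc n)"
  using four_block_carrier_mat[of "a \<cdot>\<^sub>m 1\<^sub>m 1" 1 1 B n n "0\<^sub>m 1 n" "0\<^sub>m n 1"] by simp

lemma bordered_one: "bordered n 1 (1\<^sub>m n) = 1\<^sub>m (Suc n)"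
  by (rule eq_matI) auto

lemma bordered_orthogonal:
  assumes "B \<in> orthogonal_group n"
  shows "bordered n 1 B \<in> orthogonal_group (Suc n)"
proof -
  note B = orthogonal_groupD[OF assms]
  have "transpose_mat (bordered n 1 B) * bordered n 1 B = 1\<^sub>m (Suc n)"
    unfolding bordered_transpose[OF B(1)] using B by (subst bordered_mult) (auto simp: bordered_one[simplified])
  then show ?thesis using bordered_carrier[OF B(1)] unfolding orthogonal_group_def by blast
qed

lemma bordered_diag:
  "bordered n c (mat_diag n f) = mat_diag (Suc n) (case_nat c f)"
  by (rule eq_matI) (auto simp: mat_diag_def split: nat.splits)

text \<open>\<open>col K 0\<close> and \<open>col H 0\<close> form a singular pair with value
  \<open>c\<close>. The first equation clears the first column below the corner, because the columns
  of \<open>H\<close> are orthonormal; the transposed equation clears the first row. With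
  \<open>H = K\<close> this is the induction step of the spectral theorem, with different
  \<open>H\<close> and \<open>K\<close> that of the singular value decomposition.\<close>

lemma deflation:
  assumes A: "A \<in> carrier_mat (Suc n) (Suc n)"
    and H: "H \<in> orthogonal_group (Suc n)" "K \<in> orthogonal_group (Suc n)"
    and 1: "A *\<^sub>v col K 0 = c \<cdot>\<^sub>v col H 0" and 2: "transpose_mat A *\<^sub>v col H 0 = c \<cdot>\<^sub>v col K 0"
  shows "\<exists>B \<in> carrier_mat n n. transpose_mat H * A * K = bordered n c B"
proof -
  note HD = orthogonal_groupD[OF H(1)] and KD = orthogonal_groupD[OF H(2)]
  define M where "M = transpose_mat H * A * K"
  have M: "M \<in> carrier_mat (Suc n) (Suc n)" using HD KD A by (auto simp: M_def)
  have col0: "M $$ (i, 0) = (if i = 0 then c else 0)" if "i < Suc n" for i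
  proof -
    have "M = transpose_mat H * (A * K)"
      unfolding M_def using HD KD A by (simp add: assoc_mult_mat[of _ "Suc n" "Suc n" _ "Suc n" _ "Suc n"])
    then have "M $$ (i, 0) = col H i \<bullet> col (A * K) 0" using that HD KD A by auto
    also have "col (A * K) 0 = A *\<^sub>v col K 0"
      using A KD by (intro col_mult2[of _ "Suc n" "Suc n" _ "Suc n"]) auto
    also have "col H i \<bullet> (A *\<^sub>v col K 0) = c * (col H i \<bullet> col H 0)"
      using that HD KD unfolding 1 by (subst scalar_prod_smult_right) auto
    also have "col H i \<bullet> col H 0 = (\<Sum>k<Suc n. H $$ (k, i) * H $$ (k, 0))"
      using that HD(1) by (auto simp: scalar_prod_def lessThan_atLeast0 intro!: sum.cong)
    also have "\<dots> = (if i = 0 then 1 else 0)" by (rule orthogonal_group_cols[OF H(1)]) (use that in auto)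
    finally show ?thesis by simp
  qed
  have row0: "M $$ (0, j) = (if j = 0 then c else 0)" if "j < Suc n" for j
  proof -
    have "transpose_mat M = transpose_mat K * (transpose_mat A * H)"
      unfolding M_def using HD KD A
      by (simp add: transpose_mult[of _ "Suc n" "Suc n" _ "Suc n"])
    then have "M $$ (0, j) = (transpose_mat K * (transpose_mat A * H)) $$ (j, 0)"
      using that M by (metis carrier_matD index_transpose_mat(1) zero_less_Suc)
    also have "\<dots> = col K j \<bullet> col (transpose_mat A * H) 0" using that HD KD A by auto
    also have "col (transpose_mat A * H) 0 = transpose_mat A *\<^sub>v col H 0"
      using A HD by (intro col_mult2[of _ "Suc n" "Suc n" _ "Suc n"]) auto
    also have "col K j \<bullet> (transpose_mat A *\<^sub>v col H 0) = c * (col K j \<bullet> col K 0)"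
      using that HD KD unfolding 2 by (subst scalar_prod_smult_right) auto
    also have "col K j \<bullet> col K 0 = (\<Sum>k<Suc n. K $$ (k, j) * K $$ (k, 0))"
      using that KD(1) by (auto simp: scalar_prod_def lessThan_atLeast0 intro!: sum.cong)
    also have "\<dots> = (if j = 0 then 1 else 0)" by (rule orthogonal_group_cols[OF H(2)]) (use that in auto)
    finally show ?thesis by simp
  qed
  define B where "B = Matrix.mat n n (\<lambda>(i,j). M $$ (Suc i, Suc j))"
  have "M = bordered n c B"
  proof (rule eq_matI)
    fix i j assume ij: "i < dim_row (bordered n c B)" "j < dim_col (bordered n c B)"
    then have "i < Suc n" "j < Suc n" by (auto simp: B_def)
    with ij show "M $$ (i, j) = bordered n c B $$ (i, j)"
      using col0 row0 by (cases i; cases j) (auto simp: B_def)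
  qed (use M in \<open>auto simp: B_def\<close>)
  then show ?thesis by (intro bexI[of _ B]) (auto simp: M_def B_def)
qed

text \<open>Over the complex numbers an eigenvalue \<open>k\<close> exists. Symmetry makes the
  quadratic form \<open>S\<close> at the eigenvector real, and it equals \<open>k\<close> times the
  positive number \<open>Z\<close>, so \<open>k\<close> is real. It is then a root of the real
  characteristic polynomial, which yields a real eigenvector to normalise.\<close>

lemma symmetric_real_eigenvector:
  assumes A: "A \<in> carrier_mat (Suc n) (Suc n)" and sym: "transpose_mat A = (A :: real mat)"
  obtains v c where "v \<in> carrier_vec (Suc n)" "(\<Sum>i<Suc n. (v $ i)\<^sup>2) = 1" "A *\<^sub>v v = c \<cdot>\<^sub>v v"
proof -
  define N where "N = Suc n"
  define C where "C = map_mat complex_of_real A"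
  have A': "A \<in> carrier_mat N N" using A by (simp add: N_def)
  have C: "C \<in> carrier_mat N N" using A' by (simp add: C_def)
  have symA: "A $$ (i, j) = A $$ (j, i)" if "i < N" "j < N" for i j
    using sym that A' by (metis carrier_matD index_transpose_mat(1))
  obtain k where "eigenvalue C k"
    using spectrum_non_empty[OF C] by (auto simp: N_def spectrum_def)
  then obtain z where z: "z \<in> carrier_vec N" "z \<noteq> 0\<^sub>v N" "C *\<^sub>v z = k \<cdot>\<^sub>v z"
    using C unfolding eigenvalue_def eigenvector_def by auto
  have Cz: "(\<Sum>j<N. of_real (A $$ (i, j)) * z $ j) = k * z $ i" if "i < N" for i
  proof -
    have "(C *\<^sub>v z) $ i = (\<Sum>j<N. of_real (A $$ (i, j)) * z $ j)"
      using that z(1) A' by (auto simp: C_def scalar_prod_def lessThan_atLeast0 intro!: sum.cong)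
    then show ?thesis using z that by auto
  qed
  define S where "S = (\<Sum>i<N. \<Sum>j<N. cnj (z $ i) * of_real (A $$ (i, j)) * z $ j)"
  define Z where "Z = (\<Sum>i<N. (cmod (z $ i))\<^sup>2)"
  have "S = (\<Sum>i<N. cnj (z $ i) * (k * z $ i))"
    unfolding S_def by (rule sum.cong) (auto simp: Cz[symmetric] sum_distrib_left mult.assoc)
  also have "\<dots> = k * of_real Z"
    unfolding Z_def of_real_sum sum_distrib_left
    by (rule sum.cong) (auto simp: complex_norm_square mult_ac simp flip: of_real_power)
  finally have S: "S = k * of_real Z" .
  have "cnj S = (\<Sum>i<N. \<Sum>j<N. cnj (z $ j) * of_real (A $$ (j, i)) * z $ i)"
    unfolding S_def cnj_sum by (intro sum.cong refl) (use symA in auto)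
  also have "\<dots> = S" unfolding S_def by (rule sum.swap)
  finally have "cnj S = S" .
  have "Z \<noteq> 0"
  proof
    assume "Z = 0"
    then have "\<forall>i<N. z $ i = 0" unfolding Z_def by (subst (asm) sum_nonneg_eq_0_iff) auto
    then have "z = 0\<^sub>v N" using z(1) by (intro eq_vecI) auto
    with z(2) show False by simp
  qed
  with \<open>cnj S = S\<close> S have "cnj k = k" by auto
  then have k: "k = of_real (Re k)" by (auto simp: complex_eq_iff)
  have "poly (char_poly C) k = 0" using \<open>eigenvalue C k\<close> C by (simp add: eigenvalue_root_char_poly)
  moreover have "char_poly C = map_poly of_real (char_poly A)"
    unfolding C_def by (rule of_real_hom.char_poly_hom[OF A'])
  ultimately have "poly (char_poly A) (Re k) = 0"
    by (metis k of_real_eq_0_iff of_real_hom.poly_map_poly)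
  then have "eigenvalue A (Re k)" using A' by (simp add: eigenvalue_root_char_poly)
  then obtain v where v: "v \<in> carrier_vec N" "v \<noteq> 0\<^sub>v N" "A *\<^sub>v v = Re k \<cdot>\<^sub>v v"
    using A' unfolding eigenvalue_def eigenvector_def by auto
  define W where "W = (\<Sum>i<N. (v $ i)\<^sup>2)"
  have "W \<noteq> 0"
  proof
    assume "W = 0"
    then have "\<forall>i<N. v $ i = 0" unfolding W_def by (subst (asm) sum_nonneg_eq_0_iff) auto
    then have "v = 0\<^sub>v N" using v(1) by (intro eq_vecI) auto
    with v(2) show False by simp
  qed
  moreover have "W \<ge> 0" unfolding W_def by (intro sum_nonneg) auto
  ultimately have W: "W > 0" by simp
  define u where "u = (1 / sqrt W) \<cdot>\<^sub>v v"
  have "(\<Sum>i<N. (u $ i)\<^sup>2) = (\<Sum>i<N. (v $ i)\<^sup>2 / W)"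
    using v(1) W by (intro sum.cong) (auto simp: u_def power_divide)
  also have "\<dots> = 1" using W by (simp add: W_def sum_divide_distrib[symmetric])
  finally have "(\<Sum>i<N. (u $ i)\<^sup>2) = 1" .
  moreover have "A *\<^sub>v u = Re k \<cdot>\<^sub>v u"
    using A' v by (simp add: u_def mult_mat_vec smult_smult_assoc mult.commute)
  moreover have "u \<in> carrier_vec N" using v by (auto simp: u_def)
  ultimately show thesis using that[of u "Re k"] by (simp add: N_def)
qed

theorem symmetric_diagonalisation:
  assumes "A \<in> carrier_mat n n" "transpose_mat A = (A :: real mat)"
  shows "\<exists>Q \<in> orthogonal_group n. \<exists>f. A = Q * mat_diag n f * transpose_mat Q"
  using assms
proof (induction n arbitrary: A)
  case 0
  then show ?case using orthogonal_group_one[of 0] by (intro bexI[of _ "1\<^sub>m 0"] exI[of _ "\<lambda>_. 0"]) (auto simp: mat_diag_def intro!: eq_matI)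
next
  case (Suc n A)
  obtain v c where v: "v \<in> carrier_vec (Suc n)" "(\<Sum>i<Suc n. (v $ i)\<^sup>2) = 1" "A *\<^sub>v v = c \<cdot>\<^sub>v v"
    using symmetric_real_eigenvector[OF Suc.prems] .
  obtain H where H: "H \<in> orthogonal_group (Suc n)" "col H 0 = v"
    using orthogonal_group_with_column[OF v(1,2)] by auto
  note HD = orthogonal_groupD[OF H(1)]
  obtain B where B: "B \<in> carrier_mat n n" "transpose_mat H * A * H = bordered n c B"
    using deflation[OF Suc.prems(1) H(1) H(1), of c] v(3) H(2) Suc.prems(2) by auto
  have "transpose_mat (bordered n c B) = bordered n c B"
    unfolding B(2)[symmetric] using HD Suc.prems
    by (simp add: transpose_mult[of _ "Suc n" "Suc n" _ "Suc n"] assoc_mult_mat[of _ "Suc n" "Suc n" _ "Suc n" _ "Suc n"])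
  then have eq: "bordered n c (transpose_mat B) = bordered n c B" unfolding bordered_transpose[OF B(1)] .
  have "transpose_mat B = B"
  proof (rule eq_matI)
    fix i j assume "i < dim_row B" "j < dim_col B"
    then show "transpose_mat B $$ (i, j) = B $$ (i, j)"
      using B(1) arg_cong[OF eq, of "\<lambda>M. M $$ (Suc i, Suc j)"] by auto
  qed (use B in auto)
  from Suc.IH[OF B(1) this] obtain Q f where Q: "Q \<in> orthogonal_group n" "B = Q * mat_diag n f * transpose_mat Q"
    by auto
  note QD = orthogonal_groupD[OF Q(1)]
  let ?Q = "bordered n 1 Q"
  have bQ: "?Q \<in> orthogonal_group (Suc n)" by (rule bordered_orthogonal[OF Q(1)])
  note bQD = orthogonal_groupD[OF bQ]
  have "bordered n c B = ?Q * bordered n c (mat_diag n f) * transpose_mat ?Q"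
    using QD(1) unfolding Q(2) bordered_transpose[OF QD(1)]
    by (subst bordered_mult[of _ n]; (subst bordered_mult[of _ n])?; auto)
  moreover have "A = H * (transpose_mat H * A * H) * transpose_mat H"
  proof -
    have "H * (transpose_mat H * A * H) * transpose_mat H = (H * transpose_mat H) * A * (H * transpose_mat H)"
      using HD(1) Suc.prems(1) by (simp add: assoc_mult_mat[of _ "Suc n" "Suc n" _ "Suc n" _ "Suc n"])
    then show ?thesis using HD Suc.prems(1) by simp
  qed
  ultimately have "A = H * (?Q * mat_diag (Suc n) (case_nat c f) * transpose_mat ?Q) * transpose_mat H"
    unfolding B(2) bordered_diag by simp
  also have "\<dots> = (H * ?Q) * mat_diag (Suc n) (case_nat c f) * transpose_mat (H * ?Q)"
    using HD(1) bQD(1) by (simp add: transpose_mult[of _ "Suc n" "Suc n" _ "Suc n"] assoc_mult_mat[of _ "Suc n" "Suc n" _ "Suc n" _ "Suc n"])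
  finally show ?case using orthogonal_group_mult[OF H(1) bQ] by blast
qed

lemma scalar_prod_self: "v \<in> carrier_vec n \<Longrightarrow> v \<bullet> v = (\<Sum>i<n. (v $ i)\<^sup>2 :: real)"
  by (auto simp: scalar_prod_def power2_eq_square lessThan_atLeast0 intro!: sum.cong)

lemma conjugate_diag_col:
  assumes Q: "Q \<in> orthogonal_group n" and A: "A = Q * mat_diag n f * transpose_mat Q" and i: "i < n"
  shows "A *\<^sub>v col Q i = f i \<cdot>\<^sub>v col Q i" "f i = col Q i \<bullet> (A *\<^sub>v col Q i)"
proof -
  note QD = orthogonal_groupD[OF Q]
  have A': "A \<in> carrier_mat n n" using A QD(1) by auto
  have "A * Q = Q * mat_diag n f * (transpose_mat Q * Q)"
    unfolding A using QD(1) by (simp add: assoc_mult_mat[of _ n n _ n _ n])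
  also have "\<dots> = Q * mat_diag n f" unfolding QD(2) using QD(1) by auto
  finally have "A * Q = Q * mat_diag n f" .
  then have "A *\<^sub>v col Q i = col (Q * mat_diag n f) i"
    using A' QD(1) i by (metis col_mult2)
  also have "\<dots> = f i \<cdot>\<^sub>v col Q i"
    using QD(1) i by (subst mat_diag_mult_right[of _ n]) (auto intro!: eq_vecI)
  finally show 1: "A *\<^sub>v col Q i = f i \<cdot>\<^sub>v col Q i" .
  have "col Q i \<bullet> col Q i = 1"
    using orthogonal_group_cols[OF Q i i] QD(1) i
    by (subst scalar_prod_self[of _ n]) (auto simp: power2_eq_square)
  then show "f i = col Q i \<bullet> (A *\<^sub>v col Q i)"
    unfolding 1 using QD(1) by (simp add: scalar_prod_smult_right)
qed

text \<open>One singular pair is split off at a time: \<open>v\<close> is an eigenvector of A^T A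
  with eigenvalue \<open>g i > 0\<close>, and \<open>u\<close> is the image of \<open>v\<close>
  divided by \<open>sqrt (g i)\<close>. Any positive eigenvalue serves, so the values
  \<open>f\<close> come in no particular order. The zero matrix has no such pair and is treated
  separately.\<close>

theorem singular_value_decomposition:
  assumes "A \<in> carrier_mat n n"
  shows "\<exists>U \<in> orthogonal_group n. \<exists>V \<in> orthogonal_group n. \<exists>f.
    (\<forall>i. f i \<ge> 0) \<and> A = U * mat_diag n f * transpose_mat V"
  using assms
proof (induction n arbitrary: A)
  case 0
  then show ?case using orthogonal_group_one[of 0]
    by (intro bexI[of _ "1\<^sub>m 0"] exI[of _ "\<lambda>_. 0"]) (auto simp: mat_diag_def intro!: eq_matI)
next
  case (Suc n A)
  note A = Suc.prems
  show ?case
  proof (cases "A = 0\<^sub>m (Suc n) (Suc n)")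
    case True
    have "mat_diag (Suc n) (\<lambda>_. 0 :: real) = 0\<^sub>m (Suc n) (Suc n)" by (auto simp: mat_diag_def)
    with True show ?thesis using orthogonal_group_one[of "Suc n"]
      by (intro bexI[of _ "1\<^sub>m (Suc n)"] exI[of _ "\<lambda>_. 0"])
        (auto simp del: One_nat_def)
  next
    case False
    define N where "N = Suc n"
    have AN: "A \<in> carrier_mat N N" using A by (simp add: N_def)
    define G where "G = transpose_mat A * A"
    have G: "G \<in> carrier_mat N N" "transpose_mat G = G"
      using AN by (auto simp: G_def transpose_mult[of _ N N _ N])
    obtain Q g where Q: "Q \<in> orthogonal_group N" and Gd: "G = Q * mat_diag N g * transpose_mat Q"
      using symmetric_diagonalisation[OF G] by auto
    note QD = orthogonal_groupD[OF Q]
    have norm: "(\<Sum>k<N. ((A *\<^sub>v col Q i) $ k)\<^sup>2) = g i" if "i < N" for i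
    proof -
      have q: "col Q i \<in> carrier_vec N" using QD(1) that by auto
      have "(\<Sum>k<N. ((A *\<^sub>v col Q i) $ k)\<^sup>2) = (A *\<^sub>v col Q i) \<bullet> (A *\<^sub>v col Q i)"
        using AN q by (subst scalar_prod_self[of _ N]) auto
      also have "\<dots> = (transpose_mat A *\<^sub>v (A *\<^sub>v col Q i)) \<bullet> col Q i"
        using AN q by (subst transpose_vec_mult_scalar[of _ N N]) auto
      also have "transpose_mat A *\<^sub>v (A *\<^sub>v col Q i) = G *\<^sub>v col Q i"
        using AN q by (simp add: G_def assoc_mult_mat_vec[of _ N N _ N])
      also have "\<dots> \<bullet> col Q i = col Q i \<bullet> (G *\<^sub>v col Q i)"
        using G q by (intro comm_scalar_prod[of _ N]) auto
      finally show ?thesis using conjugate_diag_col(2)[OF Q Gd that] by simp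
    qed
    \<comment> \<open>Otherwise A^T A = 0, and its diagonal entries, the squared column norms of
      \<open>A\<close>, would all vanish.\<close>
    have "\<exists>i<N. g i \<noteq> 0"
    proof (rule ccontr)
      assume "\<not> ?thesis"
      then have "mat_diag N g = 0\<^sub>m N N" by (auto simp: mat_diag_def)
      then have "G = 0\<^sub>m N N" using Gd QD(1) by auto
      have "A $$ (k, j) = 0" if kj: "k < N" "j < N" for k j
      proof -
        have "(\<Sum>k<N. (A $$ (k, j))\<^sup>2) = G $$ (j, j)"
          using kj AN unfolding G_def by (subst mat_mult_entry[of _ N]) (auto simp: power2_eq_square)
        also have "\<dots> = 0" using \<open>G = 0\<^sub>m N N\<close> kj by simp
        finally show ?thesis using kj by (subst (asm) sum_nonneg_eq_0_iff) auto
      qed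
      then have "A = 0\<^sub>m N N" using AN by (intro eq_matI) auto
      with False show False by (simp add: N_def)
    qed
    then obtain i where i: "i < N" "g i \<noteq> 0" by blast
    have "g i \<ge> 0" unfolding norm[OF i(1), symmetric] by (intro sum_nonneg) auto
    with i have gi: "g i > 0" by simp
    define v where "v = col Q i"
    define u where "u = (1 / sqrt (g i)) \<cdot>\<^sub>v (A *\<^sub>v v)"
    have v: "v \<in> carrier_vec N" using QD(1) i by (auto simp: v_def)
    have u: "u \<in> carrier_vec N" using AN v by (auto simp: u_def)
    have v1: "(\<Sum>k<N. (v $ k)\<^sup>2) = 1"
      using orthogonal_group_cols[OF Q i(1) i(1)] QD(1) i by (simp add: v_def power2_eq_square)
    have "(\<Sum>k<N. (u $ k)\<^sup>2) = (\<Sum>k<N. ((A *\<^sub>v v) $ k)\<^sup>2 / g i)"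
      using AN gi by (intro sum.cong) (auto simp: u_def power_divide simp del: index_mult_mat_vec)
    also have "\<dots> = 1" using norm[OF i(1)] gi by (simp add: v_def sum_divide_distrib[symmetric])
    finally have u1: "(\<Sum>k<N. (u $ k)\<^sup>2) = 1" .
    have Av: "A *\<^sub>v v = sqrt (g i) \<cdot>\<^sub>v u" using gi by (simp add: u_def smult_smult_assoc)
    have "transpose_mat A *\<^sub>v u = (1 / sqrt (g i)) \<cdot>\<^sub>v (G *\<^sub>v v)"
      using AN v by (simp add: u_def G_def mult_mat_vec[of _ N N] assoc_mult_mat_vec[of _ N N _ N])
    also have "G *\<^sub>v v = g i \<cdot>\<^sub>v v" unfolding v_def by (rule conjugate_diag_col(1)[OF Q Gd i(1)])
    also have "(1 / sqrt (g i)) \<cdot>\<^sub>v (g i \<cdot>\<^sub>v v) = sqrt (g i) \<cdot>\<^sub>v v"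
      using gi by (simp add: smult_smult_assoc real_div_sqrt)
    finally have Au: "transpose_mat A *\<^sub>v u = sqrt (g i) \<cdot>\<^sub>v v" .
    obtain H where H: "H \<in> orthogonal_group N" "col H 0 = u"
      using orthogonal_group_with_column[OF u u1] by (auto simp: N_def)
    obtain K where K: "K \<in> orthogonal_group N" "col K 0 = v"
      using orthogonal_group_with_column[OF v v1] by (auto simp: N_def)
    note HD = orthogonal_groupD[OF H(1)] and KD = orthogonal_groupD[OF K(1)]
    obtain B where B: "B \<in> carrier_mat n n" "transpose_mat H * A * K = bordered n (sqrt (g i)) B"
      using deflation[OF A, of H K "sqrt (g i)"] H K Au Av by (auto simp: N_def)
    obtain U V f where UV: "U \<in> orthogonal_group n" "V \<in> orthogonal_group n" "\<forall>i. f i \<ge> 0"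
      "B = U * mat_diag n f * transpose_mat V"
      using Suc.IH[OF B(1)] by blast
    note UD = orthogonal_groupD[OF UV(1)] and VD = orthogonal_groupD[OF UV(2)]
    have bU: "bordered n 1 U \<in> orthogonal_group N" and bV: "bordered n 1 V \<in> orthogonal_group N"
      unfolding N_def using UV by (auto intro!: bordered_orthogonal simp del: One_nat_def)
    note bUD = orthogonal_groupD[OF bU] and bVD = orthogonal_groupD[OF bV]
    have *: "bordered n c B = bordered n 1 U * bordered n c (mat_diag n f) * transpose_mat (bordered n 1 V)" for c
      using UD(1) VD(1) unfolding UV(4) bordered_transpose[OF VD(1)]
      by (subst bordered_mult[of _ n]; (subst bordered_mult[of _ n])?; auto)
    have "A = (H * transpose_mat H) * A * (K * transpose_mat K)"
      unfolding HD(3) KD(3) using AN by simp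
    also have "\<dots> = H * (transpose_mat H * A * K) * transpose_mat K"
      using HD(1) KD(1) AN by (simp add: assoc_mult_mat[of _ N N _ N _ N])
    also have "\<dots> = H * (bordered n 1 U * mat_diag N (case_nat (sqrt (g i)) f) * transpose_mat (bordered n 1 V)) * transpose_mat K"
      unfolding B(2) * bordered_diag N_def ..
    also have "\<dots> = (H * bordered n 1 U) * mat_diag N (case_nat (sqrt (g i)) f) * transpose_mat (K * bordered n 1 V)"
      using HD(1) KD(1) bUD(1) bVD(1)
      by (simp add: transpose_mult[of _ N N _ N] assoc_mult_mat[of _ N N _ N _ N])
    finally have "A = (H * bordered n 1 U) * mat_diag N (case_nat (sqrt (g i)) f) * transpose_mat (K * bordered n 1 V)" .
    moreover have "H * bordered n 1 U \<in> orthogonal_group N" "K * bordered n 1 V \<in> orthogonal_group N"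
      using H K bU bV by (auto intro: orthogonal_group_mult)
    moreover have "case_nat (sqrt (g i)) f j \<ge> 0" for j using UV(3) gi by (auto split: nat.splits)
    ultimately show ?thesis unfolding N_def[symmetric] by blast
  qed
qed

section \<open>Positive semidefinite square roots and the multiset of singular values\<close>

lemma symmetric_psd_conjugate_diag:
  assumes Q: "Q \<in> orthogonal_group n" and f: "\<And>i. i < n \<Longrightarrow> f i \<ge> 0"
  shows "symmetric_psd_mat (Q * mat_diag n f * transpose_mat Q)"
proof -
  note QD = orthogonal_groupD[OF Q]
  let ?B = "Q * mat_diag n f * transpose_mat Q"
  have D: "transpose_mat (mat_diag n f) = mat_diag n f" by (auto simp: mat_diag_def)
  have "transpose_mat ?B = ?B"
    using QD(1) by (simp add: transpose_mult[of _ n n _ n] D assoc_mult_mat[of _ n n _ n _ n])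
  moreover have "v \<bullet> (?B *\<^sub>v v) \<ge> 0" if v: "v \<in> carrier_vec n" for v
  proof -
    define w where "w = transpose_mat Q *\<^sub>v v"
    have w: "w \<in> carrier_vec n" using QD(1) v by (auto simp: w_def)
    have "?B *\<^sub>v v = Q *\<^sub>v (mat_diag n f *\<^sub>v w)"
      using QD(1) v by (simp add: w_def assoc_mult_mat_vec[of _ n n _ n])
    then have "v \<bullet> (?B *\<^sub>v v) = w \<bullet> (mat_diag n f *\<^sub>v w)"
      using QD(1) v w mult_mat_vec_carrier[OF mat_diag_dim w, of f] unfolding w_def
      by (subst transpose_vec_mult_scalar[of _ n n]) auto
    also have "\<dots> = (\<Sum>i<n. f i * (w $ i)\<^sup>2)"
      using w by (auto simp: scalar_prod_def mat_diag_def lessThan_atLeast0 power2_eq_square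
          if_distrib[of "\<lambda>a. a * _"] sum.delta cong: if_cong intro!: sum.cong)
    also have "\<dots> \<ge> 0" using f by (intro sum_nonneg) auto
    finally show ?thesis .
  qed
  ultimately show ?thesis using QD(1) unfolding symmetric_psd_mat_def by auto
qed

text \<open>In the eigenbases of \<open>B\<close> and \<open>C\<close>, with \<open>M\<close> = Q^T
  R, equality of the squares reads (f i)^2 M_ij = M_ij (g j)^2. Since \<open>f\<close> and
  \<open>g\<close> are nonnegative, already f i M_ij = M_ij g j, that is, D M = M E; conjugating
  back gives B = C. The comparison is entrywise, so repeated eigenvalues need no separate
  treatment.\<close>

lemma symmetric_psd_sqrt_unique:
  assumes B: "B \<in> carrier_mat n n" "symmetric_psd_mat B" and C: "C \<in> carrier_mat n n" "symmetric_psd_mat C"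
    and eq: "B * B = C * C"
  shows "B = C"
proof -
  obtain Q f where Q: "Q \<in> orthogonal_group n" and Bd: "B = Q * mat_diag n f * transpose_mat Q"
    using symmetric_diagonalisation[OF B(1)] B(2) by (auto simp: symmetric_psd_mat_def)
  obtain R g where R: "R \<in> orthogonal_group n" and Cd: "C = R * mat_diag n g * transpose_mat R"
    using symmetric_diagonalisation[OF C(1)] C(2) by (auto simp: symmetric_psd_mat_def)
  note QD = orthogonal_groupD[OF Q] and RD = orthogonal_groupD[OF R]
  have f: "f i \<ge> 0" if "i < n" for i
    using conjugate_diag_col(2)[OF Q Bd that] B that QD(1) by (auto simp: symmetric_psd_mat_def)
  have g: "g i \<ge> 0" if "i < n" for i
    using conjugate_diag_col(2)[OF R Cd that] C that RD(1) by (auto simp: symmetric_psd_mat_def)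
  define D where "D = mat_diag n f"
  define E where "E = mat_diag n g"
  define M where "M = transpose_mat Q * R"
  have DE: "D \<in> carrier_mat n n" "E \<in> carrier_mat n n" "M \<in> carrier_mat n n"
    using QD RD by (auto simp: D_def E_def M_def)
  note as = assoc_mult_mat[of _ n n _ n _ n]
  have QB: "transpose_mat Q * B = D * transpose_mat Q"
  proof -
    have "transpose_mat Q * B = (transpose_mat Q * Q) * D * transpose_mat Q"
      unfolding Bd using QD(1) DE by (simp add: as D_def)
    then show ?thesis using QD(1,2) DE by simp
  qed
  have CR: "C * R = R * E"
  proof -
    have "C * R = R * E * (transpose_mat R * R)"
      unfolding Cd using RD(1) DE by (simp add: as E_def)
    then show ?thesis using RD(1,2) DE by simp
  qed
  have "D * (D * M) = transpose_mat Q * (B * B) * R"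
  proof -
    have "transpose_mat Q * (B * B) * R = ((transpose_mat Q * B) * B) * R"
      using QD(1) RD(1) B(1) by (simp add: as)
    also have "\<dots> = (D * transpose_mat Q * B) * R" unfolding QB ..
    also have "\<dots> = D * ((transpose_mat Q * B) * R)"
      using QD(1) RD(1) B(1) DE by (simp add: as)
    also have "\<dots> = D * ((D * transpose_mat Q) * R)" unfolding QB ..
    also have "\<dots> = D * (D * M)" unfolding M_def using QD(1) RD(1) DE by (simp add: as)
    finally show ?thesis ..
  qed
  also have "\<dots> = (M * E) * E"
  proof -
    have "transpose_mat Q * (C * C) * R = transpose_mat Q * (C * (C * R))"
      using QD(1) RD(1) C(1) by (simp add: as)
    also have "\<dots> = transpose_mat Q * (C * (R * E))" unfolding CR ..
    also have "\<dots> = transpose_mat Q * ((C * R) * E)"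
      using RD(1) C(1) DE by (simp add: as)
    also have "\<dots> = (M * E) * E" unfolding CR M_def using QD(1) RD(1) DE by (simp add: as)
    finally show ?thesis unfolding eq .
  qed
  finally have DDM: "D * (D * M) = (M * E) * E" .
  have "f i * M $$ (i, j) = M $$ (i, j) * g j" if ij: "i < n" "j < n" for i j
  proof -
    have "(D * (D * M)) $$ (i, j) = ((M * E) * E) $$ (i, j)" unfolding DDM ..
    then have "f i * (f i * M $$ (i, j)) = M $$ (i, j) * g j * g j"
      unfolding D_def E_def using DE ij
      by (simp add: mat_diag_mult_left[of _ n n] mat_diag_mult_right[of _ n n])
    then have "M $$ (i, j) * ((f i)\<^sup>2 - (g j)\<^sup>2) = 0" by (simp add: algebra_simps power2_eq_square)
    then have "M $$ (i, j) = 0 \<or> f i = g j" using f[OF ij(1)] g[OF ij(2)] by simp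
    then show ?thesis by auto
  qed
  then have "D * M = M * E"
    unfolding D_def E_def using DE
    by (intro eq_matI) (auto simp: mat_diag_mult_left[of _ n n] mat_diag_mult_right[of _ n n])
  moreover have "B = Q * (D * M) * transpose_mat R"
  proof -
    have "Q * (D * M) * transpose_mat R = Q * D * transpose_mat Q * (R * transpose_mat R)"
      unfolding M_def using QD(1) RD(1) DE by (simp add: as)
    then show ?thesis unfolding RD(3) Bd D_def using QD(1) by simp
  qed
  moreover have "C = Q * (M * E) * transpose_mat R"
  proof -
    have "Q * (M * E) * transpose_mat R = (Q * transpose_mat Q) * (R * E * transpose_mat R)"
      unfolding M_def using QD(1) RD(1) DE by (simp add: as)
    then show ?thesis unfolding QD(3) Cd E_def using RD(1) by simp
  qed
  ultimately show ?thesis by simp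
qed

text \<open>V diag(f) V^T is a positive semidefinite square root of A^T A, and uniqueness identifies
  it with the definite description in \<open>psd_sqrt\<close>. It is similar to diag(f), so its
  characteristic polynomial has exactly the roots \<open>f i\<close> with
  \<open>i < n\<close>.\<close>

lemma count_singular_values:
  assumes U: "U \<in> orthogonal_group n" and V: "V \<in> orthogonal_group n" and f: "\<And>i. f i \<ge> 0"
    and A: "A = U * mat_diag n f * transpose_mat V"
  shows "count (singular_values A) x = card {i. i < n \<and> f i = x}"
proof -
  note UD = orthogonal_groupD[OF U] and VD = orthogonal_groupD[OF V]
  note as = assoc_mult_mat[of _ n n _ n _ n]
  let ?D = "mat_diag n f"
  define B where "B = V * ?D * transpose_mat V"
  have D: "transpose_mat ?D = ?D" by (auto simp: mat_diag_def)
  have AA: "transpose_mat A * A = V * ?D * ?D * transpose_mat V"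
  proof -
    have "transpose_mat A * A = V * ?D * (transpose_mat U * U) * ?D * transpose_mat V"
      unfolding A using UD(1) VD(1) by (simp add: transpose_mult[of _ n n _ n] D as)
    then show ?thesis unfolding UD(2) using VD(1) by simp
  qed
  have BB: "B * B = V * ?D * ?D * transpose_mat V"
  proof -
    have "B * B = V * ?D * (transpose_mat V * V) * ?D * transpose_mat V"
      unfolding B_def using VD(1) by (simp add: as)
    then show ?thesis unfolding VD(2) using VD(1) by simp
  qed
  have B: "B \<in> carrier_mat n n" using VD(1) by (auto simp: B_def)
  have Bpsd: "symmetric_psd_mat B" unfolding B_def using V f by (rule symmetric_psd_conjugate_diag)
  have "psd_sqrt (transpose_mat A * A) = B"
    unfolding psd_sqrt_def
  proof (rule the_equality)
    show "symmetric_psd_mat B \<and> B * B = transpose_mat A * A" using Bpsd AA BB by simp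
    fix C assume C: "symmetric_psd_mat C \<and> C * C = transpose_mat A * A"
    then have "dim_row (C * C) = n" "dim_col C = dim_row C"
      using AA VD(1) by (auto simp: symmetric_psd_mat_def)
    then have "C \<in> carrier_mat n n" by (intro carrier_matI) auto
    then show "C = B" using C AA BB Bpsd B by (intro symmetric_psd_sqrt_unique[of C n B]) auto
  qed
  moreover have "char_poly B = char_poly ?D"
    by (intro char_poly_similar similar_matI[of _ _ V "transpose_mat V" n]) (use VD B in \<open>auto simp: B_def\<close>)
  moreover have "char_poly ?D = (\<Prod>a \<leftarrow> diag_mat ?D. [:- a, 1:])"
    by (rule char_poly_upper_triangular[of _ n]) (auto simp: upper_triangular_def mat_diag_def)
  moreover have "diag_mat ?D = map f [0..<n]"
    by (auto simp: diag_mat_def mat_diag_def)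
  moreover have "proots (\<Prod>a \<leftarrow> xs. [:- a, 1:]) = mset xs" for xs :: "real list"
  proof (induction xs)
    case (Cons a xs)
    have "(\<Prod>a \<leftarrow> xs. [:- a, 1:]) \<noteq> 0" by (auto simp: prod_list_zero_iff)
    then show ?case using Cons by (simp add: proots_mult del: mult_pCons_left)
  qed auto
  ultimately have "singular_values A = mset (map f [0..<n])" unfolding singular_values_def by metis
  also have "count \<dots> x = (\<Sum>i \<in> f -` {x} \<inter> {0..<n}. 1)"
    by (simp only: mset_map mset_upt count_image_mset finite_set_mset_mset_set finite_atLeastLessThan)
      (rule sum.cong, auto)
  also have "\<dots> = card {i. i < n \<and> f i = x}"
    by (simp add: vimage_def Int_def conj_commute)
  finally show ?thesis .
qed

section \<open>Haar measure on the orthogonal group\<close>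

text \<open>Extended by 0 outside the index range, so that measurability, and the bound by 1 on the
  orthogonal group, hold for all indices.\<close>

definition ent :: "nat \<Rightarrow> nat \<Rightarrow> nat \<Rightarrow> real mat \<Rightarrow> real" where
  "ent d i j U = (if i < d \<and> j < d then U $$ (i, j) else 0)"

lemma space_orthogonal_borel [simp]: "space (orthogonal_borel d) = orthogonal_group d"
  by (simp add: orthogonal_borel_def)

lemma ent_measurable_borel [measurable]: "ent d i j \<in> borel_measurable (orthogonal_borel d)"
proof (cases "i < d \<and> j < d")
  case True
  have "(\<lambda>U. \<lambda>ij \<in> {..<d} \<times> {..<d}. U $$ ij) \<in> orthogonal_borel d \<rightarrow>\<^sub>M (\<Pi>\<^sub>M ij \<in> {..<d} \<times> {..<d}. borel :: real measure)"
    unfolding orthogonal_borel_def by (rule measurable_vimage_algebra1) (auto simp: space_PiM)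
  from measurable_compose[OF this measurable_component_singleton[of "(i, j)"]] True
  show ?thesis by (simp add: ent_def[abs_def])
next
  case False
  then have "ent d i j = (\<lambda>_. 0)" by (auto simp: ent_def fun_eq_iff)
  then show ?thesis by simp
qed

lemma measurable_orthogonal_borelI:
  assumes "\<And>x. x \<in> space N \<Longrightarrow> f x \<in> orthogonal_group d"
    and "\<And>i j. i < d \<Longrightarrow> j < d \<Longrightarrow> (\<lambda>x. f x $$ (i, j)) \<in> borel_measurable N"
  shows "f \<in> N \<rightarrow>\<^sub>M orthogonal_borel d"
  unfolding orthogonal_borel_def
  using assms by (intro measurable_vimage_algebra2 measurable_restrict) auto

lemma ent_le: "U \<in> orthogonal_group d \<Longrightarrow> \<bar>ent d i j U\<bar> \<le> 1"
  using orthogonal_group_entry_le[of U d i j] by (auto simp: ent_def)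

lemma ent_cols:
  "U \<in> orthogonal_group d \<Longrightarrow> i < d \<Longrightarrow> j < d \<Longrightarrow> (\<Sum>k<d. ent d k i U * ent d k j U) = (if i = j then 1 else 0)"
  using orthogonal_group_cols[of U d i j] by (simp add: ent_def)

lemma ent_mult:
  assumes "U \<in> orthogonal_group d" "V \<in> orthogonal_group d" "i < d" "j < d"
  shows "ent d i j (U * V) = (\<Sum>k<d. ent d i k U * ent d k j V)"
  using assms orthogonal_groupD(1) by (simp add: ent_def mat_mult_entry[of _ d])

lemma mult_measurable:
  assumes U: "U \<in> orthogonal_group d"
  shows "(\<lambda>V. U * V) \<in> orthogonal_borel d \<rightarrow>\<^sub>M orthogonal_borel d"
proof (rule measurable_orthogonal_borelI)
  fix i j assume ij: "i < d" "j < d"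
  have "(\<lambda>V. \<Sum>k<d. ent d i k U * ent d k j V) \<in> borel_measurable (orthogonal_borel d)" by measurable
  moreover have "(U * V) $$ (i, j) = (\<Sum>k<d. ent d i k U * ent d k j V)" if "V \<in> orthogonal_group d" for V
    using ent_mult[OF U that ij] ij by (simp add: ent_def)
  ultimately show "(\<lambda>V. (U * V) $$ (i, j)) \<in> borel_measurable (orthogonal_borel d)"
    by (subst measurable_cong) auto
qed (use U in \<open>auto intro: orthogonal_group_mult\<close>)

lemma measurable_conjugation:
  assumes U: "U \<in> orthogonal_group d" and V: "V \<in> orthogonal_group d"
  shows "(\<lambda>W. U * W * V) \<in> orthogonal_borel d \<rightarrow>\<^sub>M orthogonal_borel d"
proof (rule measurable_orthogonal_borelI)
  fix i j assume ij: "i < d" "j < d"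
  have "(\<lambda>W. \<Sum>l<d. (\<Sum>k<d. ent d i k U * ent d k l W) * ent d l j V) \<in> borel_measurable (orthogonal_borel d)" by measurable
  moreover have "(U * W * V) $$ (i, j) = (\<Sum>l<d. (\<Sum>k<d. ent d i k U * ent d k l W) * ent d l j V)"
    if "W \<in> orthogonal_group d" for W
    using ent_mult[OF orthogonal_group_mult[OF U that] V ij] ent_mult[OF U that ij(1)] ij
    by (simp add: ent_def)
  ultimately show "(\<lambda>W. (U * W * V) $$ (i, j)) \<in> borel_measurable (orthogonal_borel d)"
    by (subst measurable_cong) auto
qed (use U V in \<open>auto intro: orthogonal_group_mult\<close>)

text \<open>Since W (U X V) = U (W' X) V with W' = U^T W U, the right factor is merely carried along
  and left invariance of the law of \<open>X\<close> passes to that of U X V. The conclusion is that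
  the new law is again Haar, not that it coincides with the old one.\<close>

lemma haar_conjugate:
  assumes U: "U \<in> orthogonal_group d" and V: "V \<in> orthogonal_group d"
    and X: "X \<in> M \<rightarrow>\<^sub>M orthogonal_borel d" and h: "haar_orthogonal d (distr M (orthogonal_borel d) X)"
  shows "haar_orthogonal d (distr M (orthogonal_borel d) (\<lambda>\<omega>. U * X \<omega> * V))"
proof -
  let ?B = "orthogonal_borel d" and ?Y = "\<lambda>\<omega>. U * X \<omega> * V"
  note mV = measurable_conjugation[OF U V]
  have Y: "?Y \<in> M \<rightarrow>\<^sub>M ?B" using measurable_compose[OF X mV] .
  have XO: "X \<omega> \<in> orthogonal_group d" if "\<omega> \<in> space M" for \<omega>
    using measurable_space[OF X that] by simp
  note UD = orthogonal_groupD[OF U]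
  have p: "prob_space M"
    using h X by (auto simp: haar_orthogonal_def intro: prob_space_distrD)
  show "haar_orthogonal d (distr M ?B ?Y)"
    unfolding haar_orthogonal_def
  proof (intro conjI ballI)
    show "prob_space (distr M ?B ?Y)" by (rule prob_space.prob_space_distr[OF p Y])
    fix W assume W: "W \<in> orthogonal_group d"
    note WD = orthogonal_groupD[OF W]
    define W' where "W' = transpose_mat U * (W * U)"
    have W': "W' \<in> orthogonal_group d" unfolding W'_def
      using U W by (intro orthogonal_group_mult orthogonal_group_transpose)
    have mW': "(\<lambda>V. W' * V) \<in> ?B \<rightarrow>\<^sub>M ?B" by (rule mult_measurable[OF W'])
    have XW: "distr M ?B (\<lambda>\<omega>. W' * X \<omega>) = distr M ?B X"
    proof -
      have "distr (distr M ?B X) (distr M ?B X) (\<lambda>V. W' * V) = distr M ?B X"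
        using h W' by (auto simp: haar_orthogonal_def)
      moreover have "distr (distr M ?B X) (distr M ?B X) (\<lambda>V. W' * V) = distr (distr M ?B X) ?B (\<lambda>V. W' * V)"
        by (rule distr_cong) auto
      moreover have "\<dots> = distr M ?B (\<lambda>\<omega>. W' * X \<omega>)"
        by (subst distr_distr[OF mW' X]) (simp add: comp_def)
      ultimately show ?thesis by simp
    qed
    have eq: "W * (U * A * V) = U * (W' * A) * V" if "A \<in> orthogonal_group d" for A
    proof -
      have "U * (W' * A) * V = (U * transpose_mat U) * (W * U * A * V)"
        unfolding W'_def using UD(1) WD(1) orthogonal_groupD(1)[OF that] orthogonal_groupD(1)[OF V]
        by (simp add: assoc_mult_mat[of _ d d _ d _ d])
      then show ?thesis
        unfolding UD(3) using UD(1) WD(1) orthogonal_groupD(1)[OF that] orthogonal_groupD(1)[OF V]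
        by (simp add: assoc_mult_mat[of _ d d _ d _ d])
    qed
    have "distr (distr M ?B ?Y) (distr M ?B ?Y) (\<lambda>V. W * V) = distr (distr M ?B ?Y) ?B (\<lambda>V. W * V)"
      by (rule distr_cong) auto
    also have "\<dots> = distr M ?B (\<lambda>\<omega>. W * ?Y \<omega>)"
      by (subst distr_distr[OF mult_measurable[OF W] Y]) (simp add: comp_def)
    also have "\<dots> = distr M ?B (\<lambda>\<omega>. U * (W' * X \<omega>) * V)"
      by (rule distr_cong) (use eq XO in auto)
    also have "\<dots> = distr (distr M ?B (\<lambda>\<omega>. W' * X \<omega>)) ?B (\<lambda>A. U * A * V)"
      by (subst distr_distr[OF mV measurable_compose[OF X mW']]) (simp add: comp_def)
    also have "\<dots> = distr M ?B ?Y"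
      unfolding XW by (subst distr_distr[OF mV X]) (simp add: comp_def)
    finally show "distr (distr M ?B ?Y) (distr M ?B ?Y) (\<lambda>V. W * V) = distr M ?B ?Y" .
  qed simp
qed

section \<open>Integration by parts along plane rotations\<close>

locale haar =
  fixes d :: nat and \<mu> :: "real mat measure"
  assumes haar: "haar_orthogonal d \<mu>"
begin

sublocale prob_space \<mu> using haar by (simp add: haar_orthogonal_def)

lemma sets_haar [simp, measurable_cong]: "sets \<mu> = sets (orthogonal_borel d)"
  using haar by (simp add: haar_orthogonal_def)

lemma space_haar [simp]: "space \<mu> = orthogonal_group d"
  using sets_eq_imp_space_eq[OF sets_haar] by simp

abbreviation E :: "nat \<Rightarrow> nat \<Rightarrow> real mat \<Rightarrow> real" where "E \<equiv> ent d"

lemma integrable_bounded: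
  assumes "f \<in> borel_measurable \<mu>" "\<And>U. U \<in> orthogonal_group d \<Longrightarrow> \<bar>f U\<bar> \<le> (C::real)"
  shows "integrable \<mu> f"
  using assms by (intro integrable_const_bound[of _ C]) auto

lemma integral_left_mult:
  assumes U: "U \<in> orthogonal_group d" and f: "(f :: real mat \<Rightarrow> real) \<in> borel_measurable \<mu>"
  shows "(\<integral>V. f (U * V) \<partial>\<mu>) = (\<integral>V. f V \<partial>\<mu>)"
proof -
  have m: "(\<lambda>V. U * V) \<in> \<mu> \<rightarrow>\<^sub>M \<mu>"
    using mult_measurable[OF U] measurable_cong_sets[OF sets_haar sets_haar] by blast
  have "(\<integral>V. f V \<partial>\<mu>) = (\<integral>V. f V \<partial>(distr \<mu> \<mu> (\<lambda>V. U * V)))"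
    using haar U by (simp add: haar_orthogonal_def)
  also have "\<dots> = (\<integral>V. f (U * V) \<partial>\<mu>)" by (rule integral_distr[OF m f])
  finally show ?thesis ..
qed

definition rot :: "nat \<Rightarrow> nat \<Rightarrow> real \<Rightarrow> real mat" where
  "rot p q s = Matrix.mat d d (\<lambda>(i, j).
     if i = p then (if j = p then cos s else if j = q then - sin s else 0)
     else if i = q then (if j = p then sin s else if j = q then cos s else 0)
     else if i = j then 1 else 0)"

lemma sum_two_points:
  assumes "p < d" "q < d" "p \<noteq> q"
  shows "(\<Sum>k<d. (if k = p then a else if k = q then b else 0) * f k) = a * f p + b * (f q :: real)"
proof -
  have "(\<Sum>k<d. (if k = p then a else if k = q then b else 0) * f k)
      = (\<Sum>k<d. (if k = p then a * f p else 0) + (if k = q then b * f q else 0))"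
    by (rule sum.cong) (use assms in auto)
  then show ?thesis using assms by (simp add: sum.distrib)
qed

lemma sum_one_point: "p < d \<Longrightarrow> (\<Sum>k<d. (if p = k then 1 else 0) * f k) = (f p :: real)"
proof -
  assume "p < d"
  have "(\<Sum>k<d. (if p = k then 1 else 0) * f k) = (\<Sum>k<d. if k = p then f p else 0)"
    by (rule sum.cong) auto
  then show ?thesis using \<open>p < d\<close> by simp
qed

lemma rot_orthogonal:
  assumes pq: "p < d" "q < d" "p \<noteq> q"
  shows "rot p q s \<in> orthogonal_group d"
proof -
  have "transpose_mat (rot p q s) \<in> orthogonal_group d"
  proof (rule orthogonal_groupI)
    fix i j assume ij: "i < d" "j < d"
    have r: "rot p q s $$ (i, k) = (if i = p then (if k = p then cos s else if k = q then - sin s else 0)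
     else if i = q then (if k = p then sin s else if k = q then cos s else 0)
     else if i = k then 1 else 0)" if "k < d" for k
      using that ij by (simp add: rot_def)
    have rr: "(\<Sum>k<d. rot p q s $$ (i, k) * f k) = (if i = p then cos s * f p - sin s * f q
       else if i = q then sin s * f p + cos s * f q else f i)" for f
    proof -
      have "(\<Sum>k<d. rot p q s $$ (i, k) * f k) = (\<Sum>k<d. (if i = p then (if k = p then cos s else if k = q then - sin s else 0)
          else if i = q then (if k = p then sin s else if k = q then cos s else 0)
          else if i = k then 1 else 0) * f k)"
        by (rule sum.cong) (simp_all add: r)
      then show ?thesis
        using sum_two_points[OF pq, of "cos s" "- sin s" f] sum_two_points[OF pq, of "sin s" "cos s" f]
          sum_one_point[of i f] ij by simp
    qed
    have "(\<Sum>k<d. transpose_mat (rot p q s) $$ (k, i) * transpose_mat (rot p q s) $$ (k, j))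
       = (\<Sum>k<d. rot p q s $$ (i, k) * rot p q s $$ (j, k))"
      using ij by (intro sum.cong) (auto simp: rot_def)
    also have "\<dots> = (if i = j then 1 else 0)"
      unfolding rr using ij pq by (auto simp: rot_def power2_eq_square[symmetric] algebra_simps)
    finally show "(\<Sum>k<d. transpose_mat (rot p q s) $$ (k, i) * transpose_mat (rot p q s) $$ (k, j))
        = (if i = j then 1 else 0)" .
  qed (simp add: rot_def)
  from orthogonal_group_transpose[OF this] show ?thesis by simp
qed

lemma ent_rot:
  assumes pq: "p < d" "q < d" "p \<noteq> q" and U: "U \<in> orthogonal_group d"
  shows "E i j (rot p q s * U) = (if i = p then cos s * E p j U - sin s * E q j U
    else if i = q then sin s * E p j U + cos s * E q j U else E i j U)"
proof (cases "i < d \<and> j < d")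
  case True
  have r: "E i k (rot p q s) = (if i = p then (if k = p then cos s else if k = q then - sin s else 0)
     else if i = q then (if k = p then sin s else if k = q then cos s else 0)
     else if i = k then 1 else 0)" if "k < d" for k
    using that True by (simp add: rot_def ent_def)
  have "E i j (rot p q s * U) = (\<Sum>k<d. E i k (rot p q s) * E k j U)"
    using True by (intro ent_mult rot_orthogonal pq U) auto
  also have "\<dots> = (\<Sum>k<d. (if i = p then (if k = p then cos s else if k = q then - sin s else 0)
     else if i = q then (if k = p then sin s else if k = q then cos s else 0)
     else if i = k then 1 else 0) * E k j U)"
    by (rule sum.cong) (simp_all add: r)
  also have "\<dots> = (if i = p then cos s * E p j U - sin s * E q j U
    else if i = q then sin s * E p j U + cos s * E q j U else E i j U)"
    using sum_two_points[OF pq, of "cos s" "- sin s" "\<lambda>k. E k j U"]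
      sum_two_points[OF pq, of "sin s" "cos s" "\<lambda>k. E k j U"]
        sum_one_point[of i "\<lambda>k. E k j U"] True by simp
  finally show ?thesis .
qed (use pq in \<open>auto simp: ent_def\<close>)

text \<open>Derivative at angle 0 of the entry \<open>(i, j)\<close> when \<open>U\<close> is
  multiplied from the left by \<open>rot p q s\<close>: only the rows \<open>p\<close> and
  \<open>q\<close> move.\<close>

definition dent :: "nat \<Rightarrow> nat \<Rightarrow> nat \<Rightarrow> nat \<Rightarrow> real mat \<Rightarrow> real" where
  "dent p q i j U = (if i = p then - E q j U else if i = q then E p j U else 0)"

lemma ent_rot_deriv:
  assumes pq: "p < d" "q < d" "p \<noteq> q" and U: "U \<in> orthogonal_group d"
  shows "((\<lambda>s. E i j (rot p q s * U)) has_real_derivative dent p q i j (rot p q s * U)) (at s)"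
  unfolding ent_rot[OF pq U] dent_def using pq
  by (auto intro!: derivative_eq_intros)

text \<open>By left invariance the mean of \<open>\<phi> (rot p q s * U)\<close> does not depend on
  \<open>s\<close>. The difference quotients at the angles 1/(n+1) therefore have mean 0; they are
  bounded by \<open>C\<close> through the mean value theorem and converge to \<phi>', so dominated
  convergence applies.\<close>

lemma integral_rotation_derivative:
  assumes pq: "p < d" "q < d" "p \<noteq> q"
    and [measurable]: "\<phi> \<in> borel_measurable (orthogonal_borel d)" "\<phi>' \<in> borel_measurable (orthogonal_borel d)"
    and b: "\<And>U. U \<in> orthogonal_group d \<Longrightarrow> \<bar>\<phi> U\<bar> \<le> C" "\<And>U. U \<in> orthogonal_group d \<Longrightarrow> \<bar>\<phi>' U\<bar> \<le> C"
    and D: "\<And>U s. U \<in> orthogonal_group d \<Longrightarrow>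
      ((\<lambda>s. \<phi> (rot p q s * U)) has_real_derivative \<phi>' (rot p q s * U)) (at s)"
  shows "(\<integral>U. \<phi>' U \<partial>\<mu>) = 0"
proof -
  define h where "h n = 1 / (real n + 1)" for n :: nat
  define u where "u n U = (\<phi> (rot p q (h n) * U) - \<phi> U) / h n" for n U
  have h: "h n > 0" for n by (simp add: h_def)
  have rm: "(\<lambda>U. \<phi> (rot p q s * U)) \<in> borel_measurable (orthogonal_borel d)" for s
    using measurable_compose[OF mult_measurable[OF rot_orthogonal[OF pq]]] assms(4) by blast
  have rO: "rot p q s * U \<in> orthogonal_group d" if "U \<in> orthogonal_group d" for s U
    using that rot_orthogonal[OF pq] by (intro orthogonal_group_mult)
  have r0: "\<phi> (rot p q 0 * U) = \<phi> U" "\<phi>' (rot p q 0 * U) = \<phi>' U" if "U \<in> orthogonal_group d" for U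
  proof -
    have "rot p q 0 = 1\<^sub>m d" by (rule eq_matI) (auto simp: rot_def)
    then have "rot p q 0 * U = U" using orthogonal_groupD(1)[OF that] by simp
    then show "\<phi> (rot p q 0 * U) = \<phi> U" "\<phi>' (rot p q 0 * U) = \<phi>' U" by simp_all
  qed
  have "(\<lambda>n. \<integral>U. u n U \<partial>\<mu>) \<longlonglongrightarrow> (\<integral>U. \<phi>' U \<partial>\<mu>)"
  proof (rule integral_dominated_convergence[where w = "\<lambda>_. C"])
    show "AE U in \<mu>. (\<lambda>n. u n U) \<longlonglongrightarrow> \<phi>' U"
    proof (rule AE_I2)
      fix U assume "U \<in> space \<mu>"
      then have U: "U \<in> orthogonal_group d" by simp
      have "((\<lambda>s. (\<phi> (rot p q s * U) - \<phi> (rot p q 0 * U)) / s) \<longlongrightarrow> \<phi>' (rot p q 0 * U)) (at 0)"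
        using D[OF U, of 0] by (simp add: DERIV_def)
      moreover have "filterlim h (at 0) sequentially"
        unfolding h_def by real_asymp
      ultimately show "(\<lambda>n. u n U) \<longlonglongrightarrow> \<phi>' U"
        unfolding u_def using r0[OF U] by (auto dest: filterlim_compose)
    qed
    show "AE U in \<mu>. norm (u n U) \<le> C" for n
    proof (rule AE_I2)
      fix U assume "U \<in> space \<mu>"
      then have U: "U \<in> orthogonal_group d" by simp
      obtain z where "\<phi> (rot p q (h n) * U) - \<phi> (rot p q 0 * U) = (h n - 0) * \<phi>' (rot p q z * U)"
        using MVT2[of 0 "h n" "\<lambda>s. \<phi> (rot p q s * U)" "\<lambda>s. \<phi>' (rot p q s * U)"] D[OF U] h by blast
      then have "u n U = \<phi>' (rot p q z * U)" unfolding u_def r0[OF U] using h[of n] by simp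
      then show "norm (u n U) \<le> C" using b(2)[OF rO[OF U]] by simp
    qed
  qed (use rm in \<open>auto simp: u_def\<close>)
  moreover have "(\<integral>U. u n U \<partial>\<mu>) = 0" for n
  proof -
    have "integrable \<mu> \<phi>" by (rule integrable_bounded[of _ C]) (use b in auto)
    moreover have "integrable \<mu> (\<lambda>U. \<phi> (rot p q (h n) * U))"
      by (rule integrable_bounded[of _ C]) (use rm b rO in auto)
    ultimately show ?thesis
      unfolding u_def using integral_left_mult[OF rot_orthogonal[OF pq], of \<phi>] by simp
  qed
  ultimately show ?thesis by (simp add: LIMSEQ_const_iff)
qed

end

section \<open>Stein identities for the tilted Haar measure\<close>

lemma exp_minus_linear_bounds:
  fixes u :: real
  assumes "\<bar>u\<bar> \<le> 1"
  shows "0 \<le> exp u - 1 - u" "exp u - 1 - u \<le> u\<^sup>2"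
proof -
  show "0 \<le> exp u - 1 - u" using exp_ge_add_one_self[of u] by linarith
  show "exp u - 1 - u \<le> u\<^sup>2"
  proof (cases "u \<ge> 0")
    case True
    then show ?thesis using exp_bound[of u] assms by auto
  next
    case False
    have "1 - u \<le> exp (- u)" using exp_ge_add_one_self[of "- u"] by simp
    then have "(1 - u) * exp u \<le> exp (- u) * exp u" by (intro mult_right_mono) auto
    also have "\<dots> = 1" by (simp flip: exp_add)
    also have "1 \<le> (1 - u) * (1 + u + u\<^sup>2)"
    proof -
      have "u ^ 3 \<le> 0" using False by (simp add: power3_eq_cube mult_nonneg_nonpos mult_nonpos_nonpos)
      then show ?thesis by (simp add: algebra_simps power2_eq_square power3_eq_cube)
    qed
    finally show ?thesis using False by (simp add: mult_le_cancel_left)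
  qed
qed

text \<open>The bound |exp u - 1 - u| <= u^2 for |u| <= 1 makes the pointwise remainder at most K
  h^2 once |h| C <= 1, so the difference quotient misses the claimed derivative by at most K
  |h|.\<close>

lemma (in prob_space) exponential_moment_deriv:
  assumes [measurable]: "Y \<in> borel_measurable M" and b: "\<And>x. x \<in> space M \<Longrightarrow> \<bar>Y x\<bar> \<le> (C::real)"
  shows "((\<lambda>\<theta>. \<integral>x. exp (\<theta> * Y x) \<partial>M) has_real_derivative (\<integral>x. Y x * exp (\<theta> * Y x) \<partial>M)) (at \<theta>)"
proof -
  define m where "m \<theta> = (\<integral>x. exp (\<theta> * Y x) \<partial>M)" for \<theta>
  define D where "D = (\<integral>x. Y x * exp (\<theta> * Y x) \<partial>M)"
  obtain x0 where "x0 \<in> space M" using not_empty by blast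
  then have C: "C \<ge> 0" using b[of x0] by linarith
  have eb: "exp (a * Y x) \<le> exp (\<bar>a\<bar> * C)" if "x \<in> space M" for a x
  proof -
    have "a * Y x \<le> \<bar>a * Y x\<bar>" by simp
    also have "\<dots> \<le> \<bar>a\<bar> * C" using b[OF that] by (simp add: abs_mult mult_left_mono)
    finally show ?thesis by simp
  qed
  have int: "integrable M (\<lambda>x. exp (a * Y x))" for a
    using eb by (intro integrable_const_bound[of _ "exp (\<bar>a\<bar> * C)"]) auto
  have intY: "integrable M (\<lambda>x. Y x * exp (a * Y x))" for a
  proof (rule integrable_const_bound[of _ "C * exp (\<bar>a\<bar> * C)"])
    have "\<bar>Y x * exp (a * Y x)\<bar> \<le> C * exp (\<bar>a\<bar> * C)" if "x \<in> space M" for x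
      unfolding abs_mult using b[OF that] eb[OF that, of a] C by (intro mult_mono) auto
    then show "AE x in M. norm (Y x * exp (a * Y x)) \<le> C * exp (\<bar>a\<bar> * C)" by (intro AE_I2) simp
  qed measurable
  define K where "K = C\<^sup>2 * exp (\<bar>\<theta>\<bar> * C)"
  have key: "\<bar>(m (\<theta> + h) - m \<theta>) / h - D\<bar> \<le> K * \<bar>h\<bar>" if h: "h \<noteq> 0" "\<bar>h\<bar> * (C + 1) \<le> 1" for h
  proof -
    have "\<bar>h\<bar> * C \<le> \<bar>h\<bar> * (C + 1)" by (intro mult_left_mono) auto
    then have hC: "\<bar>h\<bar> * C \<le> 1" using h(2) by linarith
    have "\<bar>m (\<theta> + h) - m \<theta> - h * D\<bar> = \<bar>\<integral>x. exp ((\<theta> + h) * Y x) - exp (\<theta> * Y x) - h * (Y x * exp (\<theta> * Y x)) \<partial>M\<bar>"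
      unfolding m_def D_def using int intY by simp
    also have "\<dots> \<le> (\<integral>x. \<bar>exp ((\<theta> + h) * Y x) - exp (\<theta> * Y x) - h * (Y x * exp (\<theta> * Y x))\<bar> \<partial>M)"
      by (rule integral_abs_bound)
    also have "\<dots> \<le> (\<integral>x. K * h\<^sup>2 \<partial>M)"
    proof (rule integral_mono)
      fix x assume x: "x \<in> space M"
      have u: "\<bar>h * Y x\<bar> \<le> \<bar>h\<bar> * C" using b[OF x] by (simp add: abs_mult mult_left_mono)
      have eq: "exp ((\<theta> + h) * Y x) - exp (\<theta> * Y x) - h * (Y x * exp (\<theta> * Y x))
          = exp (\<theta> * Y x) * (exp (h * Y x) - 1 - h * Y x)"
        by (simp add: algebra_simps exp_add)
      have "\<bar>exp (h * Y x) - 1 - h * Y x\<bar> \<le> (h * Y x)\<^sup>2"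
        using exp_minus_linear_bounds[of "h * Y x"] u hC by linarith
      also have "\<dots> \<le> (\<bar>h\<bar> * C)\<^sup>2" using u by (metis abs_ge_zero power2_abs power_mono)
      finally have "\<bar>exp (h * Y x) - 1 - h * Y x\<bar> \<le> h\<^sup>2 * C\<^sup>2" by (simp add: power_mult_distrib)
      then show "\<bar>exp ((\<theta> + h) * Y x) - exp (\<theta> * Y x) - h * (Y x * exp (\<theta> * Y x))\<bar> \<le> K * h\<^sup>2"
        unfolding eq K_def abs_mult using eb[OF x, of \<theta>]
        by (subst mult.commute[of "C\<^sup>2"]) (simp add: mult.assoc mult_mono mult.commute[of "C\<^sup>2"])
    qed (use int intY in auto)
    also have "\<dots> = K * h\<^sup>2" by (simp add: prob_space)
    finally have "\<bar>m (\<theta> + h) - m \<theta> - h * D\<bar> \<le> K * \<bar>h\<bar> * \<bar>h\<bar>" by (simp add: power2_eq_square)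
    moreover have "(m (\<theta> + h) - m \<theta>) / h - D = (m (\<theta> + h) - m \<theta> - h * D) / h" using h by (simp add: field_simps)
    ultimately show ?thesis using h by (simp add: abs_divide divide_le_eq)
  qed
  have "((\<lambda>h. (m (\<theta> + h) - m \<theta>) / h - D) \<longlongrightarrow> 0) (at 0)"
  proof (rule Lim_null_comparison)
    show "\<forall>\<^sub>F h in at 0. norm ((m (\<theta> + h) - m \<theta>) / h - D) \<le> K * \<bar>h\<bar>"
      unfolding eventually_at
    proof (intro exI[of _ "1 / (C + 1)"] conjI ballI impI)
      fix h :: real assume "h \<noteq> 0 \<and> dist h 0 < 1 / (C + 1)"
      then show "norm ((m (\<theta> + h) - m \<theta>) / h - D) \<le> K * \<bar>h\<bar>"
        using key[of h] C by (simp add: field_simps)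
    qed (use C in auto)
    show "((\<lambda>h. K * \<bar>h\<bar>) \<longlongrightarrow> 0) (at 0)" by (auto intro!: tendsto_eq_intros)
  qed
  then have "((\<lambda>h. (m (\<theta> + h) - m \<theta>) / h) \<longlongrightarrow> D) (at 0)" by (simp add: Lim_null[symmetric])
  then show ?thesis unfolding DERIV_def m_def D_def .
qed

section \<open>Quadratic identities and bounds for matrices with orthonormal columns\<close>

lemma orthonormal_cols_sum_squares:
  fixes e :: "nat \<Rightarrow> nat \<Rightarrow> real"
  assumes e: "\<And>q. q < d \<Longrightarrow> (\<Sum>p<d. (e p q)\<^sup>2) = 1"
  shows "(\<Sum>p<d. \<Sum>q<d. (x q)\<^sup>2 * (e p q)\<^sup>2) = (\<Sum>q<d. (x q)\<^sup>2)"
    and "(\<Sum>p<d. \<Sum>q<d. (x p)\<^sup>2 * (e q p)\<^sup>2) = (\<Sum>q<d. (x q)\<^sup>2)"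
proof -
  show 1: "(\<Sum>p<d. \<Sum>q<d. (x q)\<^sup>2 * (e p q)\<^sup>2) = (\<Sum>q<d. (x q)\<^sup>2)"
    by (subst sum.swap) (simp add: sum_distrib_left[symmetric] e)
  show "(\<Sum>p<d. \<Sum>q<d. (x p)\<^sup>2 * (e q p)\<^sup>2) = (\<Sum>q<d. (x q)\<^sup>2)"
    by (simp add: sum_distrib_left[symmetric] e)
qed

lemma sum_pairs_offdiag:
  fixes g :: "nat \<Rightarrow> real"
  shows "(\<Sum>p<d. \<Sum>q<d. if p = q then 0 else g q + g p) = 2 * (real d - 1) * (\<Sum>p<d. g p)"
proof -
  have "(\<Sum>p<d. \<Sum>q<d. if p = q then 0 else g q + g p)
      = (\<Sum>p<d. \<Sum>q<d. g q + g p - (if p = q then 2 * g p else 0))"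
    by (intro sum.cong refl) auto
  also have "\<dots> = 2 * (real d - 1) * (\<Sum>p<d. g p)"
    by (simp add: sum_subtractf sum.distrib sum_distrib_left algebra_simps)
  finally show ?thesis .
qed

text \<open>Squared Hilbert-Schmidt norm of UX - (UX)^T for U = (e p q) and X = diag(x): each of the
  two squares gives |x|^2, and the cross term is the trace of (UX)^2.\<close>

lemma antisymmetric_sum_square:
  fixes e :: "nat \<Rightarrow> nat \<Rightarrow> real"
  assumes e: "\<And>q. q < d \<Longrightarrow> (\<Sum>p<d. (e p q)\<^sup>2) = 1"
  shows "(\<Sum>p<d. \<Sum>q<d. (x q * e p q - x p * e q p)\<^sup>2)
    = 2 * (\<Sum>q<d. (x q)\<^sup>2) - 2 * (\<Sum>p<d. \<Sum>q<d. x p * x q * e p q * e q p)"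
proof -
  have "(\<Sum>p<d. \<Sum>q<d. (x q * e p q - x p * e q p)\<^sup>2)
     = (\<Sum>p<d. \<Sum>q<d. (x q)\<^sup>2 * (e p q)\<^sup>2 + (x p)\<^sup>2 * (e q p)\<^sup>2 - 2 * (x p * x q * e p q * e q p))"
    by (intro sum.cong refl) (simp add: power2_eq_square algebra_simps)
  then show ?thesis
    by (simp add: sum.distrib sum_subtractf orthonormal_cols_sum_squares[OF e]) (simp add: sum_distrib_left)
qed

text \<open>The trace of (UX)^2 is at most the squared Hilbert-Schmidt norm of UX, by 2 |a b| <= a^2
  + b^2 in every entry.\<close>

lemma twisted_trace_bound:
  fixes e :: "nat \<Rightarrow> nat \<Rightarrow> real"
  assumes e: "\<And>q. q < d \<Longrightarrow> (\<Sum>p<d. (e p q)\<^sup>2) = 1"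
  shows "\<bar>\<Sum>p<d. \<Sum>q<d. x p * x q * e p q * e q p\<bar> \<le> (\<Sum>q<d. (x q)\<^sup>2)"
proof -
  have "\<bar>\<Sum>p<d. \<Sum>q<d. x p * x q * e p q * e q p\<bar> \<le> (\<Sum>p<d. \<Sum>q<d. \<bar>x p * x q * e p q * e q p\<bar>)"
    by (intro order.trans[OF sum_abs] sum_mono sum_abs)
  also have "\<dots> \<le> (\<Sum>p<d. \<Sum>q<d. ((x q)\<^sup>2 * (e p q)\<^sup>2 + (x p)\<^sup>2 * (e q p)\<^sup>2) / 2)"
  proof (intro sum_mono)
    fix p q
    have "0 \<le> (\<bar>x q * e p q\<bar> - \<bar>x p * e q p\<bar>)\<^sup>2" by simp
    then show "\<bar>x p * x q * e p q * e q p\<bar> \<le> ((x q)\<^sup>2 * (e p q)\<^sup>2 + (x p)\<^sup>2 * (e q p)\<^sup>2) / 2"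
      by (simp add: power2_diff abs_mult power_mult_distrib mult_ac)
  qed
  also have "\<dots> = (\<Sum>q<d. (x q)\<^sup>2)"
    by (simp add: sum_divide_distrib[symmetric] sum.distrib orthonormal_cols_sum_squares[OF e])
  finally show ?thesis .
qed

text \<open>The inner sum is the entry \<open>(p, q)\<close> of U X U. The left factor is an
  isometry, so column \<open>q\<close> has the same norm as column \<open>q\<close> of X U.\<close>

lemma weighted_gram_column_norm:
  fixes e :: "nat \<Rightarrow> nat \<Rightarrow> real"
  assumes e: "\<And>i j. i < d \<Longrightarrow> j < d \<Longrightarrow> (\<Sum>p<d. e p i * e p j) = (if i = j then 1 else 0)"
  shows "(\<Sum>p<d. (\<Sum>j<d. x j * e p j * e j q)\<^sup>2) = (\<Sum>j<d. (x j)\<^sup>2 * (e j q)\<^sup>2)"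
proof -
  have "(\<Sum>p<d. (\<Sum>j<d. x j * e p j * e j q)\<^sup>2)
      = (\<Sum>p<d. \<Sum>i<d. \<Sum>j<d. x i * e i q * (x j * e j q) * (e p i * e p j))"
    by (simp add: power2_eq_square sum_product mult_ac)
  also have "\<dots> = (\<Sum>i<d. \<Sum>j<d. \<Sum>p<d. x i * e i q * (x j * e j q) * (e p i * e p j))"
    by (subst sum.swap) (intro sum.cong refl sum.swap)
  also have "\<dots> = (\<Sum>i<d. \<Sum>j<d. x i * e i q * (x j * e j q) * (if i = j then 1 else 0))"
    by (intro sum.cong refl) (simp add: sum_distrib_left[symmetric] e)
  also have "\<dots> = (\<Sum>i<d. \<Sum>j<d. if j = i then x i * e i q * (x i * e i q) else 0)"
    by (intro sum.cong refl) auto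
  also have "\<dots> = (\<Sum>j<d. (x j)\<^sup>2 * (e j q)\<^sup>2)" by (simp add: power2_eq_square mult_ac)
  finally show ?thesis .
qed

text \<open>The products are estimated by |a b| <= a^2 / (2 c) + c b^2 / 2. The weight
  \<open>c\<close> balances the two halves, because the columns of U X U have norm at most
  \<open>c\<close> while those of U have norm 1; each half contributes 2 c |x|^2.\<close>

lemma mixed_antisymmetric_sum_bound:
  fixes e :: "nat \<Rightarrow> nat \<Rightarrow> real"
  assumes e: "\<And>i j. i < d \<Longrightarrow> j < d \<Longrightarrow> (\<Sum>p<d. e p i * e p j) = (if i = j then 1 else 0)"
    and x: "\<And>j. j < d \<Longrightarrow> \<bar>x j\<bar> \<le> c" and c: "c > 0"
  defines "C \<equiv> \<lambda>p q. \<Sum>j<d. x j * e p j * e j q"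
  shows "\<bar>\<Sum>p<d. \<Sum>q<d. (x q * C p q - x p * C q p) * (x q * e p q - x p * e q p)\<bar>
    \<le> 4 * c * (\<Sum>q<d. (x q)\<^sup>2)"
proof -
  have e2: "(\<Sum>p<d. (e p q)\<^sup>2) = 1" if "q < d" for q using e[OF that that] by (simp add: power2_eq_square)
  have C2: "(\<Sum>p<d. (C p q)\<^sup>2) \<le> c\<^sup>2" if "q < d" for q
  proof -
    have "(\<Sum>p<d. (C p q)\<^sup>2) = (\<Sum>j<d. (x j)\<^sup>2 * (e j q)\<^sup>2)"
      unfolding C_def by (rule weighted_gram_column_norm[OF e])
    also have "\<dots> \<le> (\<Sum>j<d. c\<^sup>2 * (e j q)\<^sup>2)"
    proof (intro sum_mono mult_right_mono)
      fix j assume "j \<in> {..<d}"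
      then show "(x j)\<^sup>2 \<le> c\<^sup>2" using x[of j] c by (intro abs_le_square_iff[THEN iffD1]) auto
    qed auto
    also have "\<dots> = c\<^sup>2" using e2[OF that] by (simp add: sum_distrib_left[symmetric])
    finally show ?thesis .
  qed
  have C3: "(\<Sum>p<d. \<Sum>q<d. (x q)\<^sup>2 * (C p q)\<^sup>2) \<le> c\<^sup>2 * (\<Sum>q<d. (x q)\<^sup>2)"
  proof -
    have "(\<Sum>p<d. \<Sum>q<d. (x q)\<^sup>2 * (C p q)\<^sup>2) = (\<Sum>q<d. (x q)\<^sup>2 * (\<Sum>p<d. (C p q)\<^sup>2))"
      by (subst sum.swap) (simp add: sum_distrib_left)
    also have "\<dots> \<le> (\<Sum>q<d. (x q)\<^sup>2 * c\<^sup>2)" using C2 by (intro sum_mono mult_left_mono) auto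
    finally show ?thesis by (simp add: sum_distrib_left mult.commute)
  qed
  have C4: "(\<Sum>p<d. \<Sum>q<d. (x p)\<^sup>2 * (C q p)\<^sup>2) \<le> c\<^sup>2 * (\<Sum>q<d. (x q)\<^sup>2)"
    using C3 by (subst sum.swap)
  have linear: "(\<Sum>p<d. \<Sum>q<d. (f p q + g p q) / c + c * (h p q + k p q))
      = ((\<Sum>p<d. \<Sum>q<d. f p q) + (\<Sum>p<d. \<Sum>q<d. g p q)) / c
      + c * ((\<Sum>p<d. \<Sum>q<d. h p q) + (\<Sum>p<d. \<Sum>q<d. k p q))" for f g h k :: "nat \<Rightarrow> nat \<Rightarrow> real"
    by (simp add: sum.distrib sum_divide_distrib sum_distrib_left add_divide_distrib distrib_left)
  have "\<bar>\<Sum>p<d. \<Sum>q<d. (x q * C p q - x p * C q p) * (x q * e p q - x p * e q p)\<bar>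
      \<le> (\<Sum>p<d. \<Sum>q<d. \<bar>(x q * C p q - x p * C q p) * (x q * e p q - x p * e q p)\<bar>)"
    by (intro order.trans[OF sum_abs] sum_mono sum_abs)
  also have "\<dots> \<le> (\<Sum>p<d. \<Sum>q<d. ((x q)\<^sup>2 * (C p q)\<^sup>2 + (x p)\<^sup>2 * (C q p)\<^sup>2) / c
      + c * ((x q)\<^sup>2 * (e p q)\<^sup>2 + (x p)\<^sup>2 * (e q p)\<^sup>2))"
  proof (intro sum_mono)
    fix p q
    define a b where "a = x q * C p q - x p * C q p" and "b = x q * e p q - x p * e q p"
    have amgm: "\<bar>a * b\<bar> \<le> a\<^sup>2 / (2 * c) + c * b\<^sup>2 / 2"
    proof -
      have "0 \<le> (\<bar>a\<bar> - c * \<bar>b\<bar>)\<^sup>2" by simp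
      then have "2 * c * \<bar>a * b\<bar> \<le> a\<^sup>2 + c\<^sup>2 * b\<^sup>2" by (simp add: power2_diff abs_mult power_mult_distrib mult_ac)
      then have "\<bar>a * b\<bar> \<le> (a\<^sup>2 + c\<^sup>2 * b\<^sup>2) / (2 * c)" using c by (simp add: field_simps)
      also have "\<dots> = a\<^sup>2 / (2 * c) + c * b\<^sup>2 / 2" using c by (simp add: field_simps power2_eq_square)
      finally show ?thesis .
    qed
    have sq: "(u - v)\<^sup>2 \<le> 2 * (u\<^sup>2 + v\<^sup>2)" for u v :: real
      using zero_le_power2[of "u + v"] by (simp add: power2_sum power2_diff)
    have "a\<^sup>2 \<le> 2 * ((x q)\<^sup>2 * (C p q)\<^sup>2 + (x p)\<^sup>2 * (C q p)\<^sup>2)"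
      using sq[of "x q * C p q" "x p * C q p"] by (simp add: a_def power_mult_distrib)
    then have "a\<^sup>2 / (2 * c) \<le> ((x q)\<^sup>2 * (C p q)\<^sup>2 + (x p)\<^sup>2 * (C q p)\<^sup>2) / c" using c by (simp add: field_simps)
    moreover have "b\<^sup>2 \<le> 2 * ((x q)\<^sup>2 * (e p q)\<^sup>2 + (x p)\<^sup>2 * (e q p)\<^sup>2)"
      using sq[of "x q * e p q" "x p * e q p"] by (simp add: b_def power_mult_distrib)
    then have "c * b\<^sup>2 / 2 \<le> c * ((x q)\<^sup>2 * (e p q)\<^sup>2 + (x p)\<^sup>2 * (e q p)\<^sup>2)" using c by simp
    ultimately show "\<bar>(x q * C p q - x p * C q p) * (x q * e p q - x p * e q p)\<bar>
      \<le> ((x q)\<^sup>2 * (C p q)\<^sup>2 + (x p)\<^sup>2 * (C q p)\<^sup>2) / c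
      + c * ((x q)\<^sup>2 * (e p q)\<^sup>2 + (x p)\<^sup>2 * (e q p)\<^sup>2)"
      using amgm unfolding a_def[symmetric] b_def[symmetric] by linarith
  qed
  also have "\<dots> = ((\<Sum>p<d. \<Sum>q<d. (x q)\<^sup>2 * (C p q)\<^sup>2) + (\<Sum>p<d. \<Sum>q<d. (x p)\<^sup>2 * (C q p)\<^sup>2)) / c
      + c * ((\<Sum>p<d. \<Sum>q<d. (x q)\<^sup>2 * (e p q)\<^sup>2) + (\<Sum>p<d. \<Sum>q<d. (x p)\<^sup>2 * (e q p)\<^sup>2))"
    by (rule linear)
  also have "\<dots> \<le> (c\<^sup>2 * (\<Sum>q<d. (x q)\<^sup>2) + c\<^sup>2 * (\<Sum>q<d. (x q)\<^sup>2)) / c + c * ((\<Sum>q<d. (x q)\<^sup>2) + (\<Sum>q<d. (x q)\<^sup>2))"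
    using C3 C4 c by (intro add_mono divide_right_mono mult_left_mono)
      (simp_all add: orthonormal_cols_sum_squares[OF e2])
  also have "\<dots> = 4 * c * (\<Sum>q<d. (x q)\<^sup>2)" using c by (simp add: field_simps power2_eq_square)
  finally show ?thesis .
qed

section \<open>Functionals of a Haar matrix and their derivatives along rotations\<close>

context haar
begin

definition bdd :: "(real mat \<Rightarrow> real) \<Rightarrow> bool" where
  "bdd f \<longleftrightarrow> (\<exists>C. \<forall>U \<in> orthogonal_group d. \<bar>f U\<bar> \<le> C)"

named_theorems bdd_intros

lemma bdd_const [bdd_intros]: "bdd (\<lambda>_. c)"
  by (auto simp: bdd_def)

lemma bdd_ent [bdd_intros]: "bdd (E i j)"
  using ent_le[of _ d i j] by (auto simp: bdd_def)

lemma bdd_add [bdd_intros]: "bdd f \<Longrightarrow> bdd g \<Longrightarrow> bdd (\<lambda>U. f U + g U)"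
  unfolding bdd_def by (meson abs_triangle_ineq add_mono order_trans)

lemma bdd_mult [bdd_intros]:
  assumes "bdd f" "bdd g" shows "bdd (\<lambda>U. f U * g U)"
proof -
  obtain A B where *: "\<forall>U \<in> orthogonal_group d. \<bar>f U\<bar> \<le> A" "\<forall>U \<in> orthogonal_group d. \<bar>g U\<bar> \<le> B"
    using assms unfolding bdd_def by blast
  have "\<bar>f U * g U\<bar> \<le> A * B" if "U \<in> orthogonal_group d" for U
    unfolding abs_mult using * that by (intro mult_mono) (auto intro: order_trans[OF abs_ge_zero])
  then show ?thesis unfolding bdd_def by blast
qed

lemma bdd_uminus [bdd_intros]: "bdd f \<Longrightarrow> bdd (\<lambda>U. - f U)"
  by (simp add: bdd_def)

lemma bdd_diff [bdd_intros]: "bdd f \<Longrightarrow> bdd g \<Longrightarrow> bdd (\<lambda>U. f U - g U)"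
  using bdd_add[of f "\<lambda>U. - g U"] bdd_uminus by simp

lemma bdd_divide [bdd_intros]: "bdd f \<Longrightarrow> bdd (\<lambda>U. f U / c)"
  using bdd_mult[OF _ bdd_const, of f "inverse c"] by (simp add: divide_inverse)

lemma bdd_sum [bdd_intros]: "(\<And>i. i \<in> I \<Longrightarrow> bdd (f i)) \<Longrightarrow> bdd (\<lambda>U. \<Sum>i\<in>I. f i U)"
  by (induction I rule: infinite_finite_induct) (auto intro: bdd_intros)

lemma bdd_power [bdd_intros]: "bdd f \<Longrightarrow> bdd (\<lambda>U. f U ^ n)"
  by (induction n) (auto intro: bdd_intros)

lemma bdd_exp [bdd_intros]:
  assumes "bdd f" shows "bdd (\<lambda>U. exp (f U))"
proof -
  obtain C where "\<forall>U \<in> orthogonal_group d. \<bar>f U\<bar> \<le> C" using assms unfolding bdd_def by blast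
  then have "\<forall>U \<in> orthogonal_group d. \<bar>exp (f U)\<bar> \<le> exp C" by (auto dest: abs_le_D1)
  then show ?thesis unfolding bdd_def by blast
qed

lemma integrable_bdd:
  assumes "bdd f" "f \<in> borel_measurable (orthogonal_borel d)"
  shows "integrable \<mu> f"
  using assms unfolding bdd_def by (auto intro: integrable_bounded)

lemma integral_rotation_derivative':
  assumes pq: "p < d" "q < d" "p \<noteq> q"
    and m: "\<phi> \<in> borel_measurable (orthogonal_borel d)" "\<phi>' \<in> borel_measurable (orthogonal_borel d)"
    and b: "bdd \<phi>" "bdd \<phi>'"
    and D: "\<And>U s. U \<in> orthogonal_group d \<Longrightarrow>
      ((\<lambda>s. \<phi> (rot p q s * U)) has_real_derivative \<phi>' (rot p q s * U)) (at s)"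
  shows "(\<integral>U. \<phi>' U \<partial>\<mu>) = 0"
proof -
  obtain A B where *: "\<forall>U \<in> orthogonal_group d. \<bar>\<phi> U\<bar> \<le> A" "\<forall>U \<in> orthogonal_group d. \<bar>\<phi>' U\<bar> \<le> B"
    using b unfolding bdd_def by blast
  show ?thesis
    by (rule integral_rotation_derivative[OF pq m, of "max A B"]) (use * D in fastforce)+
qed

definition dtr :: "(nat \<Rightarrow> real) \<Rightarrow> real mat \<Rightarrow> real" where
  "dtr x U = (\<Sum>i<d. x i * E i i U)"

text \<open>The entry \<open>(p, q)\<close> of U X U, where X = diag(x).\<close>

definition gram :: "(nat \<Rightarrow> real) \<Rightarrow> nat \<Rightarrow> nat \<Rightarrow> real mat \<Rightarrow> real" where
  "gram x p q U = (\<Sum>j<d. x j * E p j U * E j q U)"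

text \<open>The trace of (XU)^2, where X = diag(x): the cross term that the Stein identity for
  \<open>dtr\<close> produces.\<close>

definition twist :: "(nat \<Rightarrow> real) \<Rightarrow> real mat \<Rightarrow> real" where
  "twist x U = (\<Sum>p<d. \<Sum>q<d. x p * x q * E p q U * E q p U)"

lemma measurable_dtr_gram_twist [measurable]:
  "dtr x \<in> borel_measurable (orthogonal_borel d)"
  "gram x p q \<in> borel_measurable (orthogonal_borel d)"
  "twist x \<in> borel_measurable (orthogonal_borel d)"
  unfolding dtr_def[abs_def] gram_def[abs_def] twist_def[abs_def] by measurable

lemma bdd_dtr_gram_twist [bdd_intros]: "bdd (dtr x)" "bdd (gram x p q)" "bdd (twist x)"
  unfolding dtr_def[abs_def] gram_def[abs_def] twist_def[abs_def] by (intro bdd_intros)+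

lemma gram_diag_sum: "(\<Sum>p<d. x p * gram x p p U) = twist x U"
  by (simp add: gram_def twist_def sum_distrib_left mult_ac)

lemma dtr_rot_deriv:
  assumes pq: "p < d" "q < d" "p \<noteq> q" and U: "U \<in> orthogonal_group d"
  shows "((\<lambda>s. dtr x (rot p q s * U)) has_real_derivative
    (x q * E p q (rot p q s * U) - x p * E q p (rot p q s * U))) (at s)"
proof -
  let ?U = "rot p q s * U"
  have "((\<lambda>s. dtr x (rot p q s * U)) has_real_derivative (\<Sum>i<d. x i * dent p q i i ?U)) (at s)"
    unfolding dtr_def by (auto intro!: derivative_eq_intros ent_rot_deriv[OF pq U] simp: mult.commute)
  also have "(\<Sum>i<d. x i * dent p q i i ?U)
      = (\<Sum>i<d. (if i = p then - E q p ?U else if i = q then E p q ?U else 0) * x i)"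
    by (intro sum.cong refl) (auto simp: dent_def)
  also have "\<dots> = x q * E p q ?U - x p * E q p ?U" by (subst sum_two_points[OF pq]) simp
  finally show ?thesis .
qed

text \<open>U enters U X U twice. Rotating the left factor turns the entry into a diagonal entry of
  \<open>gram\<close>, up to sign; in the right factor only the rows \<open>p\<close> and
  \<open>q\<close> move, which leaves two explicit terms.\<close>

lemma gram_rot_deriv:
  assumes pq: "p < d" "q < d" "p \<noteq> q" and U: "U \<in> orthogonal_group d"
  defines "V \<equiv> \<lambda>s. rot p q s * U"
  shows "((\<lambda>s. gram x p q (V s)) has_real_derivative
    (- gram x q q (V s) + x q * (E p q (V s))\<^sup>2 - x p * E p p (V s) * E q q (V s))) (at s)"
    and "((\<lambda>s. gram x q p (V s)) has_real_derivative
    (gram x p p (V s) - x p * (E q p (V s))\<^sup>2 + x q * E p p (V s) * E q q (V s))) (at s)"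
proof -
  have g: "((\<lambda>s. gram x a b (V s)) has_real_derivative
      (\<Sum>j<d. x j * dent p q a j (V s) * E j b (V s)) + (\<Sum>j<d. x j * E a j (V s) * dent p q j b (V s))) (at s)" for a b
    unfolding gram_def V_def sum.distrib[symmetric]
    by (auto intro!: derivative_eq_intros ent_rot_deriv[OF pq U] sum.cong simp: algebra_simps)
  have two: "(\<Sum>j<d. x j * E a j (V s) * dent p q j b (V s))
      = x q * E a q (V s) * E p b (V s) - x p * E a p (V s) * E q b (V s)" for a b
  proof -
    have "(\<Sum>j<d. x j * E a j (V s) * dent p q j b (V s))
      = (\<Sum>j<d. (if j = p then - E q b (V s) else if j = q then E p b (V s) else 0) * (x j * E a j (V s)))"
      by (intro sum.cong refl) (auto simp: dent_def)
    then show ?thesis by (simp add: sum_two_points[OF pq])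
  qed
  have one: "(\<Sum>j<d. x j * dent p q p j (V s) * E j q (V s)) = - gram x q q (V s)"
    by (simp add: dent_def gram_def sum_negf)
  show "((\<lambda>s. gram x p q (V s)) has_real_derivative
    (- gram x q q (V s) + x q * (E p q (V s))\<^sup>2 - x p * E p p (V s) * E q q (V s))) (at s)"
    using g[of p q] unfolding one two by (simp add: power2_eq_square algebra_simps)
  have one': "(\<Sum>j<d. x j * dent p q q j (V s) * E j p (V s)) = gram x p p (V s)"
    using pq by (simp add: dent_def gram_def)
  show "((\<lambda>s. gram x q p (V s)) has_real_derivative
    (gram x p p (V s) - x p * (E q p (V s))\<^sup>2 + x q * E p p (V s) * E q q (V s))) (at s)"
    using g[of q p] unfolding one' two by (simp add: power2_eq_square algebra_simps)
qed

text \<open>Unnormalised density of the tilted measure; \<theta> runs from 0, which is Haar measure,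
  to 1, which gives the moment that is wanted.\<close>

definition tilt :: "real \<Rightarrow> (nat \<Rightarrow> real) \<Rightarrow> real mat \<Rightarrow> real" where
  "tilt \<theta> x U = exp (\<theta> * (real d * dtr x U))"

lemma measurable_tilt [measurable]: "tilt \<theta> x \<in> borel_measurable (orthogonal_borel d)"
  unfolding tilt_def[abs_def] by measurable

lemma bdd_tilt [bdd_intros]: "bdd (tilt \<theta> x)"
  unfolding tilt_def[abs_def] by (intro bdd_intros)

lemma tilt_rot_deriv:
  assumes pq: "p < d" "q < d" "p \<noteq> q" and U: "U \<in> orthogonal_group d"
  defines "V \<equiv> \<lambda>s. rot p q s * U"
  shows "((\<lambda>s. tilt \<theta> x (V s)) has_real_derivative
    (\<theta> * real d * (x q * E p q (V s) - x p * E q p (V s)) * tilt \<theta> x (V s))) (at s)"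
  unfolding tilt_def V_def
  by (auto intro!: derivative_eq_intros dtr_rot_deriv[OF pq U])

lemma sum_offdiag_integral_zero:
  assumes "\<And>p q. p < d \<Longrightarrow> q < d \<Longrightarrow> p \<noteq> q \<Longrightarrow> (\<integral>U. F p q U \<partial>\<mu>) = 0"
    and m: "\<And>p q. F p q \<in> borel_measurable (orthogonal_borel d)" and b: "\<And>p q. bdd (F p q)"
  shows "(\<integral>U. (\<Sum>p<d. \<Sum>q<d. if p = q then 0 else F p q U) \<partial>\<mu>) = 0"
proof -
  have int: "integrable \<mu> (\<lambda>U. if p = q then 0 else F p q U)" for p q
    using integrable_bdd[OF b m] by (cases "p = q") auto
  have "(\<integral>U. (\<Sum>p<d. \<Sum>q<d. if p = q then 0 else F p q U) \<partial>\<mu>)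
      = (\<Sum>p<d. \<Sum>q<d. \<integral>U. (if p = q then 0 else F p q U) \<partial>\<mu>)"
    using int by (subst Bochner_Integration.integral_sum; (intro sum.cong refl Bochner_Integration.integral_sum)?) auto
  also have "\<dots> = 0"
  proof (intro sum.neutral ballI)
    fix p q assume "p \<in> {..<d}" "q \<in> {..<d}"
    then show "(\<integral>U. (if p = q then 0 else F p q U) \<partial>\<mu>) = 0" using assms(1)[of p q] by (cases "p = q") auto
  qed
  finally show ?thesis .
qed

lemma ent_cols_sq: "U \<in> orthogonal_group d \<Longrightarrow> q < d \<Longrightarrow> (\<Sum>p<d. (E p q U)\<^sup>2) = 1"
  using ent_cols[of U d q q] by (simp add: power2_eq_square)

text \<open>Differentiate \<open>(x q * E p q - x p * E q p) * tilt\<close> along the rotation of the rows \<open>p\<close> and \<open>q\<close>,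
  integrate, and sum over \<open>p \<noteq> q\<close>.\<close>

lemma stein_trace:
  "(real d - 1) * (\<integral>U. dtr x U * tilt \<theta> x U \<partial>\<mu>)
    = \<theta> * real d * ((\<Sum>i<d. (x i)\<^sup>2) * (\<integral>U. tilt \<theta> x U \<partial>\<mu>) - (\<integral>U. twist x U * tilt \<theta> x U \<partial>\<mu>))"
proof -
  define a where "a p q U = x q * E p q U - x p * E q p U" for p q U
  define F where "F p q U = (- (x q * E q q U + x p * E p p U) + \<theta> * real d * (a p q U)\<^sup>2) * tilt \<theta> x U" for p q U
  have [measurable]: "a p q \<in> borel_measurable (orthogonal_borel d)" for p q
    unfolding a_def[abs_def] by measurable
  have ba [bdd_intros]: "bdd (a p q)" for p q
    unfolding a_def[abs_def] by (intro bdd_intros)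
  have Fm: "F p q \<in> borel_measurable (orthogonal_borel d)" for p q
    unfolding F_def[abs_def] by measurable
  have Fb: "bdd (F p q)" for p q
    unfolding F_def[abs_def] by (intro bdd_intros)
  have "(\<integral>U. F p q U \<partial>\<mu>) = 0" if pq: "p < d" "q < d" "p \<noteq> q" for p q
  proof (rule integral_rotation_derivative'[OF pq, of "\<lambda>U. a p q U * tilt \<theta> x U"])
    fix U s assume U: "U \<in> orthogonal_group d"
    show "((\<lambda>s. a p q (rot p q s * U) * tilt \<theta> x (rot p q s * U)) has_real_derivative F p q (rot p q s * U)) (at s)"
      unfolding a_def F_def using pq
      by (auto intro!: derivative_eq_intros ent_rot_deriv[OF pq U] tilt_rot_deriv[OF pq U]
          simp: dent_def power2_eq_square algebra_simps)
  qed (use Fm Fb in \<open>auto intro: bdd_intros\<close>)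
  then have "0 = (\<integral>U. (\<Sum>p<d. \<Sum>q<d. if p = q then 0 else F p q U) \<partial>\<mu>)"
    by (intro sum_offdiag_integral_zero[symmetric] Fm Fb)
  also have "\<dots> = (\<integral>U. - 2 * (real d - 1) * (dtr x U * tilt \<theta> x U)
      + 2 * \<theta> * real d * ((\<Sum>i<d. (x i)\<^sup>2) * tilt \<theta> x U - twist x U * tilt \<theta> x U) \<partial>\<mu>)"
  proof (rule Bochner_Integration.integral_cong[OF refl])
    fix U assume "U \<in> space \<mu>"
    then have U: "U \<in> orthogonal_group d" by simp
    \<comment> \<open>\<open>a p p U\<close> is 0, so the squares may be summed over all pairs.
      Every diagonal entry of \<open>U\<close> occurs with \<open>d - 1\<close> partners in either
      position, which is the source of the factor \<open>d - 1\<close>.\<close>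
    have "(\<Sum>p<d. \<Sum>q<d. if p = q then 0 else F p q U)
        = (\<Sum>p<d. \<Sum>q<d. - (if p = q then 0 else x q * E q q U + x p * E p p U) * tilt \<theta> x U
          + \<theta> * real d * tilt \<theta> x U * (a p q U)\<^sup>2)"
      by (intro sum.cong refl) (auto simp: F_def a_def algebra_simps)
    also have "\<dots> = - (\<Sum>p<d. \<Sum>q<d. if p = q then 0 else x q * E q q U + x p * E p p U) * tilt \<theta> x U
        + \<theta> * real d * tilt \<theta> x U * (\<Sum>p<d. \<Sum>q<d. (a p q U)\<^sup>2)"
      by (simp add: sum.distrib sum_subtractf sum_distrib_left sum_distrib_right sum_negf)
    also have "(\<Sum>p<d. \<Sum>q<d. if p = q then 0 else x q * E q q U + x p * E p p U)
        = 2 * (real d - 1) * dtr x U"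
      unfolding dtr_def by (rule sum_pairs_offdiag)
    also have "(\<Sum>p<d. \<Sum>q<d. (a p q U)\<^sup>2) = 2 * (\<Sum>i<d. (x i)\<^sup>2) - 2 * twist x U"
      unfolding a_def twist_def by (rule antisymmetric_sum_square[OF ent_cols_sq[OF U]])
    finally show "(\<Sum>p<d. \<Sum>q<d. if p = q then 0 else F p q U) = - 2 * (real d - 1) * (dtr x U * tilt \<theta> x U)
      + 2 * \<theta> * real d * ((\<Sum>i<d. (x i)\<^sup>2) * tilt \<theta> x U - twist x U * tilt \<theta> x U)"
      by (simp add: algebra_simps)
  qed
  also have "\<dots> = - 2 * (real d - 1) * (\<integral>U. dtr x U * tilt \<theta> x U \<partial>\<mu>)
      + 2 * \<theta> * real d * ((\<Sum>i<d. (x i)\<^sup>2) * (\<integral>U. tilt \<theta> x U \<partial>\<mu>) - (\<integral>U. twist x U * tilt \<theta> x U \<partial>\<mu>))"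
  proof -
    have "integrable \<mu> (\<lambda>U. dtr x U * tilt \<theta> x U)" "integrable \<mu> (tilt \<theta> x)" "integrable \<mu> (\<lambda>U. twist x U * tilt \<theta> x U)"
      by (intro integrable_bdd bdd_intros; measurable)+
    then show ?thesis by simp
  qed
  finally show ?thesis by (simp add: algebra_simps)
qed

text \<open>The same with \<open>x q * gram p q - x p * gram q p\<close> in place of \<open>x q * E p q - x p * E q p\<close>. The term
  \<open>- 2 * (dtr x U)\<^sup>2\<close> has the favourable sign and is dropped.\<close>

lemma stein_twist_le:
  assumes c: "\<And>j. j < d \<Longrightarrow> \<bar>x j\<bar> \<le> c" "c > 0" and \<theta>: "\<theta> \<ge> 0"
  shows "(real d - 1) * (\<integral>U. twist x U * tilt \<theta> x U \<partial>\<mu>)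
    \<le> (1 + 2 * \<theta> * real d * c) * (\<Sum>i<d. (x i)\<^sup>2) * (\<integral>U. tilt \<theta> x U \<partial>\<mu>)"
proof -
  define a where "a p q U = x q * E p q U - x p * E q p U" for p q U
  define b where "b p q U = x q * gram x p q U - x p * gram x q p U" for p q U
  define r where "r p q U = (x q)\<^sup>2 * (E p q U)\<^sup>2 + (x p)\<^sup>2 * (E q p U)\<^sup>2
     - 2 * (x p * E p p U) * (x q * E q q U)" for p q U
  define R where "R U = (\<Sum>p<d. \<Sum>q<d. b p q U * a p q U)" for U
  define F where "F p q U = (- (x q * gram x q q U + x p * gram x p p U) + r p q U
     + \<theta> * real d * (b p q U * a p q U)) * tilt \<theta> x U" for p q U
  define X where "X = (\<Sum>i<d. (x i)\<^sup>2)"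
  have [measurable]: "a p q \<in> borel_measurable (orthogonal_borel d)" "b p q \<in> borel_measurable (orthogonal_borel d)"
    "r p q \<in> borel_measurable (orthogonal_borel d)" for p q
    unfolding a_def[abs_def] b_def[abs_def] r_def[abs_def] by measurable
  have ba [bdd_intros]: "bdd (a p q)" "bdd (b p q)" "bdd (r p q)" for p q
    unfolding a_def[abs_def] b_def[abs_def] r_def[abs_def] by (intro bdd_intros)+
  have [measurable]: "R \<in> borel_measurable (orthogonal_borel d)" unfolding R_def[abs_def] by measurable
  have bR [bdd_intros]: "bdd R" unfolding R_def[abs_def] by (intro bdd_intros)
  have Fm: "F p q \<in> borel_measurable (orthogonal_borel d)" for p q
    unfolding F_def[abs_def] by measurable
  have Fb: "bdd (F p q)" for p q
    unfolding F_def[abs_def] by (intro bdd_intros)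
  have "(\<integral>U. F p q U \<partial>\<mu>) = 0" if pq: "p < d" "q < d" "p \<noteq> q" for p q
  proof (rule integral_rotation_derivative'[OF pq, of "\<lambda>U. b p q U * tilt \<theta> x U"])
    fix U s assume U: "U \<in> orthogonal_group d"
    show "((\<lambda>s. b p q (rot p q s * U) * tilt \<theta> x (rot p q s * U)) has_real_derivative F p q (rot p q s * U)) (at s)"
      unfolding b_def F_def a_def r_def
      by (rule derivative_eq_intros gram_rot_deriv[OF pq U] tilt_rot_deriv[OF pq U] refl)+
        (simp add: power2_eq_square algebra_simps)
  qed (use Fm Fb in \<open>auto intro: bdd_intros\<close>)
  then have "0 = (\<integral>U. (\<Sum>p<d. \<Sum>q<d. if p = q then 0 else F p q U) \<partial>\<mu>)"
    by (intro sum_offdiag_integral_zero[symmetric] Fm Fb)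
  also have "\<dots> = (\<integral>U. (- 2 * (real d - 1) * twist x U + 2 * X - 2 * (dtr x U)\<^sup>2
      + \<theta> * real d * R U) * tilt \<theta> x U \<partial>\<mu>)"
  proof (rule Bochner_Integration.integral_cong[OF refl])
    fix U assume "U \<in> space \<mu>"
    then have U: "U \<in> orthogonal_group d" by simp
    \<comment> \<open>\<open>r p p U\<close> and \<open>a p p U\<close> vanish, so only the
      \<open>gram\<close> terms keep the restriction to distinct indices.\<close>
    have "(\<Sum>p<d. \<Sum>q<d. if p = q then 0 else F p q U)
        = (\<Sum>p<d. \<Sum>q<d. (- (if p = q then 0 else x q * gram x q q U + x p * gram x p p U)
           + r p q U + \<theta> * real d * (b p q U * a p q U)) * tilt \<theta> x U)"
      by (intro sum.cong refl) (auto simp: F_def a_def r_def power2_eq_square)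
    also have "\<dots> = (- (\<Sum>p<d. \<Sum>q<d. if p = q then 0 else x q * gram x q q U + x p * gram x p p U)
        + (\<Sum>p<d. \<Sum>q<d. r p q U) + \<theta> * real d * R U) * tilt \<theta> x U"
      unfolding R_def by (simp add: sum.distrib sum_distrib_left sum_distrib_right sum_negf distrib_right left_diff_distrib sum_subtractf)
    also have "(\<Sum>p<d. \<Sum>q<d. if p = q then 0 else x q * gram x q q U + x p * gram x p p U)
        = 2 * (real d - 1) * twist x U"
      unfolding gram_diag_sum[symmetric] by (rule sum_pairs_offdiag)
    also have "(\<Sum>p<d. \<Sum>q<d. r p q U) = X + X - 2 * (dtr x U)\<^sup>2"
    proof -
      have "(\<Sum>p<d. \<Sum>q<d. 2 * (x p * E p p U) * (x q * E q q U)) = 2 * (dtr x U)\<^sup>2"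
        unfolding dtr_def power2_eq_square sum_product by (simp add: sum_distrib_left mult.assoc)
      then show ?thesis
        unfolding r_def X_def
        by (simp add: sum.distrib sum_subtractf orthonormal_cols_sum_squares[OF ent_cols_sq[OF U]])
    qed
    finally show "(\<Sum>p<d. \<Sum>q<d. if p = q then 0 else F p q U)
        = (- 2 * (real d - 1) * twist x U + 2 * X - 2 * (dtr x U)\<^sup>2 + \<theta> * real d * R U) * tilt \<theta> x U"
      by (simp add: algebra_simps)
  qed
  also have "\<dots> \<le> (\<integral>U. - 2 * (real d - 1) * (twist x U * tilt \<theta> x U)
      + (2 * X + \<theta> * real d * (4 * c * X)) * tilt \<theta> x U \<partial>\<mu>)"
  proof (rule integral_mono)
    fix U assume "U \<in> space \<mu>"
    then have U: "U \<in> orthogonal_group d" by simp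
    have "\<bar>R U\<bar> \<le> 4 * c * X"
      unfolding R_def b_def a_def gram_def X_def
      by (rule mixed_antisymmetric_sum_bound[OF ent_cols[OF U] c])
    then have "\<theta> * real d * R U \<le> \<theta> * real d * (4 * c * X)" using \<theta> by (intro mult_left_mono) auto
    moreover have "- 2 * (dtr x U)\<^sup>2 \<le> 0" by simp
    ultimately have "- 2 * (real d - 1) * twist x U + 2 * X - 2 * (dtr x U)\<^sup>2 + \<theta> * real d * R U
      \<le> - 2 * (real d - 1) * twist x U + (2 * X + \<theta> * real d * (4 * c * X))" by linarith
    then have "(- 2 * (real d - 1) * twist x U + 2 * X - 2 * (dtr x U)\<^sup>2 + \<theta> * real d * R U) * tilt \<theta> x U
      \<le> (- 2 * (real d - 1) * twist x U + (2 * X + \<theta> * real d * (4 * c * X))) * tilt \<theta> x U"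
      by (intro mult_right_mono) (simp_all add: tilt_def)
    then show "(- 2 * (real d - 1) * twist x U + 2 * X - 2 * (dtr x U)\<^sup>2 + \<theta> * real d * R U) * tilt \<theta> x U
      \<le> - 2 * (real d - 1) * (twist x U * tilt \<theta> x U) + (2 * X + \<theta> * real d * (4 * c * X)) * tilt \<theta> x U"
      by (simp add: algebra_simps)
  qed (intro integrable_bdd bdd_intros; measurable)+
  also have "\<dots> = - 2 * (real d - 1) * (\<integral>U. twist x U * tilt \<theta> x U \<partial>\<mu>)
      + (2 * X + \<theta> * real d * (4 * c * X)) * (\<integral>U. tilt \<theta> x U \<partial>\<mu>)"
  proof -
    have "integrable \<mu> (tilt \<theta> x)" "integrable \<mu> (\<lambda>U. twist x U * tilt \<theta> x U)"
      by (intro integrable_bdd bdd_intros; measurable)+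
    then show ?thesis by simp
  qed
  finally show ?thesis by (simp add: X_def algebra_simps)
qed

end

section \<open>Exponential moments of weighted diagonal sums\<close>

text \<open>exp y + exp (-y) - 2 is the square of exp (|y|/2) - exp (-|y|/2), and this difference is
  at least |y|. The inequality turns a second moment into an exponential one in small
  dimensions.\<close>

lemma exp_symmetric_ge: "2 + y\<^sup>2 \<le> exp y + exp (- y :: real)"
proof -
  have *: "2 * z \<le> exp z - exp (- z)" if "z \<ge> 0" for z :: real
  proof -
    define w where "w = 1 + z + z\<^sup>2 / 2"
    have w: "w \<le> exp z" unfolding w_def using exp_lower_Taylor_quadratic[OF that] by simp
    have w1: "w > 0" unfolding w_def using that by (simp add: add_pos_nonneg)
    have "exp (- z) \<le> 1 / w" using w w1 by (simp add: exp_minus inverse_eq_divide frac_le)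
    moreover have "2 * z \<le> w - 1 / w"
    proof -
      have "w\<^sup>2 - 1 - 2 * z * w = z\<^sup>2 * z\<^sup>2 / 4"
        unfolding w_def by (simp add: power2_eq_square field_simps)
      then have "2 * z * w \<le> w\<^sup>2 - 1" by (smt (verit) zero_le_power2 mult_nonneg_nonneg divide_nonneg_pos)
      then show ?thesis using w1 by (simp add: field_simps power2_eq_square)
    qed
    ultimately show ?thesis using w by linarith
  qed
  have sq: "exp y + exp (- y) - 2 = (exp (\<bar>y\<bar> / 2) - exp (- (\<bar>y\<bar> / 2)))\<^sup>2"
  proof -
    have "(exp (\<bar>y\<bar> / 2) - exp (- (\<bar>y\<bar> / 2)))\<^sup>2 = exp (\<bar>y\<bar>) + exp (- \<bar>y\<bar>) - 2"
      by (simp add: power2_diff flip: exp_of_nat_mult exp_add)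
    then show ?thesis by (cases "y \<ge> 0") auto
  qed
  have "\<bar>y\<bar>\<^sup>2 \<le> (exp (\<bar>y\<bar> / 2) - exp (- (\<bar>y\<bar> / 2)))\<^sup>2"
    using *[of "\<bar>y\<bar> / 2"] by (intro power_mono) auto
  then show ?thesis using sq by simp
qed

lemma sign_matrix_orthogonal:
  assumes "\<And>i. \<bar>\<sigma> i\<bar> = (1::real)"
  shows "mat_diag d \<sigma> \<in> orthogonal_group d"
proof -
  have "\<sigma> i * \<sigma> i = 1" for i using assms[of i] by (auto simp: abs_if split: if_splits)
  then have "mat_diag d \<sigma> * mat_diag d \<sigma> = 1\<^sub>m d"
    by (subst mat_diag_mult_left[of _ d d]) (auto simp: mat_diag_def)
  moreover have "transpose_mat (mat_diag d \<sigma>) = mat_diag d \<sigma>" by (auto simp: mat_diag_def)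
  ultimately show ?thesis by (simp add: orthogonal_group_def)
qed

lemma ent_sign_mult:
  "U \<in> orthogonal_group d \<Longrightarrow> ent d i j (mat_diag d \<sigma> * U) = \<sigma> i * ent d i j U"
  using orthogonal_groupD(1)[of U d] by (auto simp: ent_def mat_diag_mult_left[of _ d d])

context haar
begin

lemma prob_orthogonal_group [simp]: "measure \<mu> (orthogonal_group d) = 1"
  using prob_space by simp

lemma integral_sign_flip:
  assumes "\<And>i. \<bar>\<sigma> i\<bar> = (1::real)" "(f :: real mat \<Rightarrow> real) \<in> borel_measurable (orthogonal_borel d)"
  shows "(\<integral>V. f (mat_diag d \<sigma> * V) \<partial>\<mu>) = (\<integral>V. f V \<partial>\<mu>)"
  by (rule integral_left_mult[OF sign_matrix_orthogonal[OF assms(1)]]) (use assms in simp)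

lemma dtr_sign: "U \<in> orthogonal_group d \<Longrightarrow> dtr x (mat_diag d \<sigma> * U) = dtr (\<lambda>i. \<sigma> i * x i) U"
  unfolding dtr_def by (intro sum.cong refl) (simp add: ent_sign_mult)

lemma integral_dtr_neg:
  assumes [measurable]: "g \<in> borel_measurable borel"
  shows "(\<integral>U. g (- dtr x U) \<partial>\<mu>) = (\<integral>U. g (dtr x U) \<partial>\<mu> :: real)"
proof -
  have "(\<integral>U. g (dtr x (mat_diag d (\<lambda>_. - 1) * U)) \<partial>\<mu>) = (\<integral>U. g (dtr x U) \<partial>\<mu>)"
    by (rule integral_sign_flip) auto
  moreover have "(\<integral>U. g (dtr x (mat_diag d (\<lambda>_. - 1) * U)) \<partial>\<mu>) = (\<integral>U. g (- dtr x U) \<partial>\<mu>)"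
    by (rule Bochner_Integration.integral_cong) (auto simp: dtr_sign, simp add: dtr_def sum_negf)
  ultimately show ?thesis by simp
qed

lemma integral_dtr: "(\<integral>U. dtr x U \<partial>\<mu>) = 0"
  using integral_dtr_neg[of "\<lambda>y. y" x] by simp

text \<open>A quarter turn moves row \<open>p\<close> into row \<open>i\<close>, so all entries of
  column \<open>i\<close> have the same second moment, and their squares add up to 1.\<close>

lemma integral_ent_square:
  assumes "i < d" shows "(\<integral>U. (E i i U)\<^sup>2 \<partial>\<mu>) = 1 / real d"
proof -
  have eq: "(\<integral>U. (E p i U)\<^sup>2 \<partial>\<mu>) = (\<integral>U. (E i i U)\<^sup>2 \<partial>\<mu>)" if p: "p < d" for p
  proof (cases "p = i")
    case False
    have "(\<integral>U. (E i i (rot p i (pi / 2) * U))\<^sup>2 \<partial>\<mu>) = (\<integral>U. (E i i U)\<^sup>2 \<partial>\<mu>)"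
      using p assms False by (intro integral_left_mult rot_orthogonal) auto
    moreover have "(\<integral>U. (E i i (rot p i (pi / 2) * U))\<^sup>2 \<partial>\<mu>) = (\<integral>U. (E p i U)\<^sup>2 \<partial>\<mu>)"
      using p assms False by (intro Bochner_Integration.integral_cong) (auto simp: ent_rot)
    ultimately show ?thesis by simp
  qed simp
  have int: "integrable \<mu> (\<lambda>U. (E p i U)\<^sup>2)" for p
    by (intro integrable_bdd bdd_intros) measurable
  have "real d * (\<integral>U. (E i i U)\<^sup>2 \<partial>\<mu>) = (\<Sum>p<d. \<integral>U. (E p i U)\<^sup>2 \<partial>\<mu>)" by (simp add: eq)
  also have "\<dots> = (\<integral>U. (\<Sum>p<d. (E p i U)\<^sup>2) \<partial>\<mu>)" using int by simp
  also have "\<dots> = (\<integral>U. 1 \<partial>\<mu>)"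
    using assms by (intro Bochner_Integration.integral_cong) (auto simp: ent_cols_sq)
  finally show ?thesis using assms by (simp add: prob_space field_simps)
qed

text \<open>Flipping the sign of row \<open>i\<close> preserves the measure and negates the
  product.\<close>

lemma integral_ent_product:
  assumes "i \<noteq> j" shows "(\<integral>U. E i i U * E j j U \<partial>\<mu>) = 0"
proof -
  define \<sigma> :: "nat \<Rightarrow> real" where "\<sigma> k = (if k = i then - 1 else 1)" for k
  have "(\<integral>U. E i i (mat_diag d \<sigma> * U) * E j j (mat_diag d \<sigma> * U) \<partial>\<mu>) = (\<integral>U. E i i U * E j j U \<partial>\<mu>)"
    by (rule integral_sign_flip[where f = "\<lambda>U. E i i U * E j j U"]) (auto simp: \<sigma>_def)
  moreover have "(\<integral>U. E i i (mat_diag d \<sigma> * U) * E j j (mat_diag d \<sigma> * U) \<partial>\<mu>) = (\<integral>U. - (E i i U * E j j U) \<partial>\<mu>)"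
    using assms by (intro Bochner_Integration.integral_cong) (auto simp: ent_sign_mult \<sigma>_def)
  ultimately show ?thesis by simp
qed

lemma integral_dtr_square:
  assumes "d > 0" shows "(\<integral>U. (dtr x U)\<^sup>2 \<partial>\<mu>) = (\<Sum>i<d. (x i)\<^sup>2) / real d"
proof -
  have int: "integrable \<mu> (\<lambda>U. E i i U * E j j U)" for i j
    by (intro integrable_bdd bdd_intros) measurable
  have "(\<integral>U. (dtr x U)\<^sup>2 \<partial>\<mu>) = (\<integral>U. (\<Sum>i<d. \<Sum>j<d. x i * x j * (E i i U * E j j U)) \<partial>\<mu>)"
    unfolding dtr_def power2_eq_square sum_product by (simp add: mult_ac)
  also have "\<dots> = (\<Sum>i<d. \<Sum>j<d. x i * x j * (\<integral>U. E i i U * E j j U \<partial>\<mu>))"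
    using int by simp
  also have "\<dots> = (\<Sum>i<d. \<Sum>j<d. if j = i then (x i)\<^sup>2 / real d else 0)"
    using integral_ent_product integral_ent_square
    by (intro sum.cong refl) (auto simp: power2_eq_square)
  also have "\<dots> = (\<Sum>i<d. (x i)\<^sup>2) / real d" by (simp add: sum_divide_distrib)
  finally show ?thesis .
qed

lemma tilt_deriv:
  "((\<lambda>\<theta>. \<integral>U. tilt \<theta> x U \<partial>\<mu>) has_real_derivative real d * (\<integral>U. dtr x U * tilt \<theta> x U \<partial>\<mu>)) (at \<theta>)"
proof -
  have "bdd (\<lambda>U. real d * dtr x U)" by (intro bdd_intros)
  then obtain C where "\<forall>U \<in> orthogonal_group d. \<bar>real d * dtr x U\<bar> \<le> C" unfolding bdd_def by blast
  then have "((\<lambda>\<theta>. \<integral>U. tilt \<theta> x U \<partial>\<mu>) has_real_derivative (\<integral>U. real d * dtr x U * tilt \<theta> x U \<partial>\<mu>)) (at \<theta>)"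
    unfolding tilt_def by (intro exponential_moment_deriv[of _ C]) auto
  then show ?thesis by (simp add: mult.assoc)
qed

lemma integrable_tilt:
  "integrable \<mu> (tilt \<theta> x)" "integrable \<mu> (\<lambda>U. twist x U * tilt \<theta> x U)" "integrable \<mu> (\<lambda>U. dtr x U * tilt \<theta> x U)"
  by (intro integrable_bdd bdd_intros; measurable)+

lemma integral_tilt_nonneg: "(\<integral>U. tilt \<theta> x U \<partial>\<mu>) \<ge> 0"
  by (intro integral_nonneg_AE) (simp add: tilt_def)

lemma integral_tilt_0: "(\<integral>U. tilt 0 x U \<partial>\<mu>) = 1"
  by (simp add: tilt_def prob_space)

text \<open>With |twist| <= |x|^2 the Stein identity bounds \<open>d - 1\<close> times the tilted
  integral of \<open>dtr\<close> by 2 \<theta> d |x|^2 m(\<theta>). For d >= 2 one has d <= 2 (d -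
  1), hence m' <= 4 \<theta> d |x|^2 m, and integration over [0, 1] gives the exponent 2 d
  |x|^2.\<close>

theorem exp_moment_upper:
  "(\<integral>U. exp (real d * dtr x U) \<partial>\<mu>) \<le> exp (2 * real d * (\<Sum>i<d. (x i)\<^sup>2))"
proof (cases "d \<ge> 2")
  case True
  define X where "X = (\<Sum>i<d. (x i)\<^sup>2)"
  have X: "X \<ge> 0" unfolding X_def by (intro sum_nonneg) auto
  define m where "m \<theta> = (\<integral>U. tilt \<theta> x U \<partial>\<mu>)" for \<theta>
  define D where "D \<theta> = (\<integral>U. dtr x U * tilt \<theta> x U \<partial>\<mu>)" for \<theta>
  have D: "real d * D \<theta> \<le> 4 * \<theta> * real d * X * m \<theta>" if "\<theta> \<ge> 0" for \<theta>
  proof -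
    have "- (\<integral>U. twist x U * tilt \<theta> x U \<partial>\<mu>) = (\<integral>U. - (twist x U) * tilt \<theta> x U \<partial>\<mu>)" by simp
    also have "\<dots> \<le> (\<integral>U. X * tilt \<theta> x U \<partial>\<mu>)"
    proof (rule integral_mono)
      fix U assume "U \<in> space \<mu>"
      then have "\<bar>twist x U\<bar> \<le> X"
        unfolding twist_def X_def by (intro twisted_trace_bound ent_cols_sq) auto
      then show "- (twist x U) * tilt \<theta> x U \<le> X * tilt \<theta> x U"
        by (intro mult_right_mono) (auto simp: tilt_def)
    qed (use integrable_tilt in auto)
    also have "\<dots> = X * m \<theta>" by (simp add: m_def)
    finally have tw: "- (\<integral>U. twist x U * tilt \<theta> x U \<partial>\<mu>) \<le> X * m \<theta>" .
    have "(real d - 1) * D \<theta> = \<theta> * real d * (X * m \<theta> + - (\<integral>U. twist x U * tilt \<theta> x U \<partial>\<mu>))"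
      unfolding D_def stein_trace by (simp add: X_def m_def)
    also have "\<dots> \<le> \<theta> * real d * (X * m \<theta> + X * m \<theta>)"
      using tw that by (intro mult_left_mono add_left_mono) auto
    finally have 1: "(real d - 1) * D \<theta> \<le> 2 * \<theta> * real d * X * m \<theta>" by simp
    show ?thesis
    proof (cases "D \<theta> \<ge> 0")
      case True
      then have "real d * D \<theta> \<le> 2 * (real d - 1) * D \<theta>" using \<open>d \<ge> 2\<close> by (intro mult_right_mono) auto
      then show ?thesis using 1 by linarith
    next
      case False
      then have "real d * D \<theta> \<le> 0" by (simp add: mult_nonneg_nonpos)
      moreover have "0 \<le> 4 * \<theta> * real d * X * m \<theta>"
        using that X integral_tilt_nonneg[of \<theta> x] by (simp add: m_def)
      ultimately show ?thesis by linarith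
    qed
  qed
  have "m 1 * exp (- (2 * real d * X) * 1\<^sup>2) \<le> m 0 * exp (- (2 * real d * X) * 0\<^sup>2)"
  proof (rule DERIV_nonpos_imp_nonincreasing[of 0 1 "\<lambda>\<theta>. m \<theta> * exp (- (2 * real d * X) * \<theta>\<^sup>2)"])
    fix \<theta> :: real assume \<theta>: "0 \<le> \<theta>"
    have "((\<lambda>\<theta>. m \<theta> * exp (- (2 * real d * X) * \<theta>\<^sup>2)) has_real_derivative
       (real d * D \<theta> - 4 * \<theta> * real d * X * m \<theta>) * exp (- (2 * real d * X) * \<theta>\<^sup>2)) (at \<theta>)"
      unfolding m_def D_def
      by (rule derivative_eq_intros tilt_deriv refl)+ (simp add: algebra_simps)
    moreover have "(real d * D \<theta> - 4 * \<theta> * real d * X * m \<theta>) * exp (- (2 * real d * X) * \<theta>\<^sup>2) \<le> 0"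
      using D[OF \<theta>] by (intro mult_nonpos_nonneg) auto
    ultimately show "\<exists>y. ((\<lambda>\<theta>. m \<theta> * exp (- (2 * real d * X) * \<theta>\<^sup>2)) has_real_derivative y) (at \<theta>) \<and> y \<le> 0"
      by blast
  qed simp
  then have "m 1 * exp (- (2 * real d * X)) \<le> 1" by (simp add: m_def integral_tilt_0)
  then have "m 1 \<le> exp (2 * real d * X)" by (simp add: exp_minus field_simps)
  then show ?thesis by (simp add: m_def tilt_def X_def)
next
  case False
  then consider "d = 0" | "d = 1" by linarith
  then show ?thesis
  proof cases
    case 1
    then show ?thesis by (simp add: prob_space)
  next
    case 2
    \<comment> \<open>Dimension 1 has no plane rotations; there \<open>dtr x\<close> is centred with
      values between -|x 0| and |x 0|, and Hoeffding's lemma applies.\<close>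
    interpret I: interval_bounded_random_variable \<mu> "dtr x" "- \<bar>x 0\<bar>" "\<bar>x 0\<bar>"
    proof unfold_locales
      have "\<bar>dtr x U\<bar> \<le> \<bar>x 0\<bar>" if "U \<in> orthogonal_group d" for U
        using ent_le[OF that, of 0 0] mult_left_mono[of "\<bar>E 0 0 U\<bar>" 1 "\<bar>x 0\<bar>"] unfolding dtr_def
        by (simp add: abs_mult 2)
      then show "AE U in \<mu>. dtr x U \<in> {- \<bar>x 0\<bar>..\<bar>x 0\<bar>}" by (intro AE_I2) (auto simp: abs_le_iff minus_le_iff)
    qed auto
    have int: "integrable \<mu> (\<lambda>U. exp (dtr x U))" by (intro integrable_bdd bdd_intros; measurable)
    have "ennreal (\<integral>U. exp (dtr x U) \<partial>\<mu>) = (\<integral>\<^sup>+U. exp (1 * dtr x U) \<partial>\<mu>)"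
      using int by (subst nn_integral_eq_integral) auto
    also have "\<dots> \<le> ennreal (exp (1\<^sup>2 * (\<bar>x 0\<bar> - - \<bar>x 0\<bar>)\<^sup>2 / 8))"
      by (rule I.Hoeffdings_lemma_nn_integral_0) (auto simp: integral_dtr)
    finally have "(\<integral>U. exp (dtr x U) \<partial>\<mu>) \<le> exp ((2 * \<bar>x 0\<bar>)\<^sup>2 / 8)" by simp
    also have "\<dots> \<le> exp (2 * (x 0)\<^sup>2)" by (simp add: power_mult_distrib)
    finally show ?thesis using 2 by simp
  qed
qed

text \<open>The bound on \<open>twist\<close> beats the main term of the Stein identity only for \<open>d \<ge> 4\<close>; for smaller \<open>d\<close> the exponent is
  at most \<open>1\<close> and the second moment suffices.\<close>

theorem exp_moment_lower:
  assumes x: "\<And>i. i < d \<Longrightarrow> \<bar>x i\<bar> \<le> 1 / 16"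
  shows "exp (real d * (\<Sum>i<d. (x i)\<^sup>2) / 4) \<le> (\<integral>U. exp (real d * dtr x U) \<partial>\<mu>)"
proof (cases "d \<ge> 4")
  case True
  define X where "X = (\<Sum>i<d. (x i)\<^sup>2)"
  have X: "X \<ge> 0" unfolding X_def by (intro sum_nonneg) auto
  define m where "m \<theta> = (\<integral>U. tilt \<theta> x U \<partial>\<mu>)" for \<theta>
  define D where "D \<theta> = (\<integral>U. dtr x U * tilt \<theta> x U \<partial>\<mu>)" for \<theta>
  have m: "m \<theta> \<ge> 0" for \<theta> unfolding m_def by (rule integral_tilt_nonneg)
  have D: "\<theta> * real d * X * m \<theta> / 2 \<le> real d * D \<theta>" if "\<theta> \<ge> 0" "\<theta> \<le> 1" for \<theta>
  proof -
    define T where "T = (\<integral>U. twist x U * tilt \<theta> x U \<partial>\<mu>)"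
    have "(real d - 1) * T \<le> (1 + 2 * \<theta> * real d * (1/16)) * X * m \<theta>"
      unfolding T_def X_def m_def by (rule stein_twist_le) (use x that in auto)
    \<comment> \<open>For \<open>c = 1/16\<close> and \<theta> <= 1 the coefficient is at most 1 +
      d/8, which is at most (d - 1)/2 as soon as d >= 4. Half of the main term of the Stein identity
      then survives.\<close>
    also have "\<dots> \<le> ((real d - 1) / 2) * X * m \<theta>"
    proof (intro mult_right_mono)
      have "\<theta> * real d \<le> 1 * real d" using that by (intro mult_right_mono) auto
      then have 1: "\<theta> * real d \<le> real d" by simp
      have 2: "4 \<le> real d" using True by simp
      have "1 + 2 * \<theta> * real d * (1/16) = 1 + (\<theta> * real d) / 8" by simp
      also have "\<dots> \<le> 1 + real d / 8" using 1 by simp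
      also have "\<dots> \<le> (real d - 1) / 2" using 2 by (simp add: field_simps)
      finally show "1 + 2 * \<theta> * real d * (1/16) \<le> (real d - 1) / 2" .
    qed (use X m in auto)
    finally have "(real d - 1) * T \<le> (real d - 1) * (X * m \<theta> / 2)" by simp
    then have T: "T \<le> X * m \<theta> / 2" using True by (subst (asm) mult_le_cancel_left_pos) auto
    have "\<theta> * real d * (X * m \<theta> / 2) \<le> \<theta> * real d * (X * m \<theta> - T)"
      using T that by (intro mult_left_mono) auto
    also have "\<dots> = (real d - 1) * D \<theta>" unfolding D_def stein_trace by (simp add: X_def m_def T_def)
    finally have 1: "\<theta> * real d * (X * m \<theta> / 2) \<le> (real d - 1) * D \<theta>" .
    have "0 \<le> \<theta> * real d * (X * m \<theta> / 2)" using that X m by simp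
    with 1 have "0 \<le> (real d - 1) * D \<theta>" by linarith
    then have "D \<theta> \<ge> 0" using True by (simp add: zero_le_mult_iff)
    then show ?thesis using 1 by (simp add: algebra_simps)
  qed
  \<comment> \<open>The differential inequality m' >= \<theta> d X m / 2, integrated from 0 to
    1.\<close>
  have "m 0 * exp (- (real d * X / 4) * 0\<^sup>2) \<le> m 1 * exp (- (real d * X / 4) * 1\<^sup>2)"
  proof (rule DERIV_nonneg_imp_nondecreasing[of 0 1 "\<lambda>\<theta>. m \<theta> * exp (- (real d * X / 4) * \<theta>\<^sup>2)"])
    fix \<theta> :: real assume \<theta>: "0 \<le> \<theta>" "\<theta> \<le> 1"
    have "((\<lambda>\<theta>. m \<theta> * exp (- (real d * X / 4) * \<theta>\<^sup>2)) has_real_derivative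
       (real d * D \<theta> - \<theta> * real d * X * m \<theta> / 2) * exp (- (real d * X / 4) * \<theta>\<^sup>2)) (at \<theta>)"
      unfolding m_def D_def
      by (rule derivative_eq_intros tilt_deriv refl)+ (simp add: algebra_simps)
    moreover have "(real d * D \<theta> - \<theta> * real d * X * m \<theta> / 2) * exp (- (real d * X / 4) * \<theta>\<^sup>2) \<ge> 0"
      using D[OF \<theta>] by (intro mult_nonneg_nonneg) auto
    ultimately show "\<exists>y. ((\<lambda>\<theta>. m \<theta> * exp (- (real d * X / 4) * \<theta>\<^sup>2)) has_real_derivative y) (at \<theta>) \<and> y \<ge> 0"
      by blast
  qed simp
  then have "1 \<le> m 1 * exp (- (real d * X / 4))" by (simp add: m_def integral_tilt_0)
  then have "exp (real d * X / 4) \<le> m 1" by (simp add: exp_minus field_simps)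
  then show ?thesis by (simp add: m_def tilt_def X_def)
next
  case False
  show ?thesis
  proof (cases "d = 0")
    case True
    then show ?thesis using prob_orthogonal_group by simp
  next
    case d: False
    define u where "u = real d * (\<Sum>i<d. (x i)\<^sup>2)"
    have "u \<ge> 0" unfolding u_def by (intro mult_nonneg_nonneg sum_nonneg) auto
    have "(\<Sum>i<d. (x i)\<^sup>2) \<le> (\<Sum>i<d. (1/16)\<^sup>2)"
      using x by (intro sum_mono abs_le_square_iff[THEN iffD1]) auto
    then have "u \<le> real d * (real d * (1/16)\<^sup>2)" unfolding u_def by (intro mult_left_mono) auto
    also have "\<dots> \<le> 3 * (3 * (1/16)\<^sup>2)" using False by (intro mult_mono) auto
    finally have "u \<le> 1" by (simp add: power2_eq_square)
    have "exp (u / 4) \<le> 1 + u / 4 + (u / 4)\<^sup>2"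
      using \<open>u \<ge> 0\<close> \<open>u \<le> 1\<close> by (intro exp_bound) auto
    also have "\<dots> \<le> 1 + u / 2"
      using \<open>u \<ge> 0\<close> \<open>u \<le> 1\<close> mult_left_mono[of u 1 u] by (simp add: power2_eq_square)
    \<comment> \<open>\<open>dtr x\<close> has second moment |x|^2 / d, so the quadratic term has
      mean d |x|^2 / 2 = u/2. Symmetry of the law of \<open>dtr x\<close> then allows exp to be
      replaced by its even part.\<close>
    also have "\<dots> = (\<integral>U. 1 + (real d)\<^sup>2 / 2 * (dtr x U)\<^sup>2 \<partial>\<mu>)"
    proof -
      have "integrable \<mu> (\<lambda>U. (dtr x U)\<^sup>2)" by (intro integrable_bdd bdd_intros) measurable
      then have "(\<integral>U. 1 + (real d)\<^sup>2 / 2 * (dtr x U)\<^sup>2 \<partial>\<mu>) = 1 + (real d)\<^sup>2 / 2 * (\<integral>U. (dtr x U)\<^sup>2 \<partial>\<mu>)"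
        by simp
      also have "\<dots> = 1 + u / 2"
        using d integral_dtr_square[of x] by (simp add: u_def) (simp add: power2_eq_square)
      finally show ?thesis ..
    qed
    also have "\<dots> \<le> (\<integral>U. (exp (real d * dtr x U) + exp (real d * - dtr x U)) / 2 \<partial>\<mu>)"
    proof (rule integral_mono)
      fix U
      show "1 + (real d)\<^sup>2 / 2 * (dtr x U)\<^sup>2 \<le> (exp (real d * dtr x U) + exp (real d * - dtr x U)) / 2"
        using exp_symmetric_ge[of "real d * dtr x U"] by (simp add: power_mult_distrib)
    qed (intro integrable_bdd bdd_intros; measurable)+
    also have "\<dots> = ((\<integral>U. exp (real d * dtr x U) \<partial>\<mu>) + (\<integral>U. exp (real d * - dtr x U) \<partial>\<mu>)) / 2"
    proof -
      have "integrable \<mu> (\<lambda>U. exp (real d * dtr x U))" "integrable \<mu> (\<lambda>U. exp (real d * - dtr x U))"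
        by (intro integrable_bdd bdd_intros; measurable)+
      then show ?thesis by simp
    qed
    also have "(\<integral>U. exp (real d * - dtr x U) \<partial>\<mu>) = (\<integral>U. exp (real d * dtr x U) \<partial>\<mu>)"
      by (rule integral_dtr_neg[of "\<lambda>y. exp (real d * y)"]) measurable
    finally show ?thesis by (simp add: u_def)
  qed
qed

end

section \<open>Permutation invariance and linear growth of the exponential moment\<close>

context haar
begin

text \<open>Both sides are \<open>\<integral>\<integral> exp (tr (U\<^sup>T V A))\<close>, integrated first over \<open>V\<close> or first over \<open>U\<close>. This replaces right
  invariance, which \<open>haar_orthogonal\<close> does not assume.\<close>

lemma integral_exp_transpose:
  "(\<integral>U. exp (\<Sum>i<d. \<Sum>j<d. E i j U * a i j) \<partial>\<mu>) = (\<integral>U. exp (\<Sum>i<d. \<Sum>j<d. E j i U * a i j) \<partial>\<mu>)"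
proof -
  define f where "f U V = exp (\<Sum>i<d. \<Sum>j<d. (\<Sum>k<d. E k i U * E k j V) * a i j)" for U V
  interpret P: pair_prob_space \<mu> \<mu> ..
  have tr: "E i j (transpose_mat U * V) = (\<Sum>k<d. E k i U * E k j V)"
    if "U \<in> orthogonal_group d" "V \<in> orthogonal_group d" "i < d" "j < d" for U V i j
    using that orthogonal_groupD(1)[OF that(1)]
    by (subst ent_mult[OF orthogonal_group_transpose]) (auto simp: ent_def intro!: sum.cong)
  have [measurable]: "(\<lambda>(U, V). f U V) \<in> borel_measurable (\<mu> \<Otimes>\<^sub>M \<mu>)"
    unfolding f_def split_beta by measurable
  have "integrable (\<mu> \<Otimes>\<^sub>M \<mu>) (\<lambda>(U, V). f U V)"
  proof (rule P.P.integrable_const_bound[where B = "exp (\<Sum>i<d. \<Sum>j<d. real d * \<bar>a i j\<bar>)"])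
    have "f U V \<le> exp (\<Sum>i<d. \<Sum>j<d. real d * \<bar>a i j\<bar>)"
      if U: "U \<in> orthogonal_group d" and V: "V \<in> orthogonal_group d" for U V
    proof -
      have "(\<Sum>k<d. E k i U * E k j V) * a i j \<le> real d * \<bar>a i j\<bar>" for i j
      proof -
        have "\<bar>\<Sum>k<d. E k i U * E k j V\<bar> \<le> (\<Sum>k<d. 1)"
          using ent_le[OF U] ent_le[OF V]
          by (intro order.trans[OF sum_abs] sum_mono) (auto simp: abs_mult intro!: mult_le_one)
        then have "\<bar>(\<Sum>k<d. E k i U * E k j V) * a i j\<bar> \<le> real d * \<bar>a i j\<bar>"
          unfolding abs_mult by (intro mult_right_mono) auto
        then show ?thesis by (rule order.trans[OF abs_ge_self])
      qed
      then show ?thesis unfolding f_def exp_le_cancel_iff by (intro sum_mono)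
    qed
    then show "AE UV in \<mu> \<Otimes>\<^sub>M \<mu>. norm ((\<lambda>(U, V). f U V) UV) \<le> exp (\<Sum>i<d. \<Sum>j<d. real d * \<bar>a i j\<bar>)"
      by (intro AE_I2) (auto simp: space_pair_measure f_def)
  qed measurable
  then have fub: "(\<integral>V. (\<integral>U. f U V \<partial>\<mu>) \<partial>\<mu>) = (\<integral>U. (\<integral>V. f U V \<partial>\<mu>) \<partial>\<mu>)"
    by (rule P.Fubini_integral)
  have 1: "(\<integral>V. f U V \<partial>\<mu>) = (\<integral>U. exp (\<Sum>i<d. \<Sum>j<d. E i j U * a i j) \<partial>\<mu>)" if U: "U \<in> orthogonal_group d" for U
  proof -
    have "(\<integral>V. f U V \<partial>\<mu>) = (\<integral>V. exp (\<Sum>i<d. \<Sum>j<d. E i j (transpose_mat U * V) * a i j) \<partial>\<mu>)"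
      unfolding f_def using tr[OF U] by (intro Bochner_Integration.integral_cong) auto
    also have "\<dots> = (\<integral>U. exp (\<Sum>i<d. \<Sum>j<d. E i j U * a i j) \<partial>\<mu>)"
      by (rule integral_left_mult[OF orthogonal_group_transpose[OF U], where f = "\<lambda>U. exp (\<Sum>i<d. \<Sum>j<d. E i j U * a i j)"])
        measurable
    finally show ?thesis .
  qed
  have 2: "(\<integral>U. f U V \<partial>\<mu>) = (\<integral>U. exp (\<Sum>i<d. \<Sum>j<d. E j i U * a i j) \<partial>\<mu>)" if V: "V \<in> orthogonal_group d" for V
  proof -
    have "(\<integral>U. f U V \<partial>\<mu>) = (\<integral>U. exp (\<Sum>i<d. \<Sum>j<d. E j i (transpose_mat V * U) * a i j) \<partial>\<mu>)"
      unfolding f_def using tr[OF V] by (intro Bochner_Integration.integral_cong) (auto simp: mult.commute)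
    also have "\<dots> = (\<integral>U. exp (\<Sum>i<d. \<Sum>j<d. E j i U * a i j) \<partial>\<mu>)"
      by (rule integral_left_mult[OF orthogonal_group_transpose[OF V], where f = "\<lambda>U. exp (\<Sum>i<d. \<Sum>j<d. E j i U * a i j)"])
        measurable
    finally show ?thesis .
  qed
  have "(\<integral>U. (\<integral>V. f U V \<partial>\<mu>) \<partial>\<mu>) = (\<integral>U. exp (\<Sum>i<d. \<Sum>j<d. E i j U * a i j) \<partial>\<mu>)"
    using 1 by (subst Bochner_Integration.integral_cong[OF refl, of _ _ "\<lambda>_. (\<integral>U. exp (\<Sum>i<d. \<Sum>j<d. E i j U * a i j) \<partial>\<mu>)"]) auto
  moreover have "(\<integral>V. (\<integral>U. f U V \<partial>\<mu>) \<partial>\<mu>) = (\<integral>U. exp (\<Sum>i<d. \<Sum>j<d. E j i U * a i j) \<partial>\<mu>)"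
    using 2 by (subst Bochner_Integration.integral_cong[OF refl, of _ _ "\<lambda>_. (\<integral>U. exp (\<Sum>i<d. \<Sum>j<d. E j i U * a i j) \<partial>\<mu>)"]) auto
  ultimately show ?thesis using fub by simp
qed

definition perm_mat :: "(nat \<Rightarrow> nat) \<Rightarrow> real mat" where
  "perm_mat \<pi> = Matrix.mat d d (\<lambda>(i, j). if j = \<pi> i then 1 else 0)"

lemma perm_mat_orthogonal:
  assumes "inj_on \<pi> {..<d}" "\<pi> ` {..<d} \<subseteq> {..<d}"
  shows "perm_mat \<pi> \<in> orthogonal_group d"
proof -
  have "transpose_mat (perm_mat \<pi>) \<in> orthogonal_group d"
  proof (rule orthogonal_groupI)
    fix i j assume ij: "i < d" "j < d"
    have "(\<Sum>k<d. transpose_mat (perm_mat \<pi>) $$ (k, i) * transpose_mat (perm_mat \<pi>) $$ (k, j))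
        = (\<Sum>k<d. if k = \<pi> i then (if \<pi> i = \<pi> j then 1 else 0) else 0)"
      using ij by (intro sum.cong refl) (auto simp: perm_mat_def)
    also have "\<dots> = (if i = j then 1 else 0)"
      using assms ij by (auto simp: inj_on_def)
    finally show "(\<Sum>k<d. transpose_mat (perm_mat \<pi>) $$ (k, i) * transpose_mat (perm_mat \<pi>) $$ (k, j))
        = (if i = j then 1 else 0)" .
  qed (simp add: perm_mat_def)
  from orthogonal_group_transpose[OF this] show ?thesis by simp
qed

lemma ent_perm_mult:
  assumes "inj_on \<pi> {..<d}" "\<pi> ` {..<d} \<subseteq> {..<d}" and U: "U \<in> orthogonal_group d" and ij: "i < d" "j < d"
  shows "E i j (perm_mat \<pi> * U) = E (\<pi> i) j U"
proof -
  have "\<pi> i < d" using assms by auto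
  have "E i j (perm_mat \<pi> * U) = (\<Sum>k<d. E i k (perm_mat \<pi>) * E k j U)"
    by (rule ent_mult[OF perm_mat_orthogonal[OF assms(1,2)] U ij])
  also have "\<dots> = (\<Sum>k<d. if k = \<pi> i then E (\<pi> i) j U else 0)"
    using ij by (intro sum.cong refl) (auto simp: ent_def perm_mat_def)
  finally show ?thesis using \<open>\<pi> i < d\<close> by simp
qed

text \<open>Left invariance permutes rows only. Columns are reached through the transpose: permute
  the rows, transpose, permute the rows again.\<close>

lemma exp_dtr_permute:
  assumes \<pi>: "inj_on \<pi> {..<d}" "\<pi> ` {..<d} \<subseteq> {..<d}"
  shows "(\<integral>U. exp (\<Sum>i<d. x i * E (\<pi> i) (\<pi> i) U) \<partial>\<mu>) = (\<integral>U. exp (dtr x U) \<partial>\<mu>)"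
proof -
  note P = perm_mat_orthogonal[OF \<pi>] and EP = ent_perm_mult[OF \<pi>]
  have \<pi>d: "\<pi> i < d" if "i < d" for i using \<pi>(2) that by auto
  have "(\<integral>U. exp (dtr x U) \<partial>\<mu>) = (\<integral>U. exp (dtr x (perm_mat \<pi> * U)) \<partial>\<mu>)"
    by (rule integral_left_mult[OF P, symmetric, where f = "\<lambda>U. exp (dtr x U)"]) measurable
  also have "\<dots> = (\<integral>U. exp (\<Sum>i<d. x i * E (\<pi> i) i U) \<partial>\<mu>)"
    by (intro Bochner_Integration.integral_cong refl) (auto simp: dtr_def EP)
  also have "\<dots> = (\<integral>U. exp (\<Sum>i<d. \<Sum>j<d. E j i U * (if j = \<pi> i then x i else 0)) \<partial>\<mu>)"
    using \<pi>d by (intro Bochner_Integration.integral_cong refl arg_cong[of _ _ exp] sum.cong)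
      (auto simp: if_distrib[of "\<lambda>y. _ * y"] mult.commute cong: if_cong)
  also have "\<dots> = (\<integral>U. exp (\<Sum>i<d. \<Sum>j<d. E i j U * (if j = \<pi> i then x i else 0)) \<partial>\<mu>)"
    by (rule integral_exp_transpose[symmetric])
  also have "\<dots> = (\<integral>U. exp (\<Sum>i<d. x i * E i (\<pi> i) U) \<partial>\<mu>)"
    using \<pi>d by (intro Bochner_Integration.integral_cong refl arg_cong[of _ _ exp] sum.cong)
      (auto simp: if_distrib[of "\<lambda>y. _ * y"] mult.commute cong: if_cong)
  also have "\<dots> = (\<integral>U. exp (\<Sum>i<d. x i * E i (\<pi> i) (perm_mat \<pi> * U)) \<partial>\<mu>)"
    by (rule integral_left_mult[OF P, symmetric, where f = "\<lambda>U. exp (\<Sum>i<d. x i * E i (\<pi> i) U)"]) measurable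
  also have "\<dots> = (\<integral>U. exp (\<Sum>i<d. x i * E (\<pi> i) (\<pi> i) U) \<partial>\<mu>)"
    using \<pi>d by (intro Bochner_Integration.integral_cong refl) (auto simp: EP)
  finally show ?thesis ..
qed

lemma cyclic_shift_bij: "k > 0 \<Longrightarrow> a < k \<Longrightarrow> bij_betw (\<lambda>j. (a + j) mod k) {..<k} {..<(k::nat)}"
proof -
  assume k: "k > 0" "a < k"
  have "inj_on (\<lambda>j. (a + j) mod k) {..<k}"
  proof (rule inj_onI)
    fix i j assume ij: "i \<in> {..<k}" "j \<in> {..<k}" "(a + i) mod k = (a + j) mod k"
    have "(a + j) mod k = (if a + j < k then a + j else a + j - k)" if "j < k" for j
      using k that by (auto simp: le_mod_geq)
    then show "i = j" using ij k by (auto split: if_splits)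
  qed
  moreover have "(\<lambda>j. (a + j) mod k) ` {..<k} \<subseteq> {..<k}" using k by auto
  ultimately show ?thesis using endo_inj_surj[of "{..<k}"] by (auto simp: bij_betw_def)
qed

text \<open>The moment does not change when the weights are shifted cyclically within
  \<open>S\<close>, and the mean of the shifted exponents carries the constant weight \<xi> on
  \<open>S\<close>. Convexity of exp gives the inequality.\<close>

lemma exp_moment_average:
  fixes x :: "nat \<Rightarrow> real"
  assumes S: "S \<subseteq> {..<d}" "S \<noteq> {}"
  defines "\<xi> \<equiv> (\<Sum>i\<in>S. x i) / real (card S)"
  shows "(\<integral>U. exp (\<Sum>i\<in>S. \<xi> * E i i U) \<partial>\<mu>) \<le> (\<integral>U. exp (\<Sum>i\<in>S. x i * E i i U) \<partial>\<mu>)"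
proof -
  have fin: "finite S" using S finite_subset by blast
  define k where "k = card S"
  have k: "k > 0" using S fin by (simp add: k_def card_gt_0_iff)
  obtain g where g: "bij_betw g {..<k} S" using ex_bij_betw_nat_finite[OF fin] by (auto simp: k_def lessThan_atLeast0)
  define h where "h = inv_into {..<k} g"
  have h: "h i < k" "g (h i) = i" if "i \<in> S" for i
    using g that unfolding h_def by (auto simp: bij_betw_def inv_into_into f_inv_into_f)
  have gS: "g j \<in> S" if "j < k" for j using g that by (auto simp: bij_betw_def)
  have hg: "h (g j) = j" if "j < k" for j using g that by (auto simp: bij_betw_def h_def)
  \<comment> \<open>Cyclic shift by \<open>j\<close> inside \<open>S\<close>, transported by the
    enumeration \<open>g\<close>; the identity outside \<open>S\<close>.\<close>
  define \<pi> where "\<pi> j i = (if i \<in> S then g ((j + h i) mod k) else i)" for j i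
  have \<pi>S: "\<pi> j i \<in> S" if "i \<in> S" for i j using that gS k by (simp add: \<pi>_def)
  have \<pi>d: "\<pi> j ` {..<d} \<subseteq> {..<d}" for j using \<pi>S S by (auto simp: \<pi>_def)
  have \<pi>i: "inj_on (\<pi> j) {..<d}" if j: "j < k" for j
  proof (rule inj_onI)
    fix a b assume ab: "\<pi> j a = \<pi> j b"
    show "a = b"
    proof (cases "a \<in> S \<and> b \<in> S")
      case True
      then have "g ((j + h a) mod k) = g ((j + h b) mod k)" using ab by (simp add: \<pi>_def)
      then have "(j + h a) mod k = (j + h b) mod k" using hg k by (metis mod_less_divisor)
      then have "h a = h b"
        using cyclic_shift_bij[OF k j] h True by (auto simp: bij_betw_def inj_on_def)
      then show ?thesis using h True by metis
    next
      case False
      then show ?thesis using ab \<pi>S by (metis \<pi>_def)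
    qed
  qed
  have cyc: "(\<Sum>j<k. f (\<pi> j i)) = (\<Sum>l\<in>S. f l)" if i: "i \<in> S" for i and f :: "nat \<Rightarrow> real"
  proof -
    have "(\<Sum>j<k. f (\<pi> j i)) = (\<Sum>j<k. f (g ((h i + j) mod k)))" using i by (simp add: \<pi>_def add.commute)
    also have "\<dots> = (\<Sum>j<k. f (g j))"
      by (rule sum.reindex_bij_betw[OF cyclic_shift_bij[OF k h(1)[OF i]], of "\<lambda>j. f (g j)"])
    also have "\<dots> = (\<Sum>l\<in>S. f l)" by (rule sum.reindex_bij_betw[OF g])
    finally show ?thesis .
  qed
  define y where "y i = (if i \<in> S then x i else 0)" for i
  have restr: "(\<Sum>i<d. y i * f i) = (\<Sum>i\<in>S. x i * f i)" for f :: "nat \<Rightarrow> real"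
    using S by (intro sum.mono_neutral_cong_right) (auto simp: y_def)
  have int: "integrable \<mu> (\<lambda>U. exp (\<Sum>i\<in>S. z i * E (p i) (p i) U))" for z and p :: "nat \<Rightarrow> nat"
    by (intro integrable_bdd bdd_intros; measurable)
  have perm: "(\<integral>U. exp (\<Sum>i\<in>S. x i * E (\<pi> j i) (\<pi> j i) U) \<partial>\<mu>) = (\<integral>U. exp (\<Sum>i\<in>S. x i * E i i U) \<partial>\<mu>)" if "j < k" for j
    using exp_dtr_permute[OF \<pi>i[OF that] \<pi>d, of y] by (simp add: restr dtr_def)
  have "(\<integral>U. exp (\<Sum>i\<in>S. \<xi> * E i i U) \<partial>\<mu>)
      \<le> (\<integral>U. (\<Sum>j<k. (1 / real k) * exp (\<Sum>i\<in>S. x i * E (\<pi> j i) (\<pi> j i) U)) \<partial>\<mu>)"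
  proof (rule integral_mono)
    fix U
    have "(\<Sum>i\<in>S. \<xi> * E i i U) = (\<Sum>j<k. (1 / real k) * (\<Sum>i\<in>S. x i * E (\<pi> j i) (\<pi> j i) U))"
    proof -
      have "(\<Sum>j<k. (1 / real k) * (\<Sum>i\<in>S. x i * E (\<pi> j i) (\<pi> j i) U))
          = (1 / real k) * (\<Sum>i\<in>S. x i * (\<Sum>j<k. E (\<pi> j i) (\<pi> j i) U))"
        unfolding sum_distrib_left[symmetric] by (subst sum.swap) (simp add: sum_distrib_left)
      also have "\<dots> = (1 / real k) * (\<Sum>i\<in>S. x i * (\<Sum>l\<in>S. E l l U))"
        by (simp add: cyc[of _ "\<lambda>l. E l l U"])
      also have "\<dots> = (\<Sum>i\<in>S. \<xi> * E i i U)"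
        by (simp add: \<xi>_def k_def sum_distrib_right[symmetric]) (simp add: sum_distrib_left sum_divide_distrib)
      finally show ?thesis ..
    qed
    moreover have "exp (\<Sum>j<k. (1 / real k) * (\<Sum>i\<in>S. x i * E (\<pi> j i) (\<pi> j i) U))
        \<le> (\<Sum>j<k. (1 / real k) * exp (\<Sum>i\<in>S. x i * E (\<pi> j i) (\<pi> j i) U))"
      using k convex_on_sum[of "{..<k}" UNIV exp "\<lambda>_. 1 / real k" "\<lambda>j. \<Sum>i\<in>S. x i * E (\<pi> j i) (\<pi> j i) U"]
      by (simp add: exp_convex lessThan_empty_iff)
    ultimately show "exp (\<Sum>i\<in>S. \<xi> * E i i U)
        \<le> (\<Sum>j<k. (1 / real k) * exp (\<Sum>i\<in>S. x i * E (\<pi> j i) (\<pi> j i) U))" by simp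
  qed (use int[of _ id] int in auto)
  also have "\<dots> = (\<Sum>j<k. (1 / real k) * (\<integral>U. exp (\<Sum>i\<in>S. x i * E (\<pi> j i) (\<pi> j i) U) \<partial>\<mu>))"
    using int by simp
  also have "\<dots> = (\<integral>U. exp (\<Sum>i\<in>S. x i * E i i U) \<partial>\<mu>)" using perm k by simp
  finally show ?thesis .
qed

text \<open>By averaging, a common weight \<xi> on \<open>S\<close> is enough. At \<xi> = 1/16 the
  quadratic bound gives the exponent b = d k / 1024 with k = card S, and for larger \<xi> Jensen's
  inequality with the power p = 16 \<xi> gives p b = d k \<xi> / 64. The subtracted term makes the
  claimed exponent nonpositive for \<xi> <= 1/16, where the moment is at least 1.\<close>

theorem exp_moment_linear_growth:
  assumes S: "S \<subseteq> {..<d}" and x: "\<And>i. i \<in> S \<Longrightarrow> x i \<ge> 0"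
  shows "exp (real d * ((\<Sum>i\<in>S. x i) / 64 - real (card S) / 1024)) \<le> (\<integral>U. exp (real d * (\<Sum>i\<in>S. x i * E i i U)) \<partial>\<mu>)"
proof (cases "S = {}")
  case True
  then show ?thesis by (simp add: prob_space)
next
  case False
  have fin: "finite S" using S finite_subset by blast
  define k where "k = real (card S)"
  have k: "k > 0" using False fin by (simp add: k_def card_gt_0_iff)
  define \<xi> where "\<xi> = (\<Sum>i\<in>S. x i) / k"
  have \<xi>: "\<xi> \<ge> 0" unfolding \<xi>_def using k x by (intro divide_nonneg_pos sum_nonneg) auto
  have sx: "(\<Sum>i\<in>S. x i) = k * \<xi>" using k by (simp add: \<xi>_def)
  define Y where "Y U = (\<Sum>i\<in>S. E i i U)" for U
  have [measurable]: "Y \<in> borel_measurable (orthogonal_borel d)" unfolding Y_def[abs_def] by measurable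
  have [bdd_intros]: "bdd Y" unfolding Y_def[abs_def] by (intro bdd_intros)
  have low: "exp (real d * (k * r\<^sup>2) / 4) \<le> (\<integral>U. exp (real d * (r * Y U)) \<partial>\<mu>)" if r: "0 \<le> r" "r \<le> 1 / 16" for r
  proof -
    define y where "y i = (if i \<in> S then r else 0)" for i
    have "(\<Sum>i<d. (y i)\<^sup>2) = (\<Sum>i\<in>S. r\<^sup>2)"
      using S by (intro sum.mono_neutral_cong_right) (auto simp: y_def)
    also have "\<dots> = k * r\<^sup>2" by (simp add: k_def)
    finally have 1: "(\<Sum>i<d. (y i)\<^sup>2) = k * r\<^sup>2" .
    have "dtr y U = (\<Sum>i\<in>S. r * E i i U)" for U
      unfolding dtr_def using S by (intro sum.mono_neutral_cong_right) (auto simp: y_def)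
    then have 2: "dtr y U = r * Y U" for U by (simp add: Y_def sum_distrib_left)
    show ?thesis using exp_moment_lower[of y] r unfolding 1 2 by (auto simp: y_def)
  qed
  have "exp (real d * (k * \<xi> / 64 - k / 1024)) \<le> (\<integral>U. exp (real d * (\<xi> * Y U)) \<partial>\<mu>)"
  proof (cases "\<xi> \<le> 1 / 16")
    case True
    have "k * \<xi> / 64 - k / 1024 = k * (\<xi> - 1 / 16) / 64" by (simp add: algebra_simps)
    also have "\<dots> \<le> 0" using True k by (simp add: mult_nonneg_nonpos)
    finally have "real d * (k * \<xi> / 64 - k / 1024) \<le> real d * (k * \<xi>\<^sup>2) / 4"
      using k by (intro order.trans[OF mult_nonneg_nonpos]) auto
    then show ?thesis using low[OF \<xi> True] by (meson exp_le_cancel_iff order_trans)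
  next
    case False
    define p where "p = 16 * \<xi>"
    have p: "p \<ge> 1" "\<xi> = p * (1 / 16)" using False by (auto simp: p_def)
    define b where "b = real d * k / 1024"
    \<comment> \<open>Jensen for the power \<open>p\<close>, with the tangent at \<open>exp b\<close> made explicit by convexity of exp.\<close>
    have jensen: "exp (p * b) * (1 - p) + p * exp ((p - 1) * b) * exp w \<le> exp (p * w)" for w
    proof -
      have "exp ((1 - 1 / p) *\<^sub>R 0 + (1 / p) *\<^sub>R (p * (w - b))) \<le> (1 - 1 / p) * exp 0 + (1 / p) * exp (p * (w - b))"
        using p(1) by (intro convex_onD[OF exp_convex]) auto
      then have "exp (w - b) \<le> (1 - 1 / p) + (1 / p) * exp (p * (w - b))" using p(1) by simp
      then have "p * exp (w - b) \<le> p * ((1 - 1 / p) + (1 / p) * exp (p * (w - b)))"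
        using p(1) by (intro mult_left_mono) auto
      also have "\<dots> = p - 1 + exp (p * (w - b))" using p(1) by (simp add: algebra_simps)
      finally have "(1 - p) + p * exp (w - b) \<le> exp (p * (w - b))" by simp
      then have "exp (p * b) * ((1 - p) + p * exp (w - b)) \<le> exp (p * b) * exp (p * (w - b))"
        by (intro mult_left_mono) auto
      then show ?thesis by (simp add: algebra_simps flip: exp_add)
    qed
    have iw: "integrable \<mu> (\<lambda>U. exp (real d * (r * Y U)))" for r
      by (intro integrable_bdd bdd_intros; measurable)
    have "exp (p * b) = exp (p * b) * (1 - p) + p * exp ((p - 1) * b) * exp b"
      by (simp add: algebra_simps flip: exp_add)
    also have "\<dots> \<le> exp (p * b) * (1 - p) + p * exp ((p - 1) * b) * (\<integral>U. exp (real d * (1 / 16 * Y U)) \<partial>\<mu>)"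
      using low[of "1 / 16"] p(1) by (intro add_left_mono mult_left_mono) (auto simp: b_def power2_eq_square)
    also have "\<dots> = (\<integral>U. exp (p * b) * (1 - p) + p * exp ((p - 1) * b) * exp (real d * (1 / 16 * Y U)) \<partial>\<mu>)"
      using iw[of "1 / 16"] by (simp add: prob_space)
    also have "\<dots> \<le> (\<integral>U. exp (real d * (\<xi> * Y U)) \<partial>\<mu>)"
    proof (rule integral_mono)
      fix U
      show "exp (p * b) * (1 - p) + p * exp ((p - 1) * b) * exp (real d * (1 / 16 * Y U)) \<le> exp (real d * (\<xi> * Y U))"
      proof -
        have "p * (real d * (1 / 16 * Y U)) = real d * (\<xi> * Y U)" by (simp add: p(2))
        from jensen[of "real d * (1 / 16 * Y U)", unfolded this] show ?thesis .
      qed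
    qed (intro integrable_bdd bdd_intros; measurable)+
    finally have "exp (p * b) \<le> (\<integral>U. exp (real d * (\<xi> * Y U)) \<partial>\<mu>)" .
    moreover have "real d * (k * \<xi> / 64 - k / 1024) \<le> p * b"
      using k by (simp add: b_def p_def algebra_simps)
    ultimately show ?thesis by (meson exp_le_cancel_iff order_trans)
  qed
  also have "\<dots> \<le> (\<integral>U. exp (real d * (\<Sum>i\<in>S. x i * E i i U)) \<partial>\<mu>)"
  proof -
    have *: "(\<Sum>i\<in>S. real d * x i) / real (card S) = real d * \<xi>"
      by (simp add: \<xi>_def k_def sum_distrib_left[symmetric])
    show ?thesis
      using exp_moment_average[OF S False, of "\<lambda>i. real d * x i"] unfolding *
      by (simp add: Y_def sum_distrib_left mult.assoc)
  qed
  finally show ?thesis by (simp add: sx k_def)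
qed

end

section \<open>Sums of independent random variables\<close>

lemma prod_indicator_ball:
  "finite J \<Longrightarrow> (\<Prod>j\<in>J. indicator A (f j) :: real) = (if \<forall>j\<in>J. f j \<in> A then 1 else 0)"
  by (induction J rule: finite_induct) (auto simp: indicator_def)

section \<open>Kolmogorov's maximal inequality and almost sure convergence\<close>

context prob_space
begin

lemma integrable_boundedI:
  assumes "f \<in> borel_measurable M" "\<And>\<omega>. \<omega> \<in> space M \<Longrightarrow> \<bar>f \<omega>\<bar> \<le> (C::real)"
  shows "integrable M f"
  using assms by (intro integrable_const_bound[of _ C]) auto

text \<open>\<open>Z i\<close> is independent of the tuple of the first \<open>k\<close> variables,
  so the mean of the product factors. Letting \<open>g\<close> be any measurable function of that
  tuple covers first passage indicators.\<close>

lemma expectation_past_mult: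
  fixes Z :: "nat \<Rightarrow> 'a \<Rightarrow> real"
  assumes ind: "indep_vars (\<lambda>_. borel) Z UNIV" and mean: "expectation (Z i) = 0" and int: "integrable M (Z i)"
    and g: "g \<in> borel_measurable (PiM {..<k} (\<lambda>_. borel))" and "k \<le> i"
    and gint: "integrable M (\<lambda>\<omega>. g (\<lambda>j\<in>{..<k}. Z j \<omega>))"
  shows "expectation (\<lambda>\<omega>. g (\<lambda>j\<in>{..<k}. Z j \<omega>) * Z i \<omega>) = (0::real)"
proof -
  have "indep_var (PiM {..<k} (\<lambda>_. borel)) (\<lambda>\<omega>. \<lambda>j\<in>{..<k}. Z j \<omega>) (PiM {i} (\<lambda>_. borel)) (\<lambda>\<omega>. \<lambda>j\<in>{i}. Z j \<omega>)"
    by (rule indep_var_restrict[OF ind]) (use \<open>k \<le> i\<close> in auto)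
  then have "indep_var borel (g \<circ> (\<lambda>\<omega>. \<lambda>j\<in>{..<k}. Z j \<omega>)) borel ((\<lambda>f. f i) \<circ> (\<lambda>\<omega>. \<lambda>j\<in>{i}. Z j \<omega>))"
    by (rule indep_var_compose) (use g in auto)
  then have "indep_var borel (\<lambda>\<omega>. g (\<lambda>j\<in>{..<k}. Z j \<omega>)) borel (Z i)" by (simp add: comp_def)
  from indep_var_lebesgue_integral[OF this gint int] show ?thesis by (simp add: mean)
qed

text \<open>Decomposition by first passage. If \<open>I k\<close> indicates that \<open>k\<close> is
  the first index with |S k| >= a, then the mean of (S n)^2 I k is at least that of (S k)^2 I k,
  because S n - S k is orthogonal to S k I k; and the latter is at least a^2 times the mean of
  \<open>I k\<close>. Summation over \<open>k\<close> gives the claim.\<close>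

theorem Kolmogorov_inequality:
  fixes Z :: "nat \<Rightarrow> 'a \<Rightarrow> real"
  assumes ind: "indep_vars (\<lambda>_. borel) Z UNIV"
    and bnd: "\<And>n \<omega>. \<omega> \<in> space M \<Longrightarrow> \<bar>Z n \<omega>\<bar> \<le> B n"
    and mean: "\<And>n. expectation (Z n) = 0" and a: "a > 0"
  shows "prob {\<omega> \<in> space M. \<exists>k\<in>{m..n}. a \<le> \<bar>\<Sum>i=m..<k. Z i \<omega>\<bar>} \<le> (\<Sum>i=m..<n. expectation (\<lambda>\<omega>. (Z i \<omega>)\<^sup>2)) / a\<^sup>2"
proof -
  have [measurable]: "Z i \<in> borel_measurable M" for i using ind by (auto simp: indep_vars_def)
  have intZ: "integrable M (Z i)" for i using bnd by (intro integrable_boundedI) auto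
  define S where "S k \<omega> = (\<Sum>i=m..<k. Z i \<omega>)" for k \<omega>
  \<comment> \<open>First passage at \<open>k\<close>, written as a product of indicators: the same
    formula in the coordinates of the past variables supplies the function \<open>g\<close>
    below.\<close>
  define I where "I k \<omega> = indicator {a..} \<bar>S k \<omega>\<bar> * (\<Prod>j=m..<k. indicator {..<a} \<bar>S j \<omega>\<bar> :: real)" for k \<omega>
  have [measurable]: "S k \<in> borel_measurable M" for k unfolding S_def[abs_def] by measurable
  have [measurable]: "I k \<in> borel_measurable M" for k unfolding I_def[abs_def] by measurable
  define T where "T k = (\<Sum>i=m..<k. B i)" for k
  have ST: "\<bar>S k \<omega>\<bar> \<le> T k" if "\<omega> \<in> space M" for k \<omega>
    unfolding S_def T_def using bnd that by (intro order.trans[OF sum_abs] sum_mono)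
  have I: "I k \<omega> = (if a \<le> \<bar>S k \<omega>\<bar> \<and> (\<forall>j\<in>{m..<k}. \<bar>S j \<omega>\<bar> < a) then 1 else 0)" for k \<omega>
    unfolding I_def by (simp add: prod_indicator_ball)
  have cross: "expectation (\<lambda>\<omega>. S k \<omega> * I k \<omega> * Z i \<omega>) = 0" "expectation (\<lambda>\<omega>. S k \<omega> * Z i \<omega>) = 0"
    if "k \<le> i" for k i
  proof -
    define s where "s j x = (\<Sum>i=m..<j. x i :: real)" for j x
    define g where "g x = s k x * (indicator {a..} \<bar>s k x\<bar> * (\<Prod>j=m..<k. indicator {..<a} \<bar>s j x\<bar>))" for x
    have sm [measurable]: "s j \<in> borel_measurable (PiM {..<k} (\<lambda>_. borel))" if "j \<le> k" for j
      unfolding s_def[abs_def] using that by (intro borel_measurable_sum measurable_component_singleton) auto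
    have pm: "(\<lambda>x. \<Prod>j=m..<k. indicator {..<a} \<bar>s j x\<bar> :: real) \<in> borel_measurable (PiM {..<k} (\<lambda>_. borel))"
    proof (rule borel_measurable_prod)
      fix j assume "j \<in> {m..<k}"
      then have [measurable]: "s j \<in> borel_measurable (PiM {..<k} (\<lambda>_. borel))" by (intro sm) auto
      show "(\<lambda>x. indicator {..<a} \<bar>s j x\<bar> :: real) \<in> borel_measurable (PiM {..<k} (\<lambda>_. borel))" by measurable
    qed
    note [measurable] = pm sm[OF order_refl]
    have gm: "g \<in> borel_measurable (PiM {..<k} (\<lambda>_. borel))" unfolding g_def[abs_def] by measurable
    have sS: "s j (\<lambda>j\<in>{..<k}. Z j \<omega>) = S j \<omega>" if "j \<le> k" for j \<omega>
      unfolding s_def S_def using that by (intro sum.cong) auto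
    have gI: "g (\<lambda>j\<in>{..<k}. Z j \<omega>) = S k \<omega> * I k \<omega>" for \<omega>
      unfolding g_def I_def by (simp add: sS cong: prod.cong_simp)
    have i1: "integrable M (\<lambda>\<omega>. S k \<omega> * I k \<omega>)"
      by (rule integrable_boundedI[of _ "T k"]) (use ST in \<open>auto simp: I abs_mult intro: order.trans[OF abs_ge_zero]\<close>)
    have i2: "integrable M (S k)" by (rule integrable_boundedI[of _ "T k"]) (use ST in auto)
    show "expectation (\<lambda>\<omega>. S k \<omega> * I k \<omega> * Z i \<omega>) = 0"
      using expectation_past_mult[OF ind mean intZ gm that] i1 by (simp add: gI)
    show "expectation (\<lambda>\<omega>. S k \<omega> * Z i \<omega>) = 0"
      using expectation_past_mult[OF ind mean intZ sm[OF order_refl] that] i2 by (simp add: sS)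
  qed
  have intpoly: "integrable M (\<lambda>\<omega>. S k \<omega> * I l \<omega> * Z i \<omega>)" "integrable M (\<lambda>\<omega>. S k \<omega> * Z i \<omega>)"
    "integrable M (\<lambda>\<omega>. (S k \<omega>)\<^sup>2 * I l \<omega>)" "integrable M (\<lambda>\<omega>. (S k \<omega>)\<^sup>2)" "integrable M (\<lambda>\<omega>. (Z i \<omega>)\<^sup>2)"
    "integrable M (I l)" for k l i
  proof -
    have *: "\<bar>I l \<omega>\<bar> \<le> 1" for \<omega> by (simp add: I)
    have 0: "0 \<le> T k" "0 \<le> B i" using not_empty ST[of _ k] bnd[of _ i] by (fastforce intro: order.trans[OF abs_ge_zero])+
    show "integrable M (\<lambda>\<omega>. S k \<omega> * I l \<omega> * Z i \<omega>)"
      by (rule integrable_boundedI[of _ "T k * 1 * B i"], measurable)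
        (unfold abs_mult, intro mult_mono ST bnd *, use 0 in auto)
    show "integrable M (\<lambda>\<omega>. S k \<omega> * Z i \<omega>)"
      by (rule integrable_boundedI[of _ "T k * B i"], measurable)
        (unfold abs_mult, intro mult_mono ST bnd *, use 0 in auto)
    show "integrable M (\<lambda>\<omega>. (S k \<omega>)\<^sup>2 * I l \<omega>)"
      by (rule integrable_boundedI[of _ "(T k)\<^sup>2 * 1"], measurable)
        (unfold abs_mult power_abs, intro mult_mono power_mono ST *, use 0 in auto)
    show "integrable M (\<lambda>\<omega>. (S k \<omega>)\<^sup>2)"
      by (rule integrable_boundedI[of _ "(T k)\<^sup>2"], measurable)
        (unfold power_abs, intro power_mono ST, use 0 in auto)
    show "integrable M (\<lambda>\<omega>. (Z i \<omega>)\<^sup>2)"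
      by (rule integrable_boundedI[of _ "(B i)\<^sup>2"], measurable)
        (unfold power_abs, intro power_mono bnd, use 0 in auto)
    show "integrable M (I l)" by (rule integrable_boundedI[of _ 1]) (use * in auto)
  qed
  have var: "expectation (\<lambda>\<omega>. (S k \<omega>)\<^sup>2) = (\<Sum>i=m..<k. expectation (\<lambda>\<omega>. (Z i \<omega>)\<^sup>2))" for k
  proof (induction k)
    case (Suc k)
    show ?case
    proof (cases "m \<le> k")
      case True
      have "(S (Suc k) \<omega>)\<^sup>2 = (S k \<omega>)\<^sup>2 + 2 * (S k \<omega> * Z k \<omega>) + (Z k \<omega>)\<^sup>2" for \<omega>
        using True by (simp add: S_def power2_sum)
      then have "expectation (\<lambda>\<omega>. (S (Suc k) \<omega>)\<^sup>2)
          = expectation (\<lambda>\<omega>. (S k \<omega>)\<^sup>2) + 2 * expectation (\<lambda>\<omega>. S k \<omega> * Z k \<omega>) + expectation (\<lambda>\<omega>. (Z k \<omega>)\<^sup>2)"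
        using intpoly by simp
      then show ?thesis using Suc True cross(2)[of k k] by simp
    qed (simp add: S_def)
  qed (simp add: S_def)
  have sumI: "(\<Sum>k=m..n. I k \<omega>) \<le> 1" for \<omega>
  proof (cases "\<exists>k\<in>{m..n}. I k \<omega> \<noteq> 0")
    case True
    then obtain k where k: "k \<in> {m..n}" "I k \<omega> \<noteq> 0" by blast
    have "I l \<omega> = 0" if l: "l \<in> {m..n} - {k}" for l
    proof (rule ccontr)
      assume "I l \<omega> \<noteq> 0"
      with k(2) have *: "a \<le> \<bar>S l \<omega>\<bar>" "\<forall>j\<in>{m..<l}. \<bar>S j \<omega>\<bar> < a" "a \<le> \<bar>S k \<omega>\<bar>" "\<forall>j\<in>{m..<k}. \<bar>S j \<omega>\<bar> < a"
        by (auto simp: I split: if_splits)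
      show False
      proof (cases "l < k")
        case True
        then have "l \<in> {m..<k}" using l by auto
        then show False using * by force
      next
        case False
        then have "k \<in> {m..<l}" using l k(1) by auto
        then show False using * by force
      qed
    qed
    then have "(\<Sum>k=m..n. I k \<omega>) = (\<Sum>l\<in>{k}. I l \<omega>)"
      using k(1) by (intro sum.mono_neutral_right) auto
    then show ?thesis by (simp add: I)
  next
    case False
    then have "(\<Sum>k=m..n. I k \<omega>) = 0" by (intro sum.neutral) auto
    then show ?thesis by simp
  qed
  define F where "F = {\<omega> \<in> space M. \<exists>k\<in>{m..n}. a \<le> \<bar>S k \<omega>\<bar>}"
  have F [measurable]: "F \<in> sets M" unfolding F_def by measurable
  have IF: "indicator F \<omega> \<le> (\<Sum>k=m..n. I k \<omega>)" if "\<omega> \<in> space M" for \<omega>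
  proof (cases "\<omega> \<in> F")
    case True
    define k where "k = (LEAST k. m \<le> k \<and> a \<le> \<bar>S k \<omega>\<bar>)"
    obtain k0 where k0: "m \<le> k0" "k0 \<le> n" "a \<le> \<bar>S k0 \<omega>\<bar>" using True by (auto simp: F_def)
    have k: "m \<le> k \<and> a \<le> \<bar>S k \<omega>\<bar>" unfolding k_def by (rule LeastI[of _ k0]) (use k0 in auto)
    have "k \<le> k0" unfolding k_def by (rule Least_le) (use k0 in auto)
    have "\<bar>S j \<omega>\<bar> < a" if "j \<in> {m..<k}" for j
      using not_less_Least[of j "\<lambda>k. m \<le> k \<and> a \<le> \<bar>S k \<omega>\<bar>"] that unfolding k_def[symmetric] by auto
    then have "I k \<omega> = 1" using k by (simp add: I)
    moreover have "I k \<omega> \<le> (\<Sum>k=m..n. I k \<omega>)"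
      using k \<open>k \<le> k0\<close> k0(2) by (intro member_le_sum) (auto simp: I)
    ultimately show ?thesis using True by simp
  qed (simp add: sum_nonneg I)
  have step: "a\<^sup>2 * expectation (I k) \<le> expectation (\<lambda>\<omega>. (S n \<omega>)\<^sup>2 * I k \<omega>)" if k: "k \<in> {m..n}" for k
  proof -
    have sp: "S n \<omega> = S k \<omega> + (\<Sum>i=k..<n. Z i \<omega>)" for \<omega>
      unfolding S_def using k by (simp add: sum.atLeastLessThan_concat)
    have "a\<^sup>2 * expectation (I k) = expectation (\<lambda>\<omega>. a\<^sup>2 * I k \<omega>)" by simp
    also have "\<dots> \<le> expectation (\<lambda>\<omega>. (S n \<omega>)\<^sup>2 * I k \<omega> - 2 * (\<Sum>i=k..<n. S k \<omega> * I k \<omega> * Z i \<omega>))"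
    proof (rule integral_mono)
      fix \<omega>
      define y where "y = (\<Sum>i=k..<n. Z i \<omega>)"
      have "(S n \<omega>)\<^sup>2 * I k \<omega> - 2 * (\<Sum>i=k..<n. S k \<omega> * I k \<omega> * Z i \<omega>) = ((S k \<omega>)\<^sup>2 + y\<^sup>2) * I k \<omega>"
        unfolding sp sum_distrib_left[symmetric] y_def[symmetric] by (simp add: power2_sum algebra_simps)
      moreover have "a\<^sup>2 * I k \<omega> \<le> ((S k \<omega>)\<^sup>2 + y\<^sup>2) * I k \<omega>"
      proof (cases "I k \<omega> = 0")
        case False
        then have "a \<le> \<bar>S k \<omega>\<bar>" "I k \<omega> = 1" by (auto simp: I split: if_splits)
        then have "a\<^sup>2 \<le> (S k \<omega>)\<^sup>2" using a power_mono[of a "\<bar>S k \<omega>\<bar>" 2] by simp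
        then show ?thesis using \<open>I k \<omega> = 1\<close> by (simp add: add_increasing2)
      qed simp
      ultimately show "a\<^sup>2 * I k \<omega> \<le> (S n \<omega>)\<^sup>2 * I k \<omega> - 2 * (\<Sum>i=k..<n. S k \<omega> * I k \<omega> * Z i \<omega>)" by simp
    qed (use intpoly in auto)
    also have "\<dots> = expectation (\<lambda>\<omega>. (S n \<omega>)\<^sup>2 * I k \<omega>) - 2 * (\<Sum>i=k..<n. expectation (\<lambda>\<omega>. S k \<omega> * I k \<omega> * Z i \<omega>))"
      using intpoly by simp
    also have "(\<Sum>i=k..<n. expectation (\<lambda>\<omega>. S k \<omega> * I k \<omega> * Z i \<omega>)) = 0"
      using cross(1) by (intro sum.neutral) auto
    finally show ?thesis by simp
  qed
  have "a\<^sup>2 * prob F = a\<^sup>2 * expectation (indicator F)" by simp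
  also have "\<dots> \<le> a\<^sup>2 * expectation (\<lambda>\<omega>. \<Sum>k=m..n. I k \<omega>)"
  proof (intro mult_left_mono integral_mono)
    show "integrable M (indicator F :: 'a \<Rightarrow> real)"
      using F by (intro integrable_boundedI[of _ 1]) (auto simp: indicator_def)
  qed (use IF intpoly in auto)
  also have "\<dots> = (\<Sum>k=m..n. a\<^sup>2 * expectation (I k))" using intpoly by (simp add: sum_distrib_left)
  also have "\<dots> \<le> (\<Sum>k=m..n. expectation (\<lambda>\<omega>. (S n \<omega>)\<^sup>2 * I k \<omega>))" using step by (intro sum_mono)
  also have "\<dots> = expectation (\<lambda>\<omega>. (S n \<omega>)\<^sup>2 * (\<Sum>k=m..n. I k \<omega>))"
    using intpoly by (simp add: sum_distrib_left)
  also have "\<dots> \<le> expectation (\<lambda>\<omega>. (S n \<omega>)\<^sup>2)"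
  proof (rule integral_mono)
    show "(S n \<omega>)\<^sup>2 * (\<Sum>k=m..n. I k \<omega>) \<le> (S n \<omega>)\<^sup>2" for \<omega>
      using mult_left_mono[OF sumI, of "(S n \<omega>)\<^sup>2" \<omega>] by simp
  qed (use intpoly in \<open>auto simp: sum_distrib_left\<close>)
  finally have "a\<^sup>2 * prob F \<le> (\<Sum>i=m..<n. expectation (\<lambda>\<omega>. (Z i \<omega>)\<^sup>2))" unfolding var .
  then show ?thesis using a unfolding F_def S_def by (simp add: field_simps)
qed

text \<open>\<open>bad a m\<close> says that some sum of consecutive terms starting at
  \<open>m\<close> reaches \<open>a\<close> in modulus; the maximal inequality bounds its
  probability by the tail of \<open>v\<close> from \<open>m\<close> on, divided by a^2. Hence almost
  surely, for every \<open>a\<close> of the form 1/(r+1), some \<open>m\<close> is not bad, and this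
  is the Cauchy criterion.\<close>

theorem AE_summable_indep:
  fixes Z :: "nat \<Rightarrow> 'a \<Rightarrow> real"
  assumes ind: "indep_vars (\<lambda>_. borel) Z UNIV"
    and bnd: "\<And>n \<omega>. \<omega> \<in> space M \<Longrightarrow> \<bar>Z n \<omega>\<bar> \<le> B n"
    and mean: "\<And>n. expectation (Z n) = 0"
    and v: "\<And>n. expectation (\<lambda>\<omega>. (Z n \<omega>)\<^sup>2) \<le> v n" "summable v"
  shows "AE \<omega> in M. summable (\<lambda>n. Z n \<omega>)"
proof -
  have [measurable]: "Z i \<in> borel_measurable M" for i using ind by (auto simp: indep_vars_def)
  define S where "S m k \<omega> = (\<Sum>i=m..<k. Z i \<omega>)" for m k \<omega>
  have [measurable]: "S m k \<in> borel_measurable M" for m k unfolding S_def[abs_def] by measurable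
  have v0: "v n \<ge> 0" for n using v(1)[of n] by (rule order.trans[rotated]) simp
  define bad where "bad a m = {\<omega> \<in> space M. \<exists>k\<ge>m. a \<le> \<bar>S m k \<omega>\<bar>}" for a m
  have [measurable]: "bad a m \<in> sets M" for a m unfolding bad_def by measurable
  have pb: "prob (bad a m) \<le> (\<Sum>i. v (i + m)) / a\<^sup>2" if a: "a > 0" for a m
  proof -
    define C where "C n = {\<omega> \<in> space M. \<exists>k\<in>{m..n}. a \<le> \<bar>S m k \<omega>\<bar>}" for n
    have "prob (C n) \<le> (\<Sum>i. v (i + m)) / a\<^sup>2" for n
    proof -
      have "prob (C n) \<le> (\<Sum>i=m..<n. expectation (\<lambda>\<omega>. (Z i \<omega>)\<^sup>2)) / a\<^sup>2"
        unfolding C_def S_def by (rule Kolmogorov_inequality[OF ind bnd mean a])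
      also have "(\<Sum>i=m..<n. expectation (\<lambda>\<omega>. (Z i \<omega>)\<^sup>2)) \<le> (\<Sum>i=m..<n. v i)" by (intro sum_mono v(1))
      also have "(\<Sum>i=m..<n. v i) = (\<Sum>i<n-m. v (i + m))"
      proof (cases "m \<le> n")
        case True
        then show ?thesis
          using sum.shift_bounds_nat_ivl[of v 0 m "n - m"] by (simp add: lessThan_atLeast0)
      qed simp
      also have "\<dots> \<le> (\<Sum>i. v (i + m))"
        using v(2) v0 by (intro sum_le_suminf) (auto simp: summable_iff_shift)
      finally show ?thesis using a by (simp add: divide_right_mono)
    qed
    moreover have "(\<lambda>n. prob (C n)) \<longlonglongrightarrow> prob (\<Union>n. C n)"
    proof (rule finite_Lim_measure_incseq)
      show "range C \<subseteq> sets M" unfolding C_def by auto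
      show "incseq C" unfolding C_def incseq_def by force
    qed
    moreover have "(\<Union>n. C n) = bad a m" unfolding C_def bad_def by force
    ultimately show ?thesis by (intro LIMSEQ_le_const2) auto
  qed
  have tail: "(\<lambda>m. \<Sum>i. v (i + m)) \<longlonglongrightarrow> 0" using suminf_exist_split2[OF v(2)] by (simp add: add.commute)
  have "AE \<omega> in M. \<exists>m. \<omega> \<notin> bad a m" if a: "a > 0" for a
  proof -
    define N where "N = (\<Inter>m. bad a m)"
    have N [measurable]: "N \<in> sets M" unfolding N_def by measurable
    have "prob N \<le> (\<Sum>i. v (i + m)) / a\<^sup>2" for m
    proof -
      have "prob N \<le> prob (bad a m)" by (intro finite_measure_mono) (auto simp: N_def)
      with pb[OF a, of m] show ?thesis by linarith
    qed
    moreover have "(\<lambda>m. (\<Sum>i. v (i + m)) / a\<^sup>2) \<longlonglongrightarrow> 0 / a\<^sup>2" by (intro tendsto_divide tail tendsto_const) (use a in auto)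
    ultimately have "prob N \<le> 0" by (intro LIMSEQ_le_const[where X = "\<lambda>m. (\<Sum>i. v (i + m)) / a\<^sup>2"]) auto
    then have "prob N = 0" by (simp add: measure_le_0_iff)
    then have "N \<in> null_sets M" by (simp add: null_sets_def emeasure_eq_measure)
    then show ?thesis by (rule AE_I') (auto simp: N_def)
  qed
  then have "AE \<omega> in M. \<forall>r. \<exists>m. \<omega> \<notin> bad (1 / real (Suc r)) m"
    unfolding AE_all_countable by simp
  then show ?thesis
  proof (rule AE_mp, intro AE_I2 impI)
    fix \<omega> assume \<omega>: "\<omega> \<in> space M" "\<forall>r. \<exists>m. \<omega> \<notin> bad (1 / real (Suc r)) m"
    show "summable (\<lambda>n. Z n \<omega>)"
      unfolding summable_Cauchy
    proof (intro allI impI)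
      fix e :: real assume "e > 0"
      then obtain r where r: "1 / real (Suc r) < e / 2" using nat_approx_posE[of "e / 2"] by auto
      obtain N where "\<omega> \<notin> bad (1 / real (Suc r)) N" using \<omega>(2) by blast
      then have "\<forall>k\<ge>N. \<not> 1 / real (Suc r) \<le> \<bar>S N k \<omega>\<bar>" using \<omega>(1) unfolding bad_def by blast
      then have N: "\<bar>S N k \<omega>\<bar> < e / 2" if "k \<ge> N" for k
        using that r by (meson less_trans not_le)
      have "norm (\<Sum>i=m..<n. Z i \<omega>) < e" if "m \<ge> N" for m n
      proof (cases "m \<le> n")
        case True
        have "(\<Sum>i=N..<m. Z i \<omega>) + (\<Sum>i=m..<n. Z i \<omega>) = (\<Sum>i=N..<n. Z i \<omega>)"
          using that True by (intro sum.atLeastLessThan_concat) auto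
        then have "(\<Sum>i=m..<n. Z i \<omega>) = S N n \<omega> - S N m \<omega>" by (simp add: S_def)
        then show ?thesis using N[of n] N[of m] that True by (simp add: abs_if split: if_splits)
      qed (use \<open>e > 0\<close> in simp)
      then show "\<exists>N. \<forall>m\<ge>N. \<forall>n. norm (\<Sum>i=m..<n. Z i \<omega>) < e" by blast
    qed
  qed
qed

end

section \<open>Comparison of laws, tails from exponential moments, and passage to the series\<close>

context prob_space
begin

text \<open>Independence and equal marginals give equal joint laws on the product space, and the
  probability of the event is determined by the joint law.\<close>

lemma prob_sum_eq_of_equal_laws:
  fixes Z Z' :: "nat \<Rightarrow> 'a \<Rightarrow> real"
  assumes ind: "indep_vars (\<lambda>_. borel) Z UNIV" "indep_vars (\<lambda>_. borel) Z' UNIV"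
    and law: "\<And>n. distr M borel (Z n) = distr M borel (Z' n)"
  shows "prob {\<omega> \<in> space M. (\<Sum>n<N. Z n \<omega>) > u} = prob {\<omega> \<in> space M. (\<Sum>n<N. Z' n \<omega>) > u}"
proof -
  have [measurable]: "Z i \<in> borel_measurable M" "Z' i \<in> borel_measurable M" for i
    using ind by (auto simp: indep_vars_def)
  let ?P = "PiM UNIV (\<lambda>_ :: nat. borel :: real measure)"
  have "distr M ?P (\<lambda>\<omega>. \<lambda>i\<in>UNIV. Z i \<omega>) = distr M ?P (\<lambda>\<omega>. \<lambda>i\<in>UNIV. Z' i \<omega>)"
    using ind law indep_vars_iff_distr_eq_PiM[where I = "UNIV :: nat set" and M' = "\<lambda>_. borel" and X = Z]
      indep_vars_iff_distr_eq_PiM[where I = "UNIV :: nat set" and M' = "\<lambda>_. borel" and X = Z'] by simp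
  then have eq: "distr M ?P (\<lambda>\<omega> i. Z i \<omega>) = distr M ?P (\<lambda>\<omega> i. Z' i \<omega>)" by (simp add: restrict_def)
  define A where "A = {x \<in> space ?P. (\<Sum>n<N. x n) > u}"
  have A: "A \<in> sets ?P" unfolding A_def by measurable
  have "measure (distr M ?P (\<lambda>\<omega> i. Z i \<omega>)) A = prob {\<omega> \<in> space M. (\<Sum>n<N. Z n \<omega>) > u}"
    using A by (subst measure_distr) (auto simp: A_def space_PiM intro!: arg_cong[of _ _ prob] measurable_PiM_single')
  moreover have "measure (distr M ?P (\<lambda>\<omega> i. Z' i \<omega>)) A = prob {\<omega> \<in> space M. (\<Sum>n<N. Z' n \<omega>) > u}"
    using A by (subst measure_distr) (auto simp: A_def space_PiM intro!: arg_cong[of _ _ prob] measurable_PiM_single')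
  ultimately show ?thesis using eq by simp
qed

text \<open>If the sign of \<open>X\<close> can be flipped without changing the law of \<open>X + Y\<close>, then one of
  \<open>Y + X\<close>, \<open>Y - X\<close> exceeds the level whenever \<open>Y\<close> does.\<close>

lemma prob_sum_ge_half_of_sign_flip:
  fixes X Y :: "nat \<Rightarrow> 'a \<Rightarrow> real"
  assumes ind: "indep_vars (\<lambda>_. borel) (\<lambda>n \<omega>. X n \<omega> + Y n \<omega>) UNIV" "indep_vars (\<lambda>_. borel) (\<lambda>n \<omega>. Y n \<omega> - X n \<omega>) UNIV"
    and law: "\<And>n. distr M borel (\<lambda>\<omega>. X n \<omega> + Y n \<omega>) = distr M borel (\<lambda>\<omega>. Y n \<omega> - X n \<omega>)"
  shows "prob {\<omega> \<in> space M. (\<Sum>n<N. Y n \<omega>) > u} \<le> 2 * prob {\<omega> \<in> space M. (\<Sum>n<N. X n \<omega> + Y n \<omega>) > u}"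
proof -
  have [measurable]: "(\<lambda>\<omega>. X i \<omega> + Y i \<omega>) \<in> borel_measurable M" "(\<lambda>\<omega>. Y i \<omega> - X i \<omega>) \<in> borel_measurable M" for i
    using ind by (auto simp: indep_vars_def)
  have "prob {\<omega> \<in> space M. (\<Sum>n<N. Y n \<omega>) > u}
      \<le> prob ({\<omega> \<in> space M. (\<Sum>n<N. X n \<omega> + Y n \<omega>) > u} \<union> {\<omega> \<in> space M. (\<Sum>n<N. Y n \<omega> - X n \<omega>) > u})"
  proof (rule finite_measure_mono)
    show "{\<omega> \<in> space M. (\<Sum>n<N. Y n \<omega>) > u}
      \<subseteq> {\<omega> \<in> space M. (\<Sum>n<N. X n \<omega> + Y n \<omega>) > u} \<union> {\<omega> \<in> space M. (\<Sum>n<N. Y n \<omega> - X n \<omega>) > u}"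
      by (auto simp: sum.distrib sum_subtractf)
  qed measurable
  also have "\<dots> \<le> prob {\<omega> \<in> space M. (\<Sum>n<N. X n \<omega> + Y n \<omega>) > u} + prob {\<omega> \<in> space M. (\<Sum>n<N. Y n \<omega> - X n \<omega>) > u}"
    by (rule measure_Un_le) measurable
  also have "prob {\<omega> \<in> space M. (\<Sum>n<N. Y n \<omega> - X n \<omega>) > u} = prob {\<omega> \<in> space M. (\<Sum>n<N. X n \<omega> + Y n \<omega>) > u}"
    by (rule prob_sum_eq_of_equal_laws[OF ind law, symmetric])
  finally show ?thesis by simp
qed

text \<open>Cauchy-Schwarz is replaced by a pointwise bound: exp X is at most exp a / 2 off the
  event and at most exp (2 X) / (2 s) + s/2 on it. The choice s = 2 exp (b - a) makes the middle
  term contribute at most exp a / 4, so a quarter of exp a is left for the probability.\<close>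

lemma exponential_Paley_Zygmund:
  assumes [measurable]: "X \<in> borel_measurable M"
    and int: "integrable M (\<lambda>\<omega>. exp (X \<omega>))" "integrable M (\<lambda>\<omega>. exp (2 * X \<omega>))"
    and lo: "exp a \<le> expectation (\<lambda>\<omega>. exp (X \<omega>))" and up: "expectation (\<lambda>\<omega>. exp (2 * X \<omega>)) \<le> exp b"
  shows "exp (2 * a - b) / 4 \<le> prob {\<omega> \<in> space M. X \<omega> \<ge> a - ln (2::real)}"
proof -
  define B where "B = {\<omega> \<in> space M. X \<omega> \<ge> a - ln 2}"
  have [measurable]: "B \<in> sets M" unfolding B_def by measurable
  define s where "s = 2 * exp (b - a)"
  have s: "s > 0" by (simp add: s_def)
  have iB: "integrable M (indicator B :: 'a \<Rightarrow> real)"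
    by (intro integrable_boundedI[of _ 1]) (auto simp: indicator_def)
  have "exp a \<le> expectation (\<lambda>\<omega>. exp (X \<omega>))" by (rule lo)
  also have "\<dots> \<le> expectation (\<lambda>\<omega>. exp a / 2 + (exp (2 * X \<omega>) / (2 * s) + s / 2 * indicator B \<omega>))"
  proof (rule integral_mono)
    fix \<omega> assume \<omega>: "\<omega> \<in> space M"
    show "exp (X \<omega>) \<le> exp a / 2 + (exp (2 * X \<omega>) / (2 * s) + s / 2 * indicator B \<omega>)"
    proof (cases "\<omega> \<in> B")
      case True
      have "0 \<le> (exp (X \<omega>) - s)\<^sup>2" by simp
      then have "2 * s * exp (X \<omega>) \<le> exp (2 * X \<omega>) + s\<^sup>2"
        by (simp add: power2_diff algebra_simps flip: exp_double)
      then have "exp (X \<omega>) \<le> (exp (2 * X \<omega>) + s\<^sup>2) / (2 * s)" using s by (simp add: field_simps)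
      also have "\<dots> = exp (2 * X \<omega>) / (2 * s) + s / 2" using s by (simp add: field_simps power2_eq_square)
      finally show ?thesis using True by (simp add: add_increasing)
    next
      case False
      then have "X \<omega> \<le> a - ln 2" using \<omega> by (simp add: B_def)
      then have "exp (X \<omega>) \<le> exp (a - ln 2)" by simp
      also have "\<dots> = exp a / 2" by (simp add: exp_diff)
      finally show ?thesis using s False by (simp add: add_increasing2)
    qed
  qed (use int iB in auto)
  also have "\<dots> = exp a / 2 + (expectation (\<lambda>\<omega>. exp (2 * X \<omega>)) / (2 * s) + s / 2 * prob B)"
    using int iB by (simp add: prob_space)
  also have "\<dots> \<le> exp a / 2 + (exp b / (2 * s) + s / 2 * prob B)"
    using up s by (intro add_left_mono add_right_mono divide_right_mono) auto
  also have "exp b / (2 * s) = exp a / 4" by (simp add: s_def exp_diff)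
  finally have "exp a / 4 \<le> s / 2 * prob B" by simp
  then have "exp a / 4 \<le> exp (b - a) * prob B" by (simp add: s_def)
  then have "exp (a - b) * (exp a / 4) \<le> exp (a - b) * (exp (b - a) * prob B)" by (intro mult_left_mono) auto
  also have "\<dots> = prob B" by (simp add: mult.assoc[symmetric] flip: exp_add)
  finally show ?thesis by (simp add: B_def algebra_simps flip: exp_add)
qed

text \<open>Outside the event exp X is at most half of exp y, and on it at most exp H; so exp H
  times the probability has to supply the other half.\<close>

lemma exp_moment_bounded_lower_tail:
  assumes [measurable]: "X \<in> borel_measurable M" and up: "\<And>\<omega>. \<omega> \<in> space M \<Longrightarrow> X \<omega> \<le> H"
    and lo: "exp y \<le> expectation (\<lambda>\<omega>. exp (X \<omega>))"
  shows "exp (y - H) / 2 \<le> prob {\<omega> \<in> space M. X \<omega> \<ge> y - ln (2::real)}"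
proof -
  define B where "B = {\<omega> \<in> space M. X \<omega> \<ge> y - ln 2}"
  have [measurable]: "B \<in> sets M" unfolding B_def by measurable
  have iB: "integrable M (indicator B :: 'a \<Rightarrow> real)"
    by (intro integrable_boundedI[of _ 1]) (auto simp: indicator_def)
  have int: "integrable M (\<lambda>\<omega>. exp (X \<omega>))" by (intro integrable_boundedI[of _ "exp H"]) (use up in auto)
  have "exp y \<le> expectation (\<lambda>\<omega>. exp y / 2 + exp H * indicator B \<omega>)"
  proof (rule order.trans[OF lo integral_mono])
    fix \<omega> assume \<omega>: "\<omega> \<in> space M"
    show "exp (X \<omega>) \<le> exp y / 2 + exp H * indicator B \<omega>"
    proof (cases "\<omega> \<in> B")
      case False
      then have "exp (X \<omega>) \<le> exp (y - ln 2)" using \<omega> by (simp add: B_def)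
      also have "\<dots> = exp y / 2" by (simp add: exp_diff)
      finally show ?thesis using False by simp
    qed (use up[OF \<omega>] in \<open>simp add: add_increasing\<close>)
  qed (use int iB in auto)
  also have "\<dots> = exp y / 2 + exp H * prob B" using iB by (simp add: prob_space)
  finally have "exp y / 2 \<le> exp H * prob B" by simp
  then have "exp (- H) * (exp y / 2) \<le> exp (- H) * (exp H * prob B)" by (intro mult_left_mono) auto
  also have "\<dots> = prob B" by (simp add: mult.assoc[symmetric] flip: exp_add)
  finally show ?thesis by (simp add: B_def exp_diff exp_minus field_simps)
qed

lemma exp_moment_upper_tail:
  assumes [measurable]: "X \<in> borel_measurable M" and int: "integrable M (\<lambda>\<omega>. exp (X \<omega>))"
    and up: "expectation (\<lambda>\<omega>. exp (X \<omega>)) \<le> exp (b::real)"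
  shows "prob {\<omega> \<in> space M. X \<omega> > y} \<le> exp (b - y)"
proof -
  have "exp y * prob {\<omega> \<in> space M. X \<omega> > y} = expectation (\<lambda>\<omega>. exp y * indicator {\<omega> \<in> space M. X \<omega> > y} \<omega>)"
    by simp
  also have "\<dots> \<le> expectation (\<lambda>\<omega>. exp (X \<omega>))"
  proof (rule integral_mono)
    have "integrable M (indicator {\<omega> \<in> space M. X \<omega> > y} :: 'a \<Rightarrow> real)"
      by (intro integrable_boundedI[of _ 1]) (auto simp: indicator_def)
    then show "integrable M (\<lambda>\<omega>. exp y * indicator {\<omega> \<in> space M. X \<omega> > y} \<omega> :: real)" by simp
  qed (use int in \<open>auto simp: indicator_def\<close>)
  finally have "exp y * prob {\<omega> \<in> space M. X \<omega> > y} \<le> exp b" using up by linarith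
  then show ?thesis by (simp add: exp_diff field_simps)
qed

text \<open>Almost surely, if the limit exceeds \<open>u\<close> then all late partial sums do. The
  event is therefore covered by the increasing union of the sets \<open>C N\<close>, each of which
  is contained in the event for a single partial sum.\<close>

lemma prob_series_gt_le:
  fixes Z :: "nat \<Rightarrow> 'a \<Rightarrow> real"
  assumes [measurable]: "\<And>n. Z n \<in> borel_measurable M" and ae: "AE \<omega> in M. summable (\<lambda>n. Z n \<omega>)"
    and p: "\<And>N. N \<ge> N0 \<Longrightarrow> prob {\<omega> \<in> space M. (\<Sum>n<N. Z n \<omega>) > u} \<le> p"
  shows "prob {\<omega> \<in> space M. (\<Sum>n. Z n \<omega>) > u} \<le> p"
proof -
  define C where "C N = {\<omega> \<in> space M. \<forall>k\<ge>N. (\<Sum>n<k. Z n \<omega>) > u}" for N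
  have [measurable]: "C N \<in> sets M" for N unfolding C_def by measurable
  have "prob {\<omega> \<in> space M. (\<Sum>n. Z n \<omega>) > u} \<le> prob (\<Union>N. C (N0 + N))"
  proof (rule finite_measure_mono_AE)
    show "AE \<omega> in M. \<omega> \<in> {\<omega> \<in> space M. (\<Sum>n. Z n \<omega>) > u} \<longrightarrow> \<omega> \<in> (\<Union>N. C (N0 + N))"
      using ae
    proof (rule AE_mp, intro AE_I2 impI)
      fix \<omega> assume *: "\<omega> \<in> space M" "summable (\<lambda>n. Z n \<omega>)" "\<omega> \<in> {\<omega> \<in> space M. (\<Sum>n. Z n \<omega>) > u}"
      then have "(\<lambda>k. \<Sum>n<k. Z n \<omega>) \<longlonglongrightarrow> (\<Sum>n. Z n \<omega>)" "u < (\<Sum>n. Z n \<omega>)"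
        by (auto simp: summable_LIMSEQ)
      then have "\<forall>\<^sub>F k in sequentially. u < (\<Sum>n<k. Z n \<omega>)" by (rule order_tendstoD)
      then obtain K where "\<forall>k\<ge>K. u < (\<Sum>n<k. Z n \<omega>)" by (auto simp: eventually_sequentially)
      then have "\<omega> \<in> C (N0 + K)" using * by (auto simp: C_def)
      then show "\<omega> \<in> (\<Union>N. C (N0 + N))" by blast
    qed
  qed measurable
  also have "\<dots> \<le> p"
  proof (rule LIMSEQ_le_const2)
    show "(\<lambda>N. prob (C (N0 + N))) \<longlonglongrightarrow> prob (\<Union>N. C (N0 + N))"
      by (rule finite_Lim_measure_incseq) (auto simp: incseq_def C_def)
    have "prob (C (N0 + N)) \<le> prob {\<omega> \<in> space M. (\<Sum>n<N0 + N. Z n \<omega>) > u}" for N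
      by (rule finite_measure_mono) (auto simp: C_def)
    then show "\<exists>N. \<forall>n\<ge>N. prob (C (N0 + n)) \<le> p" using p by (meson le_add1 order_trans)
  qed
  finally show ?thesis .
qed

text \<open>The preceding bound for the negated variables, followed by complements. The gap
  \<open>v < u\<close> absorbs the loss of strictness in the limit.\<close>

lemma prob_series_gt_ge:
  fixes Z :: "nat \<Rightarrow> 'a \<Rightarrow> real"
  assumes [measurable]: "\<And>n. Z n \<in> borel_measurable M" and ae: "AE \<omega> in M. summable (\<lambda>n. Z n \<omega>)"
    and p: "\<And>N. N \<ge> N0 \<Longrightarrow> p \<le> prob {\<omega> \<in> space M. (\<Sum>n<N. Z n \<omega>) \<ge> u}" and "v < u"
  shows "p \<le> prob {\<omega> \<in> space M. (\<Sum>n. Z n \<omega>) > v}"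
proof -
  have compl: "prob {\<omega> \<in> space M. \<not> P \<omega>} = 1 - prob {\<omega> \<in> space M. P \<omega>}" if "Measurable.pred M P" for P
    using that by (intro prob_neg) auto
  have "prob {\<omega> \<in> space M. (\<Sum>n. - Z n \<omega>) > - u} \<le> 1 - p"
  proof (rule prob_series_gt_le[of _ N0])
    fix N assume "N \<ge> N0"
    have "{\<omega> \<in> space M. (\<Sum>n<N. - Z n \<omega>) > - u} = {\<omega> \<in> space M. \<not> (\<Sum>n<N. Z n \<omega>) \<ge> u}"
      by (auto simp: sum_negf)
    then show "prob {\<omega> \<in> space M. (\<Sum>n<N. - Z n \<omega>) > - u} \<le> 1 - p"
      using p[OF \<open>N \<ge> N0\<close>] by (simp only:) (subst compl, auto)
  qed (use ae in \<open>auto intro: summable_minus\<close>)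
  moreover have "prob {\<omega> \<in> space M. \<not> (\<Sum>n. Z n \<omega>) > v} \<le> prob {\<omega> \<in> space M. (\<Sum>n. - Z n \<omega>) > - u}"
  proof (rule finite_measure_mono_AE)
    show "AE \<omega> in M. \<omega> \<in> {\<omega> \<in> space M. \<not> (\<Sum>n. Z n \<omega>) > v} \<longrightarrow> \<omega> \<in> {\<omega> \<in> space M. (\<Sum>n. - Z n \<omega>) > - u}"
      using ae by (rule AE_mp) (use \<open>v < u\<close> in \<open>auto simp: suminf_minus\<close>)
  qed measurable
  moreover have "prob {\<omega> \<in> space M. \<not> (\<Sum>n. Z n \<omega>) > v} = 1 - prob {\<omega> \<in> space M. (\<Sum>n. Z n \<omega>) > v}"
    by (rule compl) measurable
  ultimately show ?thesis by linarith
qed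

lemma expectation_exp_sum:
  fixes Z :: "nat \<Rightarrow> 'a \<Rightarrow> real"
  assumes ind: "indep_vars (\<lambda>_. borel) Z UNIV"
    and bnd: "\<And>n \<omega>. \<omega> \<in> space M \<Longrightarrow> \<bar>Z n \<omega>\<bar> \<le> B n"
  shows "expectation (\<lambda>\<omega>. exp (\<Sum>n<N. Z n \<omega>)) = (\<Prod>n<N. expectation (\<lambda>\<omega>. exp (Z n \<omega>)))"
    and "integrable M (\<lambda>\<omega>. exp (\<Sum>n<N. Z n \<omega>))"
proof -
  have i1: "indep_vars (\<lambda>_. borel) (\<lambda>n \<omega>. exp (Z n \<omega>)) {..<N}"
    using indep_vars_compose2[OF indep_vars_subset[OF ind], of "{..<N}" "\<lambda>_. exp" "\<lambda>_. borel"] by simp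
  have [measurable]: "Z i \<in> borel_measurable M" for i using ind by (auto simp: indep_vars_def)
  have i2: "integrable M (\<lambda>\<omega>. exp (Z n \<omega>))" for n
    by (rule integrable_boundedI[of _ "exp (B n)"]) (use bnd in \<open>auto dest!: abs_le_D1\<close>)
  show "expectation (\<lambda>\<omega>. exp (\<Sum>n<N. Z n \<omega>)) = (\<Prod>n<N. expectation (\<lambda>\<omega>. exp (Z n \<omega>)))"
    using indep_vars_lebesgue_integral[OF finite_lessThan i1] i2 by (simp add: exp_sum)
  show "integrable M (\<lambda>\<omega>. exp (\<Sum>n<N. Z n \<omega>))"
    using indep_vars_integrable[OF finite_lessThan i1] i2 by (simp add: exp_sum)
qed

end

section \<open>Tails of sums over independent Haar matrices\<close>

locale haar_sequence = prob_space M for M :: "'w measure" +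
  fixes d :: "nat \<Rightarrow> nat" and \<eta> :: "nat \<Rightarrow> 'w \<Rightarrow> real mat"
  assumes d_pos: "d n > 0"
    and indep: "indep_vars (\<lambda>n. orthogonal_borel (d n)) \<eta> UNIV"
    and haar_distr: "haar_orthogonal (d n) (distr M (orthogonal_borel (d n)) (\<eta> n))"
begin

lemma haar: "haar (d n) (distr M (orthogonal_borel (d n)) (\<eta> n))"
  by (rule haar.intro[OF haar_distr])

lemma eta_measurable [measurable]: "\<eta> n \<in> M \<rightarrow>\<^sub>M orthogonal_borel (d n)"
  using indep by (auto simp: indep_vars_def)

lemma eta_orthogonal: "\<omega> \<in> space M \<Longrightarrow> \<eta> n \<omega> \<in> orthogonal_group (d n)"
  using measurable_space[OF eta_measurable] by simp

text \<open>The summand \<open>n\<close> after diagonalisation, with the weights \<open>y n\<close>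
  on the diagonal of \<open>\<eta> n\<close>. The weights are an argument so that parts, multiples
  and sign changes of them can be compared on the same matrices.\<close>

definition Z :: "(nat \<Rightarrow> nat \<Rightarrow> real) \<Rightarrow> nat \<Rightarrow> 'w \<Rightarrow> real" where
  "Z y n \<omega> = real (d n) * haar.dtr (d n) (y n) (\<eta> n \<omega>)"

lemma dtr_measurable: "haar.dtr (d n) x \<in> borel_measurable (orthogonal_borel (d n))"
  by (rule haar.measurable_dtr_gram_twist[OF haar])

lemma Z_indep: "indep_vars (\<lambda>_. borel) (Z y) UNIV"
  unfolding Z_def using dtr_measurable by (intro indep_vars_compose2[OF indep]) measurable

lemma Z_measurable [measurable]: "Z y n \<in> borel_measurable M"
  using Z_indep by (auto simp: indep_vars_def)

lemma Z_bound:
  assumes "\<omega> \<in> space M"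
  shows "\<bar>Z y n \<omega>\<bar> \<le> real (d n) * (\<Sum>i<d n. \<bar>y n i\<bar>)"
proof -
  have "\<bar>haar.dtr (d n) (y n) (\<eta> n \<omega>)\<bar> \<le> (\<Sum>i<d n. \<bar>y n i * ent (d n) i i (\<eta> n \<omega>)\<bar>)"
    unfolding haar.dtr_def[OF haar] by (rule sum_abs)
  also have "\<dots> \<le> (\<Sum>i<d n. \<bar>y n i\<bar>)"
    using ent_le[OF eta_orthogonal[OF assms]] unfolding abs_mult
    by (intro sum_mono mult_left_le) auto
  finally show ?thesis unfolding Z_def abs_mult by (intro mult_mono) auto
qed

lemma Z_add: "Z (\<lambda>n i. x n i + y n i) n \<omega> = Z x n \<omega> + Z y n \<omega>"
  by (simp add: Z_def haar.dtr_def[OF haar] sum.distrib algebra_simps)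

lemma Z_scale: "Z (\<lambda>n i. a * y n i) n \<omega> = a * Z y n \<omega>"
  by (simp add: Z_def haar.dtr_def[OF haar] sum_distrib_left mult_ac)

lemma expectation_eta:
  assumes "g \<in> borel_measurable (orthogonal_borel (d n))"
  shows "expectation (\<lambda>\<omega>. g (\<eta> n \<omega>) :: real) = (\<integral>U. g U \<partial>(distr M (orthogonal_borel (d n)) (\<eta> n)))"
  by (rule integral_distr[OF eta_measurable assms, symmetric])

lemma Z_mean: "expectation (Z y n) = 0"
  unfolding Z_def using expectation_eta[OF dtr_measurable, of n "y n"] haar.integral_dtr[OF haar, of n "y n"]
  by simp

text \<open>With singular values as weights this is the part of the squared l2 norm of
  \<open>s\<close> that comes from block \<open>n\<close>, where every value is listed
  \<open>d n\<close> times.\<close>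

lemma Z_variance: "expectation (\<lambda>\<omega>. (Z y n \<omega>)\<^sup>2) = real (d n) * (\<Sum>i<d n. (y n i)\<^sup>2)"
proof -
  note [measurable] = dtr_measurable
  have "expectation (\<lambda>\<omega>. (haar.dtr (d n) (y n) (\<eta> n \<omega>))\<^sup>2) = (\<Sum>i<d n. (y n i)\<^sup>2) / real (d n)"
    using haar.integral_dtr_square[OF haar d_pos, of n "y n"]
    by (subst expectation_eta[where g = "\<lambda>U. (haar.dtr (d n) (y n) U)\<^sup>2"]) auto
  then show ?thesis using d_pos[of n] unfolding Z_def power_mult_distrib
    by (simp add: power2_eq_square)
qed

lemma Z_exp_moment:
  "expectation (\<lambda>\<omega>. exp (Z y n \<omega>)) = (\<integral>U. exp (real (d n) * haar.dtr (d n) (y n) U) \<partial>(distr M (orthogonal_borel (d n)) (\<eta> n)))"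
proof -
  note [measurable] = dtr_measurable
  show ?thesis unfolding Z_def
    by (rule expectation_eta[where g = "\<lambda>U. exp (real (d n) * haar.dtr (d n) (y n) U)"]) measurable
qed

lemma Z_sum_exp_moment:
  "expectation (\<lambda>\<omega>. exp (\<Sum>n<N. Z y n \<omega>)) = (\<Prod>n<N. expectation (\<lambda>\<omega>. exp (Z y n \<omega>)))"
  "integrable M (\<lambda>\<omega>. exp (\<Sum>n<N. Z y n \<omega>))"
  by (rule expectation_exp_sum[OF Z_indep Z_bound]; assumption)+

lemma Z_sum_exp_upper:
  "expectation (\<lambda>\<omega>. exp (\<Sum>n<N. Z y n \<omega>)) \<le> exp (2 * (\<Sum>n<N. real (d n) * (\<Sum>i<d n. (y n i)\<^sup>2)))"
proof -
  have "expectation (\<lambda>\<omega>. exp (Z y n \<omega>)) \<le> exp (2 * (real (d n) * (\<Sum>i<d n. (y n i)\<^sup>2)))" for n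
    unfolding Z_exp_moment using haar.exp_moment_upper[OF haar, of n "y n"] by (simp add: mult.assoc)
  then have "(\<Prod>n<N. expectation (\<lambda>\<omega>. exp (Z y n \<omega>)))
      \<le> (\<Prod>n<N. exp (2 * (real (d n) * (\<Sum>i<d n. (y n i)\<^sup>2))))"
    by (intro prod_mono) simp
  also have "\<dots> = exp (\<Sum>n<N. 2 * (real (d n) * (\<Sum>i<d n. (y n i)\<^sup>2)))"
    by (rule exp_sum[symmetric]) simp
  finally show ?thesis unfolding Z_sum_exp_moment(1) by (simp only: sum_distrib_left[symmetric])
qed

lemma Z_sum_exp_lower:
  assumes "\<And>n i. i < d n \<Longrightarrow> \<bar>y n i\<bar> \<le> 1 / 16"
  shows "exp ((\<Sum>n<N. real (d n) * (\<Sum>i<d n. (y n i)\<^sup>2)) / 4) \<le> expectation (\<lambda>\<omega>. exp (\<Sum>n<N. Z y n \<omega>))"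
proof -
  have "exp (real (d n) * (\<Sum>i<d n. (y n i)\<^sup>2) / 4) \<le> expectation (\<lambda>\<omega>. exp (Z y n \<omega>))" for n
    unfolding Z_exp_moment using haar.exp_moment_lower[OF haar, of n "y n"] assms by simp
  then have "(\<Prod>n<N. exp (real (d n) * (\<Sum>i<d n. (y n i)\<^sup>2) / 4))
      \<le> (\<Prod>n<N. expectation (\<lambda>\<omega>. exp (Z y n \<omega>)))"
    by (intro prod_mono) simp
  then show ?thesis
    unfolding Z_sum_exp_moment(1) exp_sum[OF finite_lessThan, symmetric] by (simp only: sum_divide_distrib[symmetric])
qed

lemma Z_sum_exp_growth:
  assumes S: "\<And>n. S n \<subseteq> {..<d n}" and y: "\<And>n i. i \<in> S n \<Longrightarrow> y n i \<ge> 0" "\<And>n i. i \<notin> S n \<Longrightarrow> y n i = 0"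
  shows "exp ((\<Sum>n<N. real (d n) * (\<Sum>i<d n. y n i)) / 64 - (\<Sum>n<N. real (d n) * real (card (S n))) / 1024)
    \<le> expectation (\<lambda>\<omega>. exp (\<Sum>n<N. Z y n \<omega>))"
proof -
  have "exp (real (d n) * (\<Sum>i<d n. y n i) / 64 - real (d n) * real (card (S n)) / 1024)
      \<le> expectation (\<lambda>\<omega>. exp (Z y n \<omega>))" for n
  proof -
    have *: "(\<Sum>i<d n. y n i * f i) = (\<Sum>i\<in>S n. y n i * f i)" for f :: "nat \<Rightarrow> real"
      using S y(2) by (intro sum.mono_neutral_right) auto
    have 1: "haar.dtr (d n) (y n) U = (\<Sum>i\<in>S n. y n i * ent (d n) i i U)" for U
      unfolding haar.dtr_def[OF haar] by (rule *)
    have 2: "(\<Sum>i<d n. y n i) = (\<Sum>i\<in>S n. y n i)" using *[of "\<lambda>_. 1"] by simp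
    show ?thesis
      unfolding Z_exp_moment 1 2
      using haar.exp_moment_linear_growth[OF haar[of n] S[of n], where x = "y n"] y(1) by (simp add: algebra_simps)
  qed
  then have "(\<Prod>n<N. exp (real (d n) * (\<Sum>i<d n. y n i) / 64 - real (d n) * real (card (S n)) / 1024))
      \<le> (\<Prod>n<N. expectation (\<lambda>\<omega>. exp (Z y n \<omega>)))"
    by (intro prod_mono conjI) auto
  then show ?thesis
    unfolding Z_sum_exp_moment(1) exp_sum[OF finite_lessThan, symmetric] sum_subtractf sum_divide_distrib[symmetric] .
qed

lemma Z_sign_law:
  assumes "\<And>i. i < d n \<Longrightarrow> y' n i = \<sigma> i * y n i" "\<And>i. \<bar>\<sigma> i\<bar> = (1::real)"
  shows "distr M borel (Z y n) = distr M borel (Z y' n)"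
proof -
  let ?O = "orthogonal_borel (d n)"
  let ?L = "\<lambda>U. mat_diag (d n) \<sigma> * U"
  let ?f = "\<lambda>U. real (d n) * haar.dtr (d n) (y n) U"
  have [measurable]: "?f \<in> borel_measurable ?O" using dtr_measurable by measurable
  have LO: "mat_diag (d n) \<sigma> \<in> orthogonal_group (d n)" by (rule sign_matrix_orthogonal) (rule assms)
  have L [measurable]: "?L \<in> ?O \<rightarrow>\<^sub>M ?O" by (rule mult_measurable[OF LO])
  have inv: "distr M ?O (\<lambda>\<omega>. ?L (\<eta> n \<omega>)) = distr M ?O (\<eta> n)"
  proof -
    have "distr (distr M ?O (\<eta> n)) (distr M ?O (\<eta> n)) ?L = distr M ?O (\<eta> n)"
      using haar_distr LO by (auto simp: haar_orthogonal_def)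
    moreover have "distr (distr M ?O (\<eta> n)) (distr M ?O (\<eta> n)) ?L = distr (distr M ?O (\<eta> n)) ?O ?L"
      by (rule distr_cong) auto
    moreover have "\<dots> = distr M ?O (\<lambda>\<omega>. ?L (\<eta> n \<omega>))"
      by (subst distr_distr[OF L eta_measurable]) (simp add: comp_def)
    ultimately show ?thesis by simp
  qed
  have "distr M borel (Z y n) = distr (distr M ?O (\<eta> n)) borel ?f"
    by (subst distr_distr) (auto simp: comp_def Z_def[abs_def])
  also have "\<dots> = distr (distr M ?O (\<lambda>\<omega>. ?L (\<eta> n \<omega>))) borel ?f" unfolding inv ..
  also have "\<dots> = distr M borel (\<lambda>\<omega>. ?f (?L (\<eta> n \<omega>)))"
    by (subst distr_distr) (auto simp: comp_def)
  also have "\<dots> = distr M borel (Z y' n)"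
  proof (rule distr_cong[OF refl refl])
    fix \<omega> assume "\<omega> \<in> space M"
    then show "?f (?L (\<eta> n \<omega>)) = Z y' n \<omega>"
    proof -
      have "haar.dtr (d n) (y n) (?L (\<eta> n \<omega>)) = haar.dtr (d n) (\<lambda>i. \<sigma> i * y n i) (\<eta> n \<omega>)"
        by (rule haar.dtr_sign[OF haar eta_orthogonal]) fact
      also have "\<dots> = haar.dtr (d n) (y' n) (\<eta> n \<omega>)"
        unfolding haar.dtr_def[OF haar] by (intro sum.cong refl) (simp add: assms)
      finally show ?thesis by (simp add: Z_def)
    qed
  qed
  finally show ?thesis .
qed

lemma prob_sum_ge_part:
  fixes B :: "nat \<Rightarrow> nat set" and y :: "nat \<Rightarrow> nat \<Rightarrow> real"
  shows "prob {\<omega> \<in> space M. (\<Sum>n<N. Z (\<lambda>n i. if i \<in> B n then y n i else 0) n \<omega>) > u} \<le> 2 * prob {\<omega> \<in> space M. (\<Sum>n<N. Z y n \<omega>) > u}"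
proof -
  \<comment> \<open>\<open>p\<close> keeps the weights on \<open>B\<close> and \<open>x\<close>
    those off \<open>B\<close>, so that \<open>y\<close> is p + x and \<open>y'\<close> is p - x. A
    diagonal sign matrix carries one into the other, hence \<open>Z y n\<close> and
    \<open>Z y' n\<close> have the same law in every block.\<close>
  define p where "p n i = (if i \<in> B n then y n i else 0)" for n i
  define x where "x n i = (if i \<in> B n then 0 else y n i)" for n i
  define y' where "y' n i = (if i \<in> B n then 1 else - 1) * y n i" for n i
  have 1: "Z y n \<omega> = Z x n \<omega> + Z p n \<omega>" for n \<omega>
    unfolding Z_add[symmetric] by (rule arg_cong[of _ _ "\<lambda>y. Z y n \<omega>"]) (auto simp: x_def p_def fun_eq_iff)
  have 2: "Z y' n \<omega> = Z p n \<omega> - Z x n \<omega>" for n \<omega>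
  proof -
    have "Z y' n \<omega> + Z x n \<omega> = Z p n \<omega>"
      unfolding Z_add[symmetric] by (rule arg_cong[of _ _ "\<lambda>y. Z y n \<omega>"]) (auto simp: x_def y'_def p_def fun_eq_iff)
    then show ?thesis by simp
  qed
  have law: "distr M borel (Z y n) = distr M borel (Z y' n)" for n
    by (rule Z_sign_law[of n y' "\<lambda>i. if i \<in> B n then 1 else - 1"]) (auto simp: y'_def)
  show ?thesis
    using prob_sum_ge_half_of_sign_flip[where X = "Z x" and Y = "Z p" and N = N and u = u] Z_indep[of y] Z_indep[of y'] law
    unfolding 1[abs_def] 2[abs_def] p_def[abs_def] by simp
qed

text \<open>The \<open>b\<close> part is bounded surely, because the diagonal entries lie in
  [-1, 1]. For the \<open>c\<close> part, \<theta> = t / (4 w) minimises 2 \<theta>^2 w^2 - \<theta>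
  t w, with the value -t^2/8.\<close>

lemma upper_tail:
  assumes dec: "\<And>n i. i < d n \<Longrightarrow> y n i = b n i + c n i"
    and b: "(\<Sum>n<N. real (d n) * (\<Sum>i<d n. \<bar>b n i\<bar>)) \<le> \<beta>"
    and c: "(\<Sum>n<N. real (d n) * (\<Sum>i<d n. (c n i)\<^sup>2)) \<le> w\<^sup>2"
    and w: "w > 0" and t: "t > 0"
  shows "prob {\<omega> \<in> space M. (\<Sum>n<N. Z y n \<omega>) > \<beta> + t * w} \<le> exp (- (t\<^sup>2 / 8))"
proof -
  define \<theta> where "\<theta> = t / (4 * w)"
  have \<theta>: "\<theta> > 0" using w t by (simp add: \<theta>_def)
  define X where "X \<omega> = (\<Sum>n<N. Z (\<lambda>n i. \<theta> * c n i) n \<omega>)" for \<omega>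
  have X: "X \<omega> = \<theta> * (\<Sum>n<N. Z c n \<omega>)" for \<omega> by (simp add: X_def Z_scale sum_distrib_left)
  have Zy: "Z y n \<omega> = Z b n \<omega> + Z c n \<omega>" for n \<omega>
    unfolding Z_def haar.dtr_def[OF haar] using dec by (simp add: sum.distrib algebra_simps)
  have "prob {\<omega> \<in> space M. (\<Sum>n<N. Z y n \<omega>) > \<beta> + t * w} \<le> prob {\<omega> \<in> space M. X \<omega> > \<theta> * (t * w)}"
  proof (rule finite_measure_mono)
    show "{\<omega> \<in> space M. (\<Sum>n<N. Z y n \<omega>) > \<beta> + t * w} \<subseteq> {\<omega> \<in> space M. X \<omega> > \<theta> * (t * w)}"
    proof safe
      fix \<omega> assume \<omega>: "\<omega> \<in> space M" "(\<Sum>n<N. Z y n \<omega>) > \<beta> + t * w"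
      have "(\<Sum>n<N. Z b n \<omega>) \<le> (\<Sum>n<N. real (d n) * (\<Sum>i<d n. \<bar>b n i\<bar>))"
        by (intro sum_mono order.trans[OF abs_ge_self Z_bound] \<omega>)
      then have "(\<Sum>n<N. Z c n \<omega>) > t * w" using \<omega>(2) b by (simp add: Zy sum.distrib)
      then show "X \<omega> > \<theta> * (t * w)" unfolding X using \<theta> by simp
    qed
  qed (unfold X_def, measurable)
  also have "\<dots> \<le> exp (t\<^sup>2 / 8 - \<theta> * (t * w))"
  proof (rule exp_moment_upper_tail)
    show "integrable M (\<lambda>\<omega>. exp (X \<omega>))" unfolding X_def by (rule Z_sum_exp_moment(2))
    have "expectation (\<lambda>\<omega>. exp (X \<omega>)) \<le> exp (2 * (\<Sum>n<N. real (d n) * (\<Sum>i<d n. (\<theta> * c n i)\<^sup>2)))"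
      unfolding X_def by (rule Z_sum_exp_upper)
    also have "(\<Sum>n<N. real (d n) * (\<Sum>i<d n. (\<theta> * c n i)\<^sup>2)) = \<theta>\<^sup>2 * (\<Sum>n<N. real (d n) * (\<Sum>i<d n. (c n i)\<^sup>2))"
      by (simp add: power_mult_distrib sum_distrib_left mult_ac)
    also have "2 * \<dots> \<le> 2 * (\<theta>\<^sup>2 * w\<^sup>2)" using c by (simp add: mult_left_mono)
    also have "\<dots> = t\<^sup>2 / 8" using w by (simp add: \<theta>_def power_divide power_mult_distrib)
    finally show "expectation (\<lambda>\<omega>. exp (X \<omega>)) \<le> exp (t\<^sup>2 / 8)" by simp
  qed (unfold X_def, measurable)
  also have "t\<^sup>2 / 8 - \<theta> * (t * w) = - (t\<^sup>2 / 8)" using w by (simp add: \<theta>_def power2_eq_square)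
  finally show ?thesis .
qed

text \<open>The exponential parameter \<open>\<kappa> = 128 * t\<^sup>2 / H\<close> makes the linear term \<open>\<kappa> * H / 64\<close> of the growth bound
  equal to \<open>2 * t\<^sup>2\<close>, which absorbs the loss \<open>t\<^sup>2 / 1024\<close> and the \<open>ln 2\<close>.\<close>

lemma lower_tail_large_values:
  fixes B :: "nat \<Rightarrow> nat set"
  assumes B: "\<And>n. B n \<subseteq> {..<d n}" and y: "\<And>n i. i \<in> B n \<Longrightarrow> y n i \<ge> 0"
    and card: "(\<Sum>n<N. real (d n) * real (card (B n))) \<le> t\<^sup>2"
    and H: "H = (\<Sum>n<N. real (d n) * (\<Sum>i\<in>B n. y n i))" "H > 0" and t: "t \<ge> 1"
  shows "exp (- (128 * t\<^sup>2)) / 4 \<le> prob {\<omega> \<in> space M. (\<Sum>n<N. Z y n \<omega>) > H / 256}"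
proof -
  define x where "x n i = (if i \<in> B n then y n i else 0)" for n i
  define \<kappa> where "\<kappa> = 128 * t\<^sup>2 / H"
  have \<kappa>: "\<kappa> > 0" using H t by (simp add: \<kappa>_def)
  have sx: "(\<Sum>i<d n. x n i) = (\<Sum>i\<in>B n. y n i)" for n
    using B by (intro sum.mono_neutral_cong_right) (auto simp: x_def)
  have Hx: "(\<Sum>n<N. real (d n) * (\<Sum>i<d n. x n i)) = H" by (simp add: sx H)
  define X where "X \<omega> = (\<Sum>n<N. Z (\<lambda>n i. \<kappa> * x n i) n \<omega>)" for \<omega>
  have X: "X \<omega> = \<kappa> * (\<Sum>n<N. Z x n \<omega>)" for \<omega> by (simp add: X_def Z_scale sum_distrib_left)
  have t2: "t\<^sup>2 \<ge> 1" using t by simp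
  define r where "r = \<kappa> * H / 64 - t\<^sup>2 / 1024"
  have "exp (r - \<kappa> * H) / 2 \<le> prob {\<omega> \<in> space M. X \<omega> \<ge> r - ln 2}"
  proof (rule exp_moment_bounded_lower_tail)
    fix \<omega> assume \<omega>: "\<omega> \<in> space M"
    have "(\<Sum>n<N. Z x n \<omega>) \<le> (\<Sum>n<N. real (d n) * (\<Sum>i<d n. \<bar>x n i\<bar>))"
      by (intro sum_mono order.trans[OF abs_ge_self Z_bound] \<omega>)
    also have "\<dots> = H" unfolding Hx[symmetric] using y by (intro sum.cong refl arg_cong2[of _ _ _ _ "(*)"]) (auto simp: x_def)
    finally show "X \<omega> \<le> \<kappa> * H" unfolding X using \<kappa> by simp
  next
    have "r \<le> (\<Sum>n<N. real (d n) * (\<Sum>i<d n. \<kappa> * x n i)) / 64 - (\<Sum>n<N. real (d n) * real (card (B n))) / 1024"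
    proof -
      have "(\<Sum>n<N. real (d n) * (\<Sum>i<d n. \<kappa> * x n i)) = \<kappa> * H"
        unfolding Hx[symmetric] by (simp add: sum_distrib_left mult_ac)
      then show ?thesis using card by (simp add: r_def)
    qed
    also have "exp \<dots> \<le> expectation (\<lambda>\<omega>. exp (X \<omega>))"
      unfolding X_def using B y \<kappa> by (intro Z_sum_exp_growth) (auto simp: x_def)
    finally show "exp r \<le> expectation (\<lambda>\<omega>. exp (X \<omega>))" by simp
  qed (unfold X_def, measurable)
  moreover have "exp (- (128 * t\<^sup>2)) \<le> exp (r - \<kappa> * H)"
    using H t2 by (simp add: r_def \<kappa>_def)
  moreover have "prob {\<omega> \<in> space M. X \<omega> \<ge> r - ln 2} \<le> prob {\<omega> \<in> space M. (\<Sum>n<N. Z x n \<omega>) > H / 256}"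
  proof (rule finite_measure_mono)
    have "ln 2 \<le> (1::real)" using ln_le_minus_one[of "2::real"] by simp
    \<comment> \<open>Here \<kappa> H / 256 = t^2/2, whereas r - ln 2 is at least 2 t^2 - t^2/1024 -
      1, and t >= 1.\<close>
    then have "\<kappa> * (H / 256) < r - ln 2" using H t2 by (simp add: r_def \<kappa>_def)
    then have "H / 256 < (\<Sum>n<N. Z x n \<omega>)" if "r - ln 2 \<le> X \<omega>" for \<omega>
      using that mult_less_cancel_left_pos[OF \<kappa>, of "H / 256" "\<Sum>n<N. Z x n \<omega>"] unfolding X by linarith
    then show "{\<omega> \<in> space M. X \<omega> \<ge> r - ln 2} \<subseteq> {\<omega> \<in> space M. (\<Sum>n<N. Z x n \<omega>) > H / 256}"
      by auto
  qed measurable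
  moreover have "prob {\<omega> \<in> space M. (\<Sum>n<N. Z x n \<omega>) > H / 256} \<le> 2 * prob {\<omega> \<in> space M. (\<Sum>n<N. Z y n \<omega>) > H / 256}"
    unfolding x_def[abs_def] by (rule prob_sum_ge_part)
  ultimately show ?thesis by linarith
qed

text \<open>\<theta> = t / (80 w) is the largest parameter for which t |y n i| <= 5 w guarantees
  |\<theta> y n i| <= 1/16. The quadratic bounds at \<theta> and 2 \<theta> have the exponents a =
  t^2/25600 and t^2/800, which enter Paley-Zygmund. The level t w / 1280 corresponds to a/4 in the
  exponent, and t >= 256 makes the remaining 3a/4 exceed ln 2.\<close>

lemma lower_tail_small_values:
  fixes B :: "nat \<Rightarrow> nat set"
  assumes B: "\<And>n. B n \<subseteq> {..<d n}" and y: "\<And>n i. i \<in> B n \<Longrightarrow> t * \<bar>y n i\<bar> \<le> 5 * w"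
    and w: "w\<^sup>2 = (\<Sum>n<N. real (d n) * (\<Sum>i\<in>B n. (y n i)\<^sup>2))" "w > 0" and t: "t \<ge> 256"
  shows "exp (- (128 * t\<^sup>2)) / 8 \<le> prob {\<omega> \<in> space M. (\<Sum>n<N. Z y n \<omega>) > t * w / 1280}"
proof -
  define x where "x n i = (if i \<in> B n then y n i else 0)" for n i
  define \<theta> where "\<theta> = t / (80 * w)"
  have \<theta>: "\<theta> > 0" using w t by (simp add: \<theta>_def)
  have sx: "(\<Sum>i<d n. (a * x n i)\<^sup>2) = a\<^sup>2 * (\<Sum>i\<in>B n. (y n i)\<^sup>2)" for n a
    unfolding sum_distrib_left using B
    by (intro sum.mono_neutral_cong_right) (auto simp: x_def power_mult_distrib)
  have wx: "(\<Sum>n<N. real (d n) * (\<Sum>i<d n. (a * x n i)\<^sup>2)) = a\<^sup>2 * w\<^sup>2" for a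
    unfolding sx w(1) by (simp add: sum_distrib_left mult_ac)
  define X where "X \<omega> = (\<Sum>n<N. Z (\<lambda>n i. \<theta> * x n i) n \<omega>)" for \<omega>
  have X: "X \<omega> = \<theta> * (\<Sum>n<N. Z x n \<omega>)" for \<omega> by (simp add: X_def Z_scale sum_distrib_left)
  have X2: "2 * X \<omega> = (\<Sum>n<N. Z (\<lambda>n i. (2 * \<theta>) * x n i) n \<omega>)" for \<omega>
    unfolding X Z_scale by (simp add: sum_distrib_left mult.assoc)
  have \<theta>w: "\<theta>\<^sup>2 * w\<^sup>2 = t\<^sup>2 / 6400" using w(2) by (simp add: \<theta>_def power_divide power_mult_distrib)
  define a where "a = t\<^sup>2 / 25600"
  have "exp (2 * a - t\<^sup>2 / 800) / 4 \<le> prob {\<omega> \<in> space M. X \<omega> \<ge> a - ln 2}"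
  proof (rule exponential_Paley_Zygmund)
    show "integrable M (\<lambda>\<omega>. exp (X \<omega>))" unfolding X_def by (rule Z_sum_exp_moment(2))
    show "integrable M (\<lambda>\<omega>. exp (2 * X \<omega>))" unfolding X2 by (rule Z_sum_exp_moment(2))
    have "\<bar>\<theta> * x n i\<bar> \<le> 1 / 16" for n i
    proof (cases "i \<in> B n")
      case True
      have "\<bar>\<theta> * x n i\<bar> = (t * \<bar>y n i\<bar>) / (80 * w)" using True t w by (simp add: \<theta>_def x_def abs_mult)
      also have "\<dots> \<le> (5 * w) / (80 * w)" using y[OF True] w by (intro divide_right_mono) auto
      finally show ?thesis using w by simp
    qed (simp add: x_def)
    then have "exp ((\<Sum>n<N. real (d n) * (\<Sum>i<d n. (\<theta> * x n i)\<^sup>2)) / 4) \<le> expectation (\<lambda>\<omega>. exp (X \<omega>))"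
      unfolding X_def by (intro Z_sum_exp_lower)
    then show "exp a \<le> expectation (\<lambda>\<omega>. exp (X \<omega>))" unfolding wx \<theta>w by (simp add: a_def)
    have "expectation (\<lambda>\<omega>. exp (2 * X \<omega>)) \<le> exp (2 * (\<Sum>n<N. real (d n) * (\<Sum>i<d n. (2 * \<theta> * x n i)\<^sup>2)))"
      unfolding X2 by (rule Z_sum_exp_upper)
    also have "\<dots> = exp (2 * ((2 * \<theta>)\<^sup>2 * w\<^sup>2))" unfolding wx ..
    also have "2 * ((2 * \<theta>)\<^sup>2 * w\<^sup>2) = t\<^sup>2 / 800" using \<theta>w by (simp add: power_mult_distrib)
    finally show "expectation (\<lambda>\<omega>. exp (2 * X \<omega>)) \<le> exp (t\<^sup>2 / 800)" .
  qed (unfold X_def, measurable)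
  moreover have "exp (- (128 * t\<^sup>2)) \<le> exp (2 * a - t\<^sup>2 / 800)" by (simp add: a_def)
  moreover have "prob {\<omega> \<in> space M. X \<omega> \<ge> a - ln 2} \<le> prob {\<omega> \<in> space M. (\<Sum>n<N. Z x n \<omega>) > t * w / 1280}"
  proof (rule finite_measure_mono)
    have "ln 2 \<le> (1::real)" using ln_le_minus_one[of "2::real"] by simp
    moreover have "256 * 256 \<le> t * t" using t by (intro mult_mono) auto
    moreover have "\<theta> * (t * w / 1280) = t * t / 102400" using w by (simp add: \<theta>_def)
    ultimately have "\<theta> * (t * w / 1280) < a - ln 2" unfolding a_def power2_eq_square by linarith
    then have "t * w / 1280 < (\<Sum>n<N. Z x n \<omega>)" if "a - ln 2 \<le> X \<omega>" for \<omega>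
      using that mult_less_cancel_left_pos[OF \<theta>, of "t * w / 1280" "\<Sum>n<N. Z x n \<omega>"] unfolding X by linarith
    then show "{\<omega> \<in> space M. X \<omega> \<ge> a - ln 2} \<subseteq> {\<omega> \<in> space M. (\<Sum>n<N. Z x n \<omega>) > t * w / 1280}"
      by auto
  qed measurable
  moreover have "prob {\<omega> \<in> space M. (\<Sum>n<N. Z x n \<omega>) > t * w / 1280} \<le> 2 * prob {\<omega> \<in> space M. (\<Sum>n<N. Z y n \<omega>) > t * w / 1280}"
    unfolding x_def[abs_def] by (rule prob_sum_ge_part)
  ultimately show ?thesis by linarith
qed

lemma AE_summable_Z:
  assumes "summable (\<lambda>n. real (d n) * (\<Sum>i<d n. (y n i)\<^sup>2))"
  shows "AE \<omega> in M. summable (\<lambda>n. Z y n \<omega>)"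
  by (rule AE_summable_indep[OF Z_indep Z_bound Z_mean _ assms]) (auto simp: Z_variance)

end

section \<open>The K-functional of the singular values\<close>

lemma nat_sums_eventually_zero:
  fixes f :: "nat \<Rightarrow> nat"
  assumes "f sums k"
  shows "\<exists>N. (\<forall>n\<ge>N. f n = 0) \<and> (\<Sum>n<N. f n) = k"
proof -
  have "\<forall>\<^sub>F N in sequentially. (\<Sum>n<N. f n) = k"
    using assms unfolding sums_def nhds_discrete filterlim_principal by simp
  then obtain N where N: "\<And>m. m \<ge> N \<Longrightarrow> (\<Sum>n<m. f n) = k" by (auto simp: eventually_sequentially)
  have "f n = 0" if "n \<ge> N" for n using N[of n] N[of "Suc n"] that by simp
  then show ?thesis using N[of N] by blast
qed

lemma sum_less_filter:
  "(\<Sum>i\<in>{i. i < n \<and> P i}. f i) = (\<Sum>i<n::nat. if P i then f i else (0::real))"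
  by (rule trans[OF _ sum.inter_filter[OF finite_lessThan]]) (rule sum.cong, auto)

definition K12_values :: "real \<Rightarrow> (nat \<Rightarrow> real) \<Rightarrow> real set" where
  "K12_values t a = {(\<Sum>m. \<bar>b m\<bar>) + t * sqrt (\<Sum>m. (c m)\<^sup>2) | b c.
     summable (\<lambda>m. \<bar>b m\<bar>) \<and> summable (\<lambda>m. (c m)\<^sup>2) \<and> (\<forall>m. b m + c m = a m)}"

lemma K12_eq: "K12 t a = Inf (K12_values t a)"
  by (simp add: K12_def K12_values_def)

lemma K12_values_nonneg: "t \<ge> 0 \<Longrightarrow> x \<in> K12_values t a \<Longrightarrow> x \<ge> 0"
  by (auto simp: K12_values_def intro!: add_nonneg_nonneg mult_nonneg_nonneg suminf_nonneg)

lemma K12_values_nonempty: "summable (\<lambda>m. (a m)\<^sup>2) \<Longrightarrow> K12_values t a \<noteq> {}"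
  unfolding K12_values_def by (force intro: exI[of _ "\<lambda>_. 0"] exI[of _ a])

lemma bdd_below_K12_values: "t \<ge> 0 \<Longrightarrow> bdd_below (K12_values t a)"
  by (rule bdd_belowI[of _ 0]) (rule K12_values_nonneg)

lemma K12_nonneg: "t \<ge> 0 \<Longrightarrow> summable (\<lambda>m. (a m)\<^sup>2) \<Longrightarrow> K12 t a \<ge> 0"
  unfolding K12_eq by (erule cInf_greatest[OF K12_values_nonempty]) (rule K12_values_nonneg)

lemma K12_le:
  assumes "t \<ge> 0" "summable (\<lambda>m. \<bar>b m\<bar>)" "summable (\<lambda>m. (c m)\<^sup>2)" "\<And>m. b m + c m = a m"
  shows "K12 t a \<le> (\<Sum>m. \<bar>b m\<bar>) + t * sqrt (\<Sum>m. (c m)\<^sup>2)"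
  unfolding K12_eq
  by (rule cInf_lower[OF _ bdd_below_K12_values]) (use assms in \<open>auto simp: K12_values_def\<close>)

lemma K12_mono:
  assumes "0 \<le> t" "t \<le> t'" "summable (\<lambda>m. (a m)\<^sup>2)"
  shows "K12 t a \<le> K12 t' a"
  unfolding K12_eq
proof (rule cInf_mono[OF K12_values_nonempty bdd_below_K12_values])
  fix x assume "x \<in> K12_values t' a"
  then obtain b c where bc: "x = (\<Sum>m. \<bar>b m\<bar>) + t' * sqrt (\<Sum>m. (c m)\<^sup>2)"
    "summable (\<lambda>m. \<bar>b m\<bar>)" "summable (\<lambda>m. (c m)\<^sup>2)" "\<forall>m. b m + c m = a m"
    by (auto simp: K12_values_def)
  have "t * sqrt (\<Sum>m. (c m)\<^sup>2) \<le> t' * sqrt (\<Sum>m. (c m)\<^sup>2)"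
    using assms bc by (intro mult_right_mono) (auto intro: suminf_nonneg)
  then show "\<exists>y\<in>K12_values t a. y \<le> x" unfolding bc(1) using bc
    by (intro bexI[of _ "(\<Sum>m. \<bar>b m\<bar>) + t * sqrt (\<Sum>m. (c m)\<^sup>2)"]) (auto simp: K12_values_def)
qed (use assms in auto)

section \<open>Matching the decreasing list with the blocks\<close>

locale haar_rearrangement = haar_sequence +
  fixes \<sigma> :: "nat \<Rightarrow> nat \<Rightarrow> real" and s :: "nat \<Rightarrow> real"
  assumes \<sigma>: "\<sigma> n i \<ge> 0"
    and s_decseq: "decseq s" and s_nonneg: "s m \<ge> 0" and s_square: "summable (\<lambda>m. (s m)\<^sup>2)"
    and s_finite: "x > 0 \<Longrightarrow> finite {m. s m = x}"
    and s_count: "x > 0 \<Longrightarrow> (\<lambda>n. d n * card {i. i < d n \<and> \<sigma> n i = x}) sums card {m. s m = x}"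
begin

text \<open>The positions \<open>(n, i, j)\<close> index the combined list: \<open>j < d n\<close> numbers the copies of the
  \<open>i\<close>-th singular value of the \<open>n\<close>-th matrix.\<close>

definition J :: "(nat \<times> nat \<times> nat) set" where
  "J = {(n, i, j). i < d n \<and> j < d n \<and> \<sigma> n i > 0}"

definition val :: "nat \<times> nat \<times> nat \<Rightarrow> real" where "val = (\<lambda>(n, i, j). \<sigma> n i)"

text \<open>Every x > 0 occurs finitely often, and equally often, in the combined list and in
  \<open>s\<close>; bijections of these level sets are chosen separately and glued. The value 0 is
  left out, because padding leaves its multiplicity undetermined.\<close>

lemma rearrangement_exists: "\<exists>h. bij_betw h J {m. s m > 0} \<and> (\<forall>q\<in>J. s (h q) = val q)"
proof -
  have "\<exists>g. bij_betw g {q \<in> J. val q = x} {m. s m = x}" if x: "x > 0" for x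
  proof -
    obtain N where N: "\<And>n. n \<ge> N \<Longrightarrow> d n * card {i. i < d n \<and> \<sigma> n i = x} = 0"
      "(\<Sum>n<N. d n * card {i. i < d n \<and> \<sigma> n i = x}) = card {m. s m = x}"
      using nat_sums_eventually_zero[OF s_count[OF x]] by blast
    have "n < N" if "i < d n" "\<sigma> n i = x" for n i
    proof (rule ccontr)
      assume "\<not> n < N"
      then have "card {i. i < d n \<and> \<sigma> n i = x} = 0" using N(1)[of n] d_pos[of n] by auto
      then show False using that by (simp add: card_eq_0_iff)
    qed
    then have eq: "{q \<in> J. val q = x} = (SIGMA n:{..<N}. {i. i < d n \<and> \<sigma> n i = x} \<times> {..<d n})"
      using x by (auto simp: J_def val_def)
    have "card {q \<in> J. val q = x} = card {m. s m = x}"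
      unfolding eq N(2)[symmetric] by (subst card_SigmaI) (auto simp: card_cartesian_product mult.commute)
    moreover have "finite {q \<in> J. val q = x}" unfolding eq by auto
    ultimately show ?thesis using finite_same_card_bij s_finite[OF x] by blast
  qed
  then obtain g where g: "\<And>x. x > 0 \<Longrightarrow> bij_betw (g x) {q \<in> J. val q = x} {m. s m = x}" by metis
  define h where "h q = g (val q) q" for q
  have pos: "val q > 0" if "q \<in> J" for q using that by (auto simp: J_def val_def)
  have sh: "s (h q) = val q" if "q \<in> J" for q
    using bij_betw_apply[OF g[OF pos[OF that]], of q] that by (simp add: h_def)
  have "bij_betw h J {m. s m > 0}"
  proof (rule bij_betwI')
    fix p q assume pq: "p \<in> J" "q \<in> J"
    show "h p = h q \<longleftrightarrow> p = q"
    proof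
      assume eq: "h p = h q"
      then have "val p = val q" using sh pq by metis
      then show "p = q" using eq inj_onD[OF bij_betw_imp_inj_on[OF g[OF pos[OF pq(1)]]], of p q] pq
        by (simp add: h_def)
    qed simp
    show "h p \<in> {m. s m > 0}" using sh[OF pq(1)] pos[OF pq(1)] by simp
  next
    fix m assume "m \<in> {m. s m > 0}"
    then have "s m > 0" by simp
    from bij_betw_imp_surj_on[OF g[OF this]] have "m \<in> g (s m) ` {q \<in> J. val q = s m}" by blast
    then obtain q where "q \<in> J" "val q = s m" "m = g (s m) q" by blast
    then show "\<exists>q\<in>J. m = h q" by (metis h_def)
  qed
  then show ?thesis using sh by blast
qed

definition h :: "nat \<times> nat \<times> nat \<Rightarrow> nat" where
  "h = (SOME h. bij_betw h J {m. s m > 0} \<and> (\<forall>q\<in>J. s (h q) = val q))"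

lemma h: "bij_betw h J {m. s m > 0}" "q \<in> J \<Longrightarrow> s (h q) = val q"
  using someI_ex[OF rearrangement_exists] unfolding h_def[symmetric] by auto

definition JN :: "nat \<Rightarrow> (nat \<times> nat \<times> nat) set" where
  "JN N = (SIGMA n:{..<N}. {i. i < d n \<and> \<sigma> n i > 0} \<times> {..<d n})"

lemma JN: "finite (JN N)" "JN N \<subseteq> J" "inj_on h (JN N)"
proof -
  show "finite (JN N)" by (auto simp: JN_def)
  show "JN N \<subseteq> J" by (auto simp: JN_def J_def)
  then show "inj_on h (JN N)" using h(1) by (auto simp: bij_betw_def intro: inj_on_subset)
qed

lemma h_JN: "q \<in> JN N \<Longrightarrow> s (h q) = val q"
  using h(2) JN(2) by blast

lemma sum_JN:
  "(\<Sum>q\<in>JN N. F q) = (\<Sum>n<N. \<Sum>i<d n. if \<sigma> n i > 0 then (\<Sum>j<d n. F (n, i, j)) else (0::real))"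
proof -
  have "(\<Sum>q\<in>JN N. F q) = (\<Sum>n<N. \<Sum>p\<in>{i. i < d n \<and> \<sigma> n i > 0} \<times> {..<d n}. F (n, p))"
    unfolding JN_def by (subst sum.Sigma) (auto simp: case_prod_beta)
  also have "\<dots> = (\<Sum>n<N. \<Sum>i\<in>{i. i < d n \<and> \<sigma> n i > 0}. \<Sum>j<d n. F (n, i, j))"
    by (subst sum.cartesian_product) (simp add: case_prod_beta)
  also have "\<dots> = (\<Sum>n<N. \<Sum>i<d n. if \<sigma> n i > 0 then (\<Sum>j<d n. F (n, i, j)) else 0)"
    by (simp only: sum_less_filter)
  finally show ?thesis .
qed

lemma sum_JN_val:
  assumes "\<And>n i. i < d n \<Longrightarrow> \<not> \<sigma> n i > 0 \<Longrightarrow> F (\<sigma> n i) = 0"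
  shows "(\<Sum>q\<in>JN N. F (val q)) = (\<Sum>n<N. real (d n) * (\<Sum>i<d n. F (\<sigma> n i) :: real))"
  unfolding sum_JN sum_distrib_left by (intro sum.cong refl) (auto simp: val_def assms)

lemma sum_JN_le_suminf:
  assumes "summable F" "\<And>m. F m \<ge> (0::real)"
  shows "(\<Sum>q\<in>JN N. F (h q)) \<le> (\<Sum>m. F m)"
proof -
  have "(\<Sum>q\<in>JN N. F (h q)) = (\<Sum>m\<in>h ` JN N. F m)" using JN(3) by (simp add: sum.reindex)
  also have "\<dots> \<le> (\<Sum>m. F m)" using assms JN(1) by (intro sum_le_suminf) auto
  finally show ?thesis .
qed

text \<open>The lower tail works with finitely many blocks, which must already contain a prescribed
  finite part of the decreasing list.\<close>

lemma JN_exhausts: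
  assumes "finite F" "F \<subseteq> {m. s m > 0}"
  shows "\<exists>N0. \<forall>N\<ge>N0. F \<subseteq> h ` JN N"
proof -
  have "F \<subseteq> h ` J" using assms(2) h(1) by (simp add: bij_betw_def)
  then obtain P where P: "P \<subseteq> J" "finite P" "F = h ` P" using finite_subset_image[OF assms(1)] by blast
  define N0 where "N0 = Suc (Max (insert 0 (fst ` P)))"
  have "P \<subseteq> JN N" if "N \<ge> N0" for N
  proof
    fix q assume q: "q \<in> P"
    then have "fst q \<le> Max (insert 0 (fst ` P))" using P(2) by (intro Max_ge) auto
    then have "fst q < N" using that by (simp add: N0_def)
    then show "q \<in> JN N" using q P(1) by (auto simp: JN_def J_def)
  qed
  then show ?thesis using P(3) by blast
qed

lemma summable_variance: "summable (\<lambda>n. real (d n) * (\<Sum>i<d n. (\<sigma> n i)\<^sup>2))"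
proof (rule bounded_imp_summable)
  show "real (d n) * (\<Sum>i<d n. (\<sigma> n i)\<^sup>2) \<ge> 0" for n by (intro mult_nonneg_nonneg sum_nonneg) auto
  fix N
  have "(\<Sum>n<Suc N. real (d n) * (\<Sum>i<d n. (\<sigma> n i)\<^sup>2)) = (\<Sum>q\<in>JN (Suc N). (val q)\<^sup>2)"
    using \<sigma> by (subst sum_JN_val[of "\<lambda>x. x\<^sup>2"]) (auto simp: not_less intro: antisym)
  also have "\<dots> = (\<Sum>q\<in>JN (Suc N). (s (h q))\<^sup>2)"
    by (intro sum.cong refl) (simp add: h_JN)
  also have "\<dots> \<le> (\<Sum>m. (s m)\<^sup>2)" by (rule sum_JN_le_suminf[OF s_square]) simp
  finally show "(\<Sum>n\<le>N. real (d n) * (\<Sum>i<d n. (\<sigma> n i)\<^sup>2)) \<le> (\<Sum>m. (s m)\<^sup>2)" by (simp add: lessThan_Suc_atMost)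
qed

lemma AE_summable_series: "AE \<omega> in M. summable (\<lambda>n. Z \<sigma> n \<omega>)"
  by (rule AE_summable_Z[OF summable_variance])

end

section \<open>Upper tail of the series\<close>

context haar_rearrangement
begin

text \<open>A decomposition of \<open>s\<close> may split the \<open>d n\<close> copies of one
  singular value in different ways. Averaging over the copies gives a decomposition of the singular
  values themselves, and neither norm increases, by the triangle inequality and Cauchy-Schwarz. The
  infimum in \<open>K12\<close> may fail to be attained, so levels \<open>v\<close> above it are
  treated before passing to the limit.\<close>

lemma series_upper_tail:
  assumes t: "t > 0"
  shows "prob {\<omega> \<in> space M. (\<Sum>n. Z \<sigma> n \<omega>) > K12 t s} \<le> exp (- (t\<^sup>2 / 8))"
proof -
  have above: "prob {\<omega> \<in> space M. (\<Sum>n. Z \<sigma> n \<omega>) > v} \<le> exp (- (t\<^sup>2 / 8))" if v: "v > K12 t s" for v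
  proof (rule prob_series_gt_le[OF Z_measurable AE_summable_series, of 0])
    fix N
    obtain x where x: "x \<in> K12_values t s" "x < v"
      using v unfolding K12_eq
      by (subst (asm) cInf_less_iff[OF K12_values_nonempty[OF s_square] bdd_below_K12_values]) (use t in auto)
    then obtain b c where bc: "summable (\<lambda>m. \<bar>b m\<bar>)" "summable (\<lambda>m. (c m)\<^sup>2)" "\<And>m. b m + c m = s m"
      "(\<Sum>m. \<bar>b m\<bar>) + t * sqrt (\<Sum>m. (c m)\<^sup>2) < v" by (auto simp: K12_values_def)
    define \<beta> where "\<beta> = (\<Sum>m. \<bar>b m\<bar>)"
    \<comment> \<open>Chosen so that \<beta> + t w = v exactly. It lies strictly above the l2 norm
      of \<open>c\<close>, hence is positive even if \<open>c\<close> vanishes.\<close>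
    define w where "w = (v - \<beta>) / t"
    have c0: "0 \<le> sqrt (\<Sum>m. (c m)\<^sup>2)" using bc(2) by (auto intro: suminf_nonneg)
    have w: "sqrt (\<Sum>m. (c m)\<^sup>2) < w" using bc(4) t by (simp add: w_def \<beta>_def field_simps)
    then have w0: "w > 0" using c0 by linarith
    have v: "v = \<beta> + t * w" using t by (simp add: w_def)
    define avg where "avg f n i = (if \<sigma> n i > 0 then (\<Sum>j<d n. f (h (n, i, j))) / real (d n) else 0)"
      for f :: "nat \<Rightarrow> real" and n i
    have "\<sigma> n i = avg b n i + avg c n i" if "i < d n" for n i
    proof (cases "\<sigma> n i > 0")
      case True
      then have "s (h (n, i, j)) = \<sigma> n i" if "j < d n" for j
        using h(2)[of "(n, i, j)"] that \<open>i < d n\<close> by (auto simp: J_def val_def)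
      then have "(\<Sum>j<d n. b (h (n, i, j)) + c (h (n, i, j))) = real (d n) * \<sigma> n i" using bc(3) by simp
      then have "(\<Sum>j<d n. b (h (n, i, j))) + (\<Sum>j<d n. c (h (n, i, j))) = real (d n) * \<sigma> n i"
        by (simp add: sum.distrib)
      then show ?thesis using True d_pos[of n] by (simp add: avg_def add_divide_distrib[symmetric])
    qed (use \<sigma>[of n i] in \<open>simp add: avg_def\<close>)
    moreover have "(\<Sum>n<N. real (d n) * (\<Sum>i<d n. \<bar>avg b n i\<bar>)) \<le> \<beta>"
    proof -
      have "(\<Sum>n<N. real (d n) * (\<Sum>i<d n. \<bar>avg b n i\<bar>)) \<le> (\<Sum>q\<in>JN N. \<bar>b (h q)\<bar>)"
        unfolding sum_JN sum_distrib_left using d_pos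
        by (intro sum_mono) (auto simp: avg_def intro: sum_abs)
      also have "\<dots> \<le> \<beta>" unfolding \<beta>_def by (rule sum_JN_le_suminf[OF bc(1)]) simp
      finally show ?thesis .
    qed
    moreover have "(\<Sum>n<N. real (d n) * (\<Sum>i<d n. (avg c n i)\<^sup>2)) \<le> w\<^sup>2"
    proof -
      have "real (d n) * (avg c n i)\<^sup>2 \<le> (if \<sigma> n i > 0 then (\<Sum>j<d n. (c (h (n, i, j)))\<^sup>2) else 0)" for n i
      proof -
        have "(\<Sum>j<d n. c (h (n, i, j)))\<^sup>2 \<le> real (d n) * (\<Sum>j<d n. (c (h (n, i, j)))\<^sup>2)"
          using sum_squared_le_sum_of_squares[of "\<lambda>j. c (h (n, i, j))" "{..<d n}"] by (simp add: mult.commute)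
        then show ?thesis using d_pos[of n] by (simp add: avg_def power_divide power2_eq_square field_simps)
      qed
      then have "(\<Sum>n<N. real (d n) * (\<Sum>i<d n. (avg c n i)\<^sup>2)) \<le> (\<Sum>q\<in>JN N. (c (h q))\<^sup>2)"
        unfolding sum_JN sum_distrib_left by (intro sum_mono)
      also have "\<dots> \<le> (\<Sum>m. (c m)\<^sup>2)" by (rule sum_JN_le_suminf[OF bc(2)]) simp
      also have "\<dots> = (sqrt (\<Sum>m. (c m)\<^sup>2))\<^sup>2" using c0 by simp
      also have "\<dots> \<le> w\<^sup>2" using w c0 by (intro power_mono) auto
      finally show ?thesis .
    qed
    ultimately show "prob {\<omega> \<in> space M. (\<Sum>n<N. Z \<sigma> n \<omega>) > v} \<le> exp (- (t\<^sup>2 / 8))"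
      unfolding v by (rule upper_tail[OF _ _ _ w0 t])
  qed
  \<comment> \<open>The levels decrease to \<open>K12 t s\<close>, so the strict events increase to
    the event at \<open>K12 t s\<close> itself.\<close>
  have "(\<lambda>k. prob {\<omega> \<in> space M. (\<Sum>n. Z \<sigma> n \<omega>) > K12 t s + 1 / real (Suc k)})
      \<longlonglongrightarrow> prob (\<Union>k. {\<omega> \<in> space M. (\<Sum>n. Z \<sigma> n \<omega>) > K12 t s + 1 / real (Suc k)})"
  proof (rule finite_Lim_measure_incseq)
    show "incseq (\<lambda>k. {\<omega> \<in> space M. (\<Sum>n. Z \<sigma> n \<omega>) > K12 t s + 1 / real (Suc k)})"
    proof (rule incseq_SucI, safe)
      fix k \<omega> assume "(\<Sum>n. Z \<sigma> n \<omega>) > K12 t s + 1 / real (Suc k)"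
      moreover have "1 / real (Suc (Suc k)) \<le> 1 / real (Suc k)" by (intro divide_left_mono) auto
      ultimately show "(\<Sum>n. Z \<sigma> n \<omega>) > K12 t s + 1 / real (Suc (Suc k))" by linarith
    qed
  qed auto
  then have "prob (\<Union>k. {\<omega> \<in> space M. (\<Sum>n. Z \<sigma> n \<omega>) > K12 t s + 1 / real (Suc k)}) \<le> exp (- (t\<^sup>2 / 8))"
    using above by (intro LIMSEQ_le_const2) auto
  also have "(\<Union>k. {\<omega> \<in> space M. (\<Sum>n. Z \<sigma> n \<omega>) > K12 t s + 1 / real (Suc k)})
      = {\<omega> \<in> space M. (\<Sum>n. Z \<sigma> n \<omega>) > K12 t s}"
  proof (intro equalityI subsetI)
    fix \<omega> assume \<omega>: "\<omega> \<in> {\<omega> \<in> space M. (\<Sum>n. Z \<sigma> n \<omega>) > K12 t s}"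
    then obtain k where "1 / real (Suc k) < (\<Sum>n. Z \<sigma> n \<omega>) - K12 t s"
      using nat_approx_posE[of "(\<Sum>n. Z \<sigma> n \<omega>) - K12 t s"] by auto
    then have "K12 t s + 1 / real (Suc k) < (\<Sum>n. Z \<sigma> n \<omega>)" by linarith
    then show "\<omega> \<in> (\<Union>k. {\<omega> \<in> space M. (\<Sum>n. Z \<sigma> n \<omega>) > K12 t s + 1 / real (Suc k)})" using \<omega> by blast
  next
    fix \<omega> assume "\<omega> \<in> (\<Union>k. {\<omega> \<in> space M. (\<Sum>n. Z \<sigma> n \<omega>) > K12 t s + 1 / real (Suc k)})"
    then obtain k where k: "\<omega> \<in> space M" "(\<Sum>n. Z \<sigma> n \<omega>) > K12 t s + 1 / real (Suc k)" by blast
    have "0 < 1 / real (Suc k)" by simp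
    then have "(\<Sum>n. Z \<sigma> n \<omega>) > K12 t s" using k(2) by linarith
    then show "\<omega> \<in> {\<omega> \<in> space M. (\<Sum>n. Z \<sigma> n \<omega>) > K12 t s}" using k(1) by simp
  qed
  finally show ?thesis .
qed

end

section \<open>Lower tail of the series\<close>

context haar_rearrangement
begin

text \<open>\<open>H\<close> is the sum of the values above \<tau> and \<rho> the l2 norm of the
  others, so K12 t s <= H + t \<rho> is at most twice the larger term. If \<open>H\<close>
  dominates, the level H/256 is at least K12 t s / 512; otherwise the level t \<rho> / 1920 is at
  least K12 t s / 3840.\<close>

lemma series_lower_tail_large_t:
  assumes t: "t \<ge> 256" and nz: "\<exists>m. s m \<noteq> 0"
  shows "exp (- (128 * t\<^sup>2)) / 8 \<le> prob {\<omega> \<in> space M. (\<Sum>n. Z \<sigma> n \<omega>) > K12 t s / 7680}"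
proof -
  define L where "L = nat \<lfloor>t\<^sup>2\<rfloor>"
  have t2: "t\<^sup>2 \<ge> 256\<^sup>2" using t by (intro power_mono) auto
  have L: "real L \<le> t\<^sup>2" "t\<^sup>2 - 1 < real L" using t2 by (auto simp: L_def)
  then have L0: "L > 0" using t2 by (auto intro: Nat.gr0I)
  \<comment> \<open>Indices start at 0, so this is the \<open>L\<close>-th largest value.\<close>
  define \<tau> where "\<tau> = s (L - 1)"
  have \<tau>: "\<tau> \<ge> 0" using s_nonneg by (simp add: \<tau>_def)
  have s_ge: "s m \<ge> \<tau>" if "m < L" for m using decseqD[OF s_decseq, of m "L - 1"] that by (simp add: \<tau>_def)
  \<comment> \<open>Strictly above \<tau>: ties at \<tau> count as low, which keeps \<open>A\<close>
    within the first \<open>L\<close> indices.\<close>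
  define A where "A = {m. s m > \<tau>}"
  have A: "A \<subseteq> {..<L}"
  proof
    fix m assume "m \<in> A"
    then have "\<not> L - 1 \<le> m" using decseqD[OF s_decseq, of "L - 1" m] by (auto simp: A_def \<tau>_def)
    then show "m \<in> {..<L}" by simp
  qed
  then have finA: "finite A" using finite_subset by blast
  define H where "H = (\<Sum>m\<in>A. s m)"
  define lo where "lo m = (if s m > \<tau> then 0 else s m)" for m
  have lo_sq: "summable (\<lambda>m. (lo m)\<^sup>2)"
    by (rule summable_comparison_test'[OF s_square, of 0]) (auto simp: lo_def)
  define \<rho> where "\<rho> = sqrt (\<Sum>m. (lo m)\<^sup>2)"
  have \<rho>0: "\<rho> \<ge> 0" unfolding \<rho>_def using lo_sq by (auto intro: suminf_nonneg)
  have \<rho>2: "\<rho>\<^sup>2 = (\<Sum>m. (lo m)\<^sup>2)" unfolding \<rho>_def using lo_sq by (auto intro: suminf_nonneg)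
  have H0: "H \<ge> 0" unfolding H_def using s_nonneg by (intro sum_nonneg)
  have K: "K12 t s \<le> H + t * \<rho>"
  proof -
    have b: "(\<lambda>m. \<bar>s m - lo m\<bar>) sums H"
      unfolding H_def using finA s_nonneg
      by (intro sums_finite[THEN back_subst[of "\<lambda>x. _ sums x"]]) (auto simp: lo_def A_def intro!: sum.cong)
    have "K12 t s \<le> (\<Sum>m. \<bar>s m - lo m\<bar>) + t * sqrt (\<Sum>m. (lo m)\<^sup>2)"
      by (rule K12_le) (use t b lo_sq in \<open>auto simp: sums_iff\<close>)
    then show ?thesis using b by (simp add: sums_iff \<rho>_def)
  qed
  \<comment> \<open>3840 is doubled to 7680 in the conclusion: K12 t s / 7680 <= u/2 < u is the
    strict gap needed in the limit of the partial sums.\<close>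
  have key: ?thesis if u: "u > 0" "K12 t s \<le> 3840 * u"
    and p: "\<And>N. N \<ge> N0 \<Longrightarrow> exp (- (128 * t\<^sup>2)) / 8 \<le> prob {\<omega> \<in> space M. (\<Sum>n<N. Z \<sigma> n \<omega>) > u}" for u N0
  proof (rule prob_series_gt_ge[OF Z_measurable AE_summable_series, of N0 _ u])
    fix N assume "N \<ge> N0"
    have "prob {\<omega> \<in> space M. (\<Sum>n<N. Z \<sigma> n \<omega>) > u} \<le> prob {\<omega> \<in> space M. (\<Sum>n<N. Z \<sigma> n \<omega>) \<ge> u}"
      by (rule finite_measure_mono) auto
    with p[OF \<open>N \<ge> N0\<close>] show "exp (- (128 * t\<^sup>2)) / 8 \<le> prob {\<omega> \<in> space M. (\<Sum>n<N. Z \<sigma> n \<omega>) \<ge> u}" by linarith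
  qed (use u in linarith)
  show ?thesis
  proof (cases "t * \<rho> \<le> H")
    case True
    have "H > 0"
    proof (rule ccontr)
      assume "\<not> H > 0"
      then have H: "H = 0" using H0 by simp
      have "s m = 0" if "m \<in> A" for m
        using H that finA s_nonneg unfolding H_def by (subst (asm) sum_nonneg_eq_0_iff) auto
      then have "A = {}" using \<tau> by (auto simp: A_def)
      moreover have "\<rho> = 0" using True H t \<rho>0 by (simp add: mult_le_0_iff)
      then have "(\<Sum>m. (lo m)\<^sup>2) = 0" using \<rho>2 by simp
      then have "\<forall>m. lo m = 0" using suminf_eq_zero_iff[OF lo_sq] by simp
      ultimately have "s m = 0" for m by (auto simp: lo_def A_def split: if_splits)
      then show False using nz by blast
    qed
    define B where "B n = {i. i < d n \<and> \<sigma> n i > \<tau>}" for n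
    obtain N0 where N0: "\<And>N. N \<ge> N0 \<Longrightarrow> A \<subseteq> h ` JN N"
      using JN_exhausts[OF finA] \<tau> by (force simp: A_def)
    show ?thesis
    proof (rule key[of "H / 256" N0])
      fix N assume N: "N \<ge> N0"
      define Q where "Q = {q \<in> JN N. val q > \<tau>}"
      have hQ: "h ` Q = A" "inj_on h Q" "finite Q"
      proof -
        show "h ` Q = A"
        proof
          show "h ` Q \<subseteq> A" by (auto simp: Q_def A_def h_JN)
          show "A \<subseteq> h ` Q"
          proof
            fix m assume m: "m \<in> A"
            then obtain q where q: "q \<in> JN N" "m = h q" using N0[OF N] by blast
            then have "val q = s m" by (simp add: h_JN)
            then show "m \<in> h ` Q" using q m by (auto simp: Q_def A_def)
          qed
        qed
        show "inj_on h Q" "finite Q"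
          using JN(1) inj_on_subset[OF JN(3), of Q N] by (auto simp: Q_def)
      qed
      \<comment> \<open>Applied to the constant 1 this counts the large values, applied to the
        identity it gives \<open>H\<close>. Both are exact, since the first \<open>N\<close> blocks
        already contain all of \<open>A\<close>.\<close>
      have sumQ: "(\<Sum>n<N. real (d n) * (\<Sum>i\<in>B n. F (\<sigma> n i))) = (\<Sum>m\<in>A. F (s m))" for F :: "real \<Rightarrow> real"
      proof -
        have "(\<Sum>m\<in>A. F (s m)) = (\<Sum>q\<in>Q. F (val q))"
          unfolding hQ(1)[symmetric] sum.reindex[OF hQ(2)] by (intro sum.cong refl) (auto simp: Q_def h_JN)
        also have "\<dots> = (\<Sum>q\<in>JN N. if val q > \<tau> then F (val q) else 0)"
          unfolding Q_def using JN(1) by (subst sum.inter_filter) auto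
        also have "\<dots> = (\<Sum>n<N. real (d n) * (\<Sum>i<d n. if \<sigma> n i > \<tau> then F (\<sigma> n i) else 0))"
          using \<tau> by (subst sum_JN_val[of "\<lambda>x. if x > \<tau> then F x else 0"]) auto
        also have "\<dots> = (\<Sum>n<N. real (d n) * (\<Sum>i\<in>B n. F (\<sigma> n i)))"
          by (simp only: B_def sum_less_filter)
        finally show ?thesis ..
      qed
      have "exp (- (128 * t\<^sup>2)) / 4 \<le> prob {\<omega> \<in> space M. (\<Sum>n<N. Z \<sigma> n \<omega>) > H / 256}"
      proof (rule lower_tail_large_values[of B])
        have "(\<Sum>n<N. real (d n) * real (card (B n))) = real (card A)" using sumQ[of "\<lambda>_. 1"] by simp
        also have "\<dots> \<le> real L" using card_mono[OF _ A] by simp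
        also have "\<dots> \<le> t\<^sup>2" by (rule L(1))
        finally show "(\<Sum>n<N. real (d n) * real (card (B n))) \<le> t\<^sup>2" .
        show "H = (\<Sum>n<N. real (d n) * (\<Sum>i\<in>B n. \<sigma> n i))" using sumQ[of "\<lambda>x. x"] by (simp add: H_def)
      qed (use \<open>H > 0\<close> t \<sigma> in \<open>auto simp: B_def\<close>)
      moreover have "exp (- (128 * t\<^sup>2)) / 8 \<le> exp (- (128 * t\<^sup>2)) / 4" by simp
      ultimately show "exp (- (128 * t\<^sup>2)) / 8 \<le> prob {\<omega> \<in> space M. (\<Sum>n<N. Z \<sigma> n \<omega>) > H / 256}" by linarith
    qed (use \<open>H > 0\<close> K True in auto)
  next
    case False
    then have H: "H < t * \<rho>" by simp
    have "\<rho> > 0" using H H0 t \<rho>0 by (cases "\<rho> = 0") auto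
    \<comment> \<open>The first \<open>L\<close> values are all at least \<tau>. Each pays for one
      \<tau>^2, either in \<tau> H or in \<rho>^2, so L \<tau>^2 <= \<tau> t \<rho> + \<rho>^2. With
      L >= t^2/2 and z = t \<tau> this reads z^2/2 <= z \<rho> + \<rho>^2, which fails for z > 3
      \<rho>.\<close>
    have t\<tau>: "t * \<tau> \<le> 3 * \<rho>"
    proof (rule ccontr)
      assume "\<not> ?thesis"
      then have x: "t * \<tau> > 3 * \<rho>" by simp
      have "real L * \<tau>\<^sup>2 = (\<Sum>m<L. \<tau>\<^sup>2)" by simp
      also have "\<dots> \<le> (\<Sum>m<L. (if m \<in> A then \<tau> * s m else 0) + (lo m)\<^sup>2)"
      proof (rule sum_mono)
        fix m assume "m \<in> {..<L}"
        then have "s m \<ge> \<tau>" using s_ge by simp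
        then show "\<tau>\<^sup>2 \<le> (if m \<in> A then \<tau> * s m else 0) + (lo m)\<^sup>2"
          using \<tau> by (auto simp: A_def lo_def power2_eq_square mult_left_mono intro: add_increasing2)
      qed
      also have "\<dots> = (\<Sum>m\<in>A. \<tau> * s m) + (\<Sum>m<L. (lo m)\<^sup>2)"
      proof -
        have "(\<Sum>m<L. if m \<in> A then \<tau> * s m else 0) = (\<Sum>m\<in>A. \<tau> * s m)"
          using A by (intro sum.mono_neutral_cong_right) auto
        then show ?thesis by (simp add: sum.distrib)
      qed
      also have "(\<Sum>m\<in>A. \<tau> * s m) = \<tau> * H" by (simp add: H_def sum_distrib_left)
      also have "(\<Sum>m<L. (lo m)\<^sup>2) \<le> \<rho>\<^sup>2" unfolding \<rho>2 using lo_sq by (intro sum_le_suminf) auto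
      also have "\<tau> * H \<le> \<tau> * (t * \<rho>)" using H \<tau> by (intro mult_left_mono) auto
      finally have "real L * \<tau>\<^sup>2 \<le> (t * \<tau>) * \<rho> + \<rho>\<^sup>2" by (simp add: mult_ac)
      moreover have "(t * \<tau>)\<^sup>2 / 2 \<le> real L * \<tau>\<^sup>2"
      proof -
        have "t\<^sup>2 / 2 * \<tau>\<^sup>2 \<le> real L * \<tau>\<^sup>2" using L t2 by (intro mult_right_mono) auto
        then show ?thesis by (simp add: power_mult_distrib)
      qed
      ultimately have 1: "(t * \<tau>)\<^sup>2 / 2 \<le> (t * \<tau>) * \<rho> + \<rho>\<^sup>2" by linarith
      have "3 * \<rho> * (\<rho> / 2) \<le> (t * \<tau>) * (t * \<tau> / 2 - \<rho>)" by (rule mult_mono) (use x \<rho>0 in linarith)+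
      then have "3 / 2 * \<rho>\<^sup>2 \<le> (t * \<tau>)\<^sup>2 / 2 - (t * \<tau>) * \<rho>" by (simp add: power2_eq_square algebra_simps)
      then have "\<rho>\<^sup>2 \<le> 0" using 1 by linarith
      then show False using \<open>\<rho> > 0\<close> by simp
    qed
    define B where "B n = {i. i < d n \<and> \<sigma> n i \<le> \<tau>}" for n
    \<comment> \<open>Finitely many blocks are made to carry more than half of \<rho>^2.\<close>
    have "(\<lambda>k. \<Sum>m<k. (lo m)\<^sup>2) \<longlonglongrightarrow> \<rho>\<^sup>2" unfolding \<rho>2 using lo_sq by (rule summable_LIMSEQ)
    moreover have "\<rho>\<^sup>2 / 2 < \<rho>\<^sup>2" using \<open>\<rho> > 0\<close> by simp
    ultimately have "\<forall>\<^sub>F k in sequentially. \<rho>\<^sup>2 / 2 < (\<Sum>m<k. (lo m)\<^sup>2)" by (rule order_tendstoD)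
    then obtain k where k: "\<rho>\<^sup>2 / 2 < (\<Sum>m<k. (lo m)\<^sup>2)" by (auto simp: eventually_sequentially)
    define C where "C = {m. m < k \<and> 0 < s m \<and> s m \<le> \<tau>}"
    obtain N0 where N0: "\<And>N. N \<ge> N0 \<Longrightarrow> C \<subseteq> h ` JN N"
      using JN_exhausts[of C] by (force simp: C_def)
    have wN: "\<rho>\<^sup>2 / 2 < (\<Sum>n<N. real (d n) * (\<Sum>i\<in>B n. (\<sigma> n i)\<^sup>2))" if N: "N \<ge> N0" for N
    proof -
      have "(\<Sum>m<k. (lo m)\<^sup>2) = (\<Sum>m\<in>C. (lo m)\<^sup>2)"
        using s_nonneg by (intro sum.mono_neutral_right) (auto simp: C_def lo_def not_less intro: antisym)
      also have "\<dots> \<le> (\<Sum>m\<in>h ` JN N. (lo m)\<^sup>2)"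
        using N0[OF N] JN(1) by (intro sum_mono2) auto
      also have "\<dots> = (\<Sum>q\<in>JN N. (lo (h q))\<^sup>2)" using JN(3) by (simp add: sum.reindex)
      also have "\<dots> = (\<Sum>q\<in>JN N. if val q > \<tau> then 0 else (val q)\<^sup>2)"
        by (intro sum.cong refl) (auto simp: lo_def h_JN)
      also have "\<dots> = (\<Sum>n<N. real (d n) * (\<Sum>i<d n. if \<sigma> n i > \<tau> then 0 else (\<sigma> n i)\<^sup>2))"
        using \<sigma> by (subst sum_JN_val[of "\<lambda>x. if x > \<tau> then 0 else x\<^sup>2"]) (auto simp: not_less intro: antisym)
      also have "\<dots> = (\<Sum>n<N. real (d n) * (\<Sum>i\<in>B n. (\<sigma> n i)\<^sup>2))"
        unfolding B_def sum_less_filter by (intro sum.cong refl arg_cong2[of _ _ _ _ "(*)"]) auto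
      finally show ?thesis using k by linarith
    qed
    show ?thesis
    proof (rule key[of "t * \<rho> / 1920" N0])
      show "K12 t s \<le> 3840 * (t * \<rho> / 1920)" using K H by (simp add: mult.commute)
      show "t * \<rho> / 1920 > 0" using t \<open>\<rho> > 0\<close> by simp
      fix N assume N: "N \<ge> N0"
      define w where "w = sqrt (\<Sum>n<N. real (d n) * (\<Sum>i\<in>B n. (\<sigma> n i)\<^sup>2))"
      have w2: "w\<^sup>2 = (\<Sum>n<N. real (d n) * (\<Sum>i\<in>B n. (\<sigma> n i)\<^sup>2))"
        unfolding w_def using wN[OF N] zero_le_power2[of \<rho>] by (intro real_sqrt_pow2) linarith
      have w0: "w \<ge> 0" unfolding w_def by (intro real_sqrt_ge_zero sum_nonneg mult_nonneg_nonneg) auto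
      \<comment> \<open>From w^2 > \<rho>^2/2 one gets 4 \<rho>^2 <= 9 w^2. Hence t \<tau> <= 3
        \<rho> <= 9 w / 2, within the permitted 5 w, and t w / 1280 >= t \<rho> / 1920.\<close>
      have \<rho>w: "2 * \<rho> \<le> 3 * w"
      proof (rule power2_le_imp_le)
        show "(2 * \<rho>)\<^sup>2 \<le> (3 * w)\<^sup>2" using wN[OF N] w2 zero_le_power2[of w] unfolding power_mult_distrib by simp
      qed (use w0 in simp)
      then have "w > 0" using \<open>\<rho> > 0\<close> by linarith
      have "exp (- (128 * t\<^sup>2)) / 8 \<le> prob {\<omega> \<in> space M. (\<Sum>n<N. Z \<sigma> n \<omega>) > t * w / 1280}"
      proof (rule lower_tail_small_values[of B])
        fix n i assume i: "i \<in> B n"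
        have "t * \<bar>\<sigma> n i\<bar> \<le> t * \<tau>" using i t \<sigma>[of n i] by (intro mult_left_mono) (auto simp: B_def)
        also have "\<dots> \<le> 5 * w" using t\<tau> \<rho>w w0 by linarith
        finally show "t * \<bar>\<sigma> n i\<bar> \<le> 5 * w" .
      qed (use w2 \<open>w > 0\<close> t in \<open>auto simp: B_def\<close>)
      also have "\<dots> \<le> prob {\<omega> \<in> space M. (\<Sum>n<N. Z \<sigma> n \<omega>) > t * \<rho> / 1920}"
      proof (rule finite_measure_mono)
        have "t * (2 * \<rho>) \<le> t * (3 * w)" using \<rho>w t by (intro mult_left_mono) auto
        then have "t * \<rho> / 1920 \<le> t * w / 1280" by (simp add: mult_ac)
        then show "{\<omega> \<in> space M. (\<Sum>n<N. Z \<sigma> n \<omega>) > t * w / 1280} \<subseteq> {\<omega> \<in> space M. (\<Sum>n<N. Z \<sigma> n \<omega>) > t * \<rho> / 1920}"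
          using le_less_trans by blast
      qed measurable
      finally show "exp (- (128 * t\<^sup>2)) / 8 \<le> prob {\<omega> \<in> space M. (\<Sum>n<N. Z \<sigma> n \<omega>) > t * \<rho> / 1920}" .
    qed
  qed
qed

end

section \<open>From the matrix series to weighted diagonal sums, and the choice of the
  constant\<close>

lemma mat_trace_mult_commute:
  assumes "P \<in> carrier_mat n n" "Q \<in> carrier_mat n n"
  shows "mat_trace (P * Q) = mat_trace (Q * P)"
proof -
  have tr: "mat_trace (X * Y) = (\<Sum>i<n. \<Sum>k<n. X $$ (i, k) * Y $$ (k, i))"
    if "X \<in> carrier_mat n n" "Y \<in> carrier_mat n n" for X Y
    using that unfolding mat_trace_def by (auto simp: mat_mult_entry[of _ n] simp del: index_mult_mat(1) intro!: sum.cong)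
  show ?thesis unfolding tr[OF assms] tr[OF assms(2,1)] by (subst sum.swap) (simp add: mult.commute)
qed

text \<open>Cyclicity of the trace moves both orthogonal factors to \<open>X\<close>, so that V^T X
  U meets a diagonal matrix.\<close>

lemma mat_trace_svd:
  assumes U: "U \<in> carrier_mat n n" and V: "V \<in> carrier_mat n n" and X: "X \<in> carrier_mat n n"
  shows "mat_trace (X * (U * mat_diag n f * transpose_mat V)) = (\<Sum>i<n. f i * (transpose_mat V * X * U) $$ (i, i))"
proof -
  define D where "D = mat_diag n f"
  have D: "D \<in> carrier_mat n n" by (simp add: D_def)
  have "X * (U * D * transpose_mat V) = (X * U * D) * transpose_mat V"
    using U V X D by (simp add: assoc_mult_mat[of _ n n _ n _ n])
  then have "mat_trace (X * (U * D * transpose_mat V)) = mat_trace (transpose_mat V * (X * U * D))"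
    using U V X D by (simp add: mat_trace_mult_commute[of _ n])
  also have "transpose_mat V * (X * U * D) = (transpose_mat V * X * U) * D"
    using U V X D by (simp add: assoc_mult_mat[of _ n n _ n _ n])
  also have "mat_trace \<dots> = (\<Sum>i<n. f i * (transpose_mat V * X * U) $$ (i, i))"
    using U V X unfolding D_def
    by (subst mat_diag_mult_right[of _ n n]) (auto simp: mat_trace_def mult.commute simp del: index_mult_mat(1) intro!: sum.cong)
  finally show ?thesis by (simp add: D_def)
qed

text \<open>The matrices \<open>\<eta> n\<close> absorb the orthogonal factors of the singular value
  decomposition; they are independent and again Haar distributed. The level \<open>u\<close> is left
  free so that the constants of the two bounds can be merged into one.\<close>

lemma orthogonal_series_tails:
  assumes "prob_space M" and d: "\<And>n. d n > 0" and A: "\<And>n. A n \<in> carrier_mat (d n) (d n)"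
    and ind: "prob_space.indep_vars M (\<lambda>n. orthogonal_borel (d n)) eps UNIV"
    and haar: "\<And>n. haar_orthogonal (d n) (distr M (orthogonal_borel (d n)) (eps n))"
    and s: "decreasing_singular_values d A s" "summable (\<lambda>m. (s m)\<^sup>2)" and t: "t > 0"
  shows "K12 t s \<le> u \<Longrightarrow> \<P>(\<omega> in M. orthogonal_series d A eps \<omega> > u) \<le> exp (- (t\<^sup>2 / 8))"
    and "t \<ge> 256 \<Longrightarrow> \<exists>m. s m \<noteq> 0 \<Longrightarrow> u \<le> K12 t s / 7680 \<Longrightarrow>
      exp (- (128 * t\<^sup>2)) / 8 \<le> \<P>(\<omega> in M. orthogonal_series d A eps \<omega> > u)"
proof -
  interpret prob_space M by fact
  have "\<exists>U V f. U \<in> orthogonal_group (d n) \<and> V \<in> orthogonal_group (d n) \<and> (\<forall>i. f i \<ge> 0) \<and>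
      A n = U * mat_diag (d n) f * transpose_mat V" for n
    using singular_value_decomposition[OF A] by blast
  then obtain U V \<sigma> where UV: "\<And>n. U n \<in> orthogonal_group (d n)" "\<And>n. V n \<in> orthogonal_group (d n)"
    "\<And>n i. \<sigma> n i \<ge> (0::real)" "\<And>n. A n = U n * mat_diag (d n) (\<sigma> n) * transpose_mat (V n)" by metis
  define \<eta> where "\<eta> n \<omega> = transpose_mat (V n) * eps n \<omega> * U n" for n \<omega>
  have eps: "eps n \<in> M \<rightarrow>\<^sub>M orthogonal_borel (d n)" for n using ind by (auto simp: indep_vars_def)
  note VT = orthogonal_group_transpose[OF UV(2)]
  have conj: "(\<lambda>X. transpose_mat (V n) * X * U n) \<in> orthogonal_borel (d n) \<rightarrow>\<^sub>M orthogonal_borel (d n)" for n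
    by (rule measurable_conjugation[OF VT UV(1)])
  interpret haar_rearrangement M d \<eta> \<sigma> s
  proof unfold_locales
    show "indep_vars (\<lambda>n. orthogonal_borel (d n)) \<eta> UNIV"
      unfolding \<eta>_def using indep_vars_compose2[OF ind conj] by simp
    show "haar_orthogonal (d n) (distr M (orthogonal_borel (d n)) (\<eta> n))" for n
      unfolding \<eta>_def by (rule haar_conjugate[OF VT UV(1) eps haar])
    show "finite {m. s m = x}" "(\<lambda>n. d n * card {i. i < d n \<and> \<sigma> n i = x}) sums card {m. s m = x}" if "x > 0" for x
      using s(1) that count_singular_values[OF UV(1,2,3,4)] by (auto simp: decreasing_singular_values_def)
  qed (use d UV(3) s in \<open>auto simp: decreasing_singular_values_def\<close>)
  have series: "orthogonal_series d A eps \<omega> = (\<Sum>n. Z \<sigma> n \<omega>)" if "\<omega> \<in> space M" for \<omega>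
    unfolding orthogonal_series_def
  proof (rule suminf_cong)
    fix n
    have e: "eps n \<omega> \<in> carrier_mat (d n) (d n)"
      using measurable_space[OF eps that] orthogonal_groupD(1) by simp
    show "real (d n) * mat_trace (eps n \<omega> * A n) = Z \<sigma> n \<omega>"
      unfolding UV(4) mat_trace_svd[OF orthogonal_groupD(1)[OF UV(1)] orthogonal_groupD(1)[OF UV(2)] e]
      by (simp add: Z_def haar.dtr_def[OF haar.intro[OF haar_distr]] ent_def \<eta>_def)
  qed
  have ev: "\<P>(\<omega> in M. orthogonal_series d A eps \<omega> > u) = prob {\<omega> \<in> space M. (\<Sum>n. Z \<sigma> n \<omega>) > u}" for u
    by (rule arg_cong[of _ _ prob]) (auto simp: series)
  have mono: "prob {\<omega> \<in> space M. (\<Sum>n. Z \<sigma> n \<omega>) > v} \<le> prob {\<omega> \<in> space M. (\<Sum>n. Z \<sigma> n \<omega>) > u}"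
    if "u \<le> v" for u v
    using that by (intro finite_measure_mono) auto
  show "\<P>(\<omega> in M. orthogonal_series d A eps \<omega> > u) \<le> exp (- (t\<^sup>2 / 8))" if "K12 t s \<le> u"
    unfolding ev using mono[OF that] series_upper_tail[OF t] by linarith
  show "exp (- (128 * t\<^sup>2)) / 8 \<le> \<P>(\<omega> in M. orthogonal_series d A eps \<omega> > u)"
    if "t \<ge> 256" "\<exists>m. s m \<noteq> 0" "u \<le> K12 t s / 7680"
    unfolding ev using mono[OF that(3)] series_lower_tail_large_t[OF that(1,2)] by linarith
qed

text \<open>Enlarging \<open>c\<close> weakens both bounds, so one large value serves for both. The
  second bound excludes s = 0: there all \<open>A n\<close> vanish, the series and
  \<open>K12 t s\<close> are 0, and the strict event is empty.\<close>

theorem theorem2p1: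
  shows "\<exists>c::real. c > 0 \<and>
    (\<forall>(M :: 'w measure) (d :: nat \<Rightarrow> nat) (A :: nat \<Rightarrow> real mat)
      (eps :: nat \<Rightarrow> 'w \<Rightarrow> real mat) (s :: nat \<Rightarrow> real).
      prob_space M \<longrightarrow>
      (\<forall>n. d n > 0) \<longrightarrow>
      (\<forall>n. A n \<in> carrier_mat (d n) (d n)) \<longrightarrow>
      prob_space.indep_vars M (\<lambda>n. orthogonal_borel (d n)) eps UNIV \<longrightarrow>
      (\<forall>n. haar_orthogonal (d n) (distr M (orthogonal_borel (d n)) (eps n))) \<longrightarrow>
      decreasing_singular_values d A s \<longrightarrow>
      summable (\<lambda>m. (s m)\<^sup>2) \<longrightarrow>
      (\<forall>t>0.
        \<P>(\<omega> in M. orthogonal_series d A eps \<omega> > c * K12 t s) \<le> c * exp (- (t\<^sup>2 / c)) \<and>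
        ((\<exists>m. s m \<noteq> 0) \<longrightarrow>
          \<P>(\<omega> in M. orthogonal_series d A eps \<omega> > K12 t s / c) \<ge> exp (- (c * t\<^sup>2)) / c)))"
proof -
  \<comment> \<open>8388608 is 128 times 256^2, so 1/c equals the lower bound exp (-128 t^2) / 8 at
    t = 256.\<close>
  define c where "c = 8 * exp (8388608 :: real)"
  have "1 + 8388608 \<le> exp (8388608 :: real)" by (rule exp_ge_add_one_self)
  then have c: "c \<ge> 8" "c \<ge> 7680" "c \<ge> 128" by (simp_all add: c_def)
  show ?thesis
  proof (intro exI[of _ c] conjI allI impI)
    fix M :: "'w measure" and d :: "nat \<Rightarrow> nat" and A :: "nat \<Rightarrow> real mat"
      and eps :: "nat \<Rightarrow> 'w \<Rightarrow> real mat" and s :: "nat \<Rightarrow> real" and t :: real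
    assume M: "prob_space M" and d: "\<forall>n. d n > 0" and A: "\<forall>n. A n \<in> carrier_mat (d n) (d n)"
      and ind: "prob_space.indep_vars M (\<lambda>n. orthogonal_borel (d n)) eps UNIV"
      and haar: "\<forall>n. haar_orthogonal (d n) (distr M (orthogonal_borel (d n)) (eps n))"
      and s: "decreasing_singular_values d A s" "summable (\<lambda>m. (s m)\<^sup>2)" and t: "t > 0"
    note tails = orthogonal_series_tails[OF M d[rule_format] A[rule_format] ind haar[rule_format] s]
    have K: "K12 t s \<ge> 0" using K12_nonneg[OF _ s(2)] t by simp
    have "K12 t s \<le> c * K12 t s" using K c mult_right_mono[of 1 c "K12 t s"] by simp
    then have "\<P>(\<omega> in M. orthogonal_series d A eps \<omega> > c * K12 t s) \<le> exp (- (t\<^sup>2 / 8))"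
      by (rule tails(1)[OF t])
    also have "\<dots> \<le> exp (- (t\<^sup>2 / c))"
      unfolding exp_le_cancel_iff neg_le_iff_le using c by (intro divide_left_mono) auto
    also have "\<dots> \<le> c * exp (- (t\<^sup>2 / c))" using c by simp
    finally show "\<P>(\<omega> in M. orthogonal_series d A eps \<omega> > c * K12 t s) \<le> c * exp (- (t\<^sup>2 / c))" .
    assume nz: "\<exists>m. s m \<noteq> 0"
    show "\<P>(\<omega> in M. orthogonal_series d A eps \<omega> > K12 t s / c) \<ge> exp (- (c * t\<^sup>2)) / c"
    proof (cases "t \<ge> 256")
      case True
      have "exp (- (c * t\<^sup>2)) / c \<le> exp (- (128 * t\<^sup>2)) / 8"
        using c by (intro frac_le) (auto intro: mult_right_mono)
      also have "\<dots> \<le> \<P>(\<omega> in M. orthogonal_series d A eps \<omega> > K12 t s / c)"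
        by (rule tails(2)[OF t True nz]) (use K c in \<open>intro divide_left_mono, auto\<close>)
      finally show ?thesis .
    next
      \<comment> \<open>Small \<open>t\<close> is reduced to \<open>t = 256\<close> by monotonicity of \<open>K12\<close>; this fixes the size of \<open>c\<close>.\<close>
      case False
      have "exp (- (c * t\<^sup>2)) / c \<le> 1 / c" using c by (intro divide_right_mono) auto
      also have "\<dots> = exp (- (128 * 256\<^sup>2)) / 8" by (simp add: c_def exp_minus field_simps)
      also have "\<dots> \<le> \<P>(\<omega> in M. orthogonal_series d A eps \<omega> > K12 t s / c)"
      proof (rule tails(2)[OF _ _ nz])
        have "K12 t s \<le> K12 256 s" using False t s(2) by (intro K12_mono) auto
        then show "K12 t s / c \<le> K12 256 s / 7680" using K c by (intro frac_le) auto
      qed auto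
      finally show ?thesis .
    qed
  qed (use c in simp)
qed

end
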